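(* Let $(M;c)$ be a connected, modular coloured matroid. The following are equivalent: (i) $(M;c)$ has no rainbow triangle; (ii) $(M;c)$ has no rainbow circuit of size $3$ or more; (iii) there are mutually skew nonempty flats $F_1,\dots,F_t$ of $M$ such that $c=\bigotimes_{i=1}^t (c|F_i)$, the colouring $c|F_i$ is simple with $|c(F_i)|\le2$ for all $i\ge2$, and either $r_M(F_1)=1$ or $|c(F_1)|\le2$.
   Context: A coloured matroid $(M;c)$ is a (finite) matroid $M$ with a function $c$ on $E(M)$; $c(X)$ is the set of colours on $X$, $c|X$ the restriction. $M$ is modular if $r_M(F)+r_M(F')=r_M(F\cup F')+r_M(F\cap F')$ for all flats $F,F'$. A set is rainbow if $c$ is injective on it; a triangle is a three-element circuit. A colouring $d$ of a flat $F$ is simple (in $M$) if $F$ contains no loop of $M$ and $d(e)=d(f)$ whenever $e,f\in F$ are parallel. Flats $F_1,\dots,F_t$ are mutually skew if $r_M(\bigcup_iF_i)=\sum_i r_M(F_i)$. Lift-join: if $F_1,F_2$ are skew flats of a modular matroid $M$, $c_1$ a colouring of $F_1$ and $c_2$ a simple colouring of $F_2$, then $c_1\otimes c_2$ is the colouring $d$ of $\mathrm{cl}_M(F_1\cup F_2)$ with $d(e)=c_1(e)$ for $e\in F_1$, and, for $e\in\mathrm{cl}_M(F_1\cup F_2)-F_1$, $d(e)$ is the unique element of $c_2(\mathrm{cl}_M(F_1\cup\{e\})\cap F_2)$ (this intersection is a single parallel class). For mutually skew flats, $\bigotimes_{i=1}^t c_i=(\cdots((c_1\otimes c_2)\otimes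 c_3)\cdots)\otimes c_t$ (for $t=0$ this is the empty colouring of $\mathrm{cl}_M(\varnothing)$). *)

theory Defs
  imports Main
begin

record 'a matroid =
  ground :: "'a set"
  indep :: "'a set \<Rightarrow> bool"

locale matroid =
  fixes M :: "'a matroid"
  assumes finite_ground: "finite (ground M)"
    and indep_subset_ground: "indep M X \<Longrightarrow> X \<subseteq> ground M"
    and indep_empty: "indep M {}"
    and indep_mono: "indep M Y \<Longrightarrow> X \<subseteq> Y \<Longrightarrow> indep M X"
    and indep_augment:
      "indep M X \<Longrightarrow> indep M Y \<Longrightarrow> card X < card Y \<Longrightarrow> \<exists>e\<in>Y - X. indep M (insert e X)"

definition mrank :: "'a matroid \<Rightarrow> 'a set \<Rightarrow> nat" where
  "mrank M X = Max {card I | I. I \<subseteq> X \<and> indep M I}"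

definition mcl :: "'a matroid \<Rightarrow> 'a set \<Rightarrow> 'a set" where
  "mcl M X = {e \<in> ground M. mrank M (insert e X) = mrank M X}"

definition mflat :: "'a matroid \<Rightarrow> 'a set \<Rightarrow> bool" where
  "mflat M F \<longleftrightarrow> F \<subseteq> ground M \<and> mcl M F = F"

definition mcircuit :: "'a matroid \<Rightarrow> 'a set \<Rightarrow> bool" where
  "mcircuit M C \<longleftrightarrow> C \<subseteq> ground M \<and> \<not> indep M C \<and> (\<forall>X. X \<subset> C \<longrightarrow> indep M X)"

definition mtriangle :: "'a matroid \<Rightarrow> 'a set \<Rightarrow> bool" where
  "mtriangle M T \<longleftrightarrow> mcircuit M T \<and> card T = 3"

definition mloop :: "'a matroid \<Rightarrow> 'a \<Rightarrow> bool" where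
  "mloop M e \<longleftrightarrow> mcircuit M {e}"

definition mparallel :: "'a matroid \<Rightarrow> 'a \<Rightarrow> 'a \<Rightarrow> bool" where
  "mparallel M e f \<longleftrightarrow> e \<noteq> f \<and> mcircuit M {e, f}"

text \<open>As usual, the empty matroid and every one-element matroid are connected.\<close>

definition mconnected :: "'a matroid \<Rightarrow> bool" where
  "mconnected M \<longleftrightarrow>
    (\<forall>e\<in>ground M. \<forall>f\<in>ground M. e \<noteq> f \<longrightarrow> (\<exists>C. mcircuit M C \<and> e \<in> C \<and> f \<in> C))"

definition mmodular :: "'a matroid \<Rightarrow> bool" where
  "mmodular M \<longleftrightarrow>
    (\<forall>F F'. mflat M F \<longrightarrow> mflat M F' \<longrightarrow>
      mrank M F + mrank M F' = mrank M (F \<union> F') + mrank M (F \<inter> F'))"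

definition mutually_skew :: "'a matroid \<Rightarrow> 'a set list \<Rightarrow> bool" where
  "mutually_skew M Fs \<longleftrightarrow> mrank M (\<Union>(set Fs)) = (\<Sum>F\<leftarrow>Fs. mrank M F)"

text \<open>
  A colouring of a set is a partial function whose domain is exactly that set, so that
  equality of colourings includes equality of the coloured sets, and \<open>c |` F\<close> is the
  restriction of \<open>c\<close> to \<open>F\<close>.
\<close>

definition coloured_matroid :: "'a matroid \<Rightarrow> ('a \<rightharpoonup> 'c) \<Rightarrow> bool" where
  "coloured_matroid M c \<longleftrightarrow> matroid M \<and> dom c = ground M"

definition colours :: "('a \<rightharpoonup> 'c) \<Rightarrow> 'a set \<Rightarrow> 'c set" where
  "colours c X = {k. \<exists>e\<in>X. c e = Some k}"

definition rainbow :: "('a \<rightharpoonup> 'c) \<Rightarrow> 'a set \<Rightarrow> bool" where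
  "rainbow c X \<longleftrightarrow> inj_on c X"

definition simple_colouring :: "'a matroid \<Rightarrow> ('a \<rightharpoonup> 'c) \<Rightarrow> bool" where
  "simple_colouring M d \<longleftrightarrow>
    (\<forall>e\<in>dom d. \<not> mloop M e) \<and>
    (\<forall>e\<in>dom d. \<forall>f\<in>dom d. mparallel M e f \<longrightarrow> d e = d f)"

text \<open>
  The definite description is meaningful when \<open>dom c1\<close> and \<open>dom c2\<close> are skew flats of a
  modular matroid and \<open>c2\<close> is a simple colouring.
\<close>

definition lift_join :: "'a matroid \<Rightarrow> ('a \<rightharpoonup> 'c) \<Rightarrow> ('a \<rightharpoonup> 'c) \<Rightarrow> ('a \<rightharpoonup> 'c)" where
  "lift_join M c1 c2 = (\<lambda>e.
     if e \<in> dom c1 then c1 e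
     else if e \<in> mcl M (dom c1 \<union> dom c2)
       then Some (THE k. k \<in> colours c2 (mcl M (dom c1 \<union> {e}) \<inter> dom c2))
     else None)"

text \<open>
  The iteration starts from the first colouring rather than from the empty one, since the
  first colouring need not be simple and so need not be a legitimate right-hand operand.
\<close>

fun lift_joins :: "'a matroid \<Rightarrow> ('a \<rightharpoonup> 'c) list \<Rightarrow> ('a \<rightharpoonup> 'c)" where
  "lift_joins M [] = Map.empty"
| "lift_joins M (c # cs) = foldl (lift_join M) c cs"

end

(*
  A minimal rainbow circuit shrinks to a rainbow triangle because the line through two of its
  elements meets the flat spanned by the others.  The substance is the passage from the absence of
  rainbow triangles to the decomposition.  There the key fact is that the points of a finite
  projective geometry cannot be divided into three spanning classes such that no line meets all
  three.  Finiteness is essential: over an infinite field valuations give such divisions (the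
  colouring in Monsky's theorem).  In a plane one counts.  The number of points of a class on a
  line depends only on the pair of classes that the line meets, and counting each class once through
  a point of another class and once through a point of its own gives equations without solutions.
  In higher rank take a hyperplane K through a point of each class.  By induction some class A does
  not span K; contracting the flat spanned by the points of A in K, and colouring by A every coset
  outside K that meets A, gives a smaller counterexample.

  Now let H be a maximal proper flat such that all elements of cl(H + e) - H have the same colour,
  for every e outside H.  If three colours occurred outside H, two of them and the union of the
  others would be three classes as above in the contraction of H, and a class not spanning it would
  enlarge H.  So at most two colours occur outside H, the colouring is the lift-join of its
  restrictions to H and to any complement of H, and one proceeds with H by induction on the rank.
*)
theory Submission
  imports Defs
begin

section \<open>Finite modular rank functions\<close>

text \<open>Parallel elements may have different colours, though only in the first factor. Hence the
  empty flat need not satisfy the condition on H, and the existence of any such flat is a separate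
  problem. It is solved by starting from a condition that exempts two colours, or from a parallel
  class with three colours. In higher rank, contracting the span of the points of A in K works
  because, on the rest of K, lines towards points of A cannot change between B and C. Outside K a
  coset may mix the classes, whence the recolouring by A. The danger is that A swallows all of B or
  C outside K, so that this class no longer spans; a third point on a line from B to C excludes
  this. Connectivity enters mainly as such third points; it also excludes loops from ground sets
  with more than one element. Contractions create loops and parallel elements. Therefore the
  arguments use a rank function on a fixed ground set, and actual points are chosen only in the
  plane.\<close>

definition rank_closure :: "'a set \<Rightarrow> ('a set \<Rightarrow> nat) \<Rightarrow> 'a set \<Rightarrow> 'a set" where
  "rank_closure E r X = {e \<in> E. r (insert e X) = r X}"

text \<open>The identity \<open>modular\<close> is required for arbitrary sets and so contains two
  further axioms: \<open>X = Y\<close> shows that closure keeps the rank, and monotonicity turns the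
  identity into submodularity. A restriction changes only \<open>E\<close>, a contraction only
  \<open>r\<close>.\<close>

locale modular_rank =
  fixes E :: "'a set" and r :: "'a set \<Rightarrow> nat"
  assumes finite_E: "finite E"
    and r_empty: "r {} = 0"
    and r_single: "e \<in> E \<Longrightarrow> r {e} \<le> 1"
    and r_mono: "X \<subseteq> Y \<Longrightarrow> Y \<subseteq> E \<Longrightarrow> r X \<le> r Y"
    and modular: "X \<subseteq> E \<Longrightarrow> Y \<subseteq> E \<Longrightarrow> r (X \<union> Y) + r (rank_closure E r X \<inter> rank_closure E r Y) = r X + r Y"
begin

abbreviation "cl \<equiv> rank_closure E r"

lemma cl_subset: "cl X \<subseteq> E"
  by (auto simp: rank_closure_def)

lemma cl_in_ground: "e \<in> cl X \<Longrightarrow> e \<in> E"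
  by (auto simp: rank_closure_def)

lemma subset_cl: "X \<subseteq> E \<Longrightarrow> X \<subseteq> cl X"
  by (auto simp: rank_closure_def insert_absorb)

lemma r_submod:
  assumes "X \<subseteq> E" "Y \<subseteq> E"
  shows "r (X \<union> Y) + r (X \<inter> Y) \<le> r X + r Y"
proof -
  have "r (X \<inter> Y) \<le> r (cl X \<inter> cl Y)"
    using assms subset_cl[of X] subset_cl[of Y] cl_subset by (intro r_mono) blast+
  then show ?thesis using modular[OF assms] by linarith
qed

lemma r_Un_le: "X \<subseteq> E \<Longrightarrow> Y \<subseteq> E \<Longrightarrow> r (X \<union> Y) \<le> r X + r Y"
  using r_submod[of X Y] by linarith

lemma r_insert_le:
  assumes "X \<subseteq> E" "e \<in> E"
  shows "r (insert e X) \<le> Suc (r X)"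
  using r_Un_le[of "{e}" X] r_single[of e] assms by auto

lemma r_insert:
  assumes "X \<subseteq> E" "e \<in> E" "e \<notin> cl X"
  shows "r (insert e X) = Suc (r X)"
proof -
  have "r X \<le> r (insert e X)" using assms by (intro r_mono) auto
  moreover have "r (insert e X) \<noteq> r X" using assms by (auto simp: rank_closure_def)
  ultimately show ?thesis using r_insert_le[OF assms(1,2)] by linarith
qed

lemma cl_mono:
  assumes "X \<subseteq> Y" "Y \<subseteq> E"
  shows "cl X \<subseteq> cl Y"
proof
  fix e assume e: "e \<in> cl X"
  then have eE: "e \<in> E" and re: "r (insert e X) = r X" by (auto simp: rank_closure_def)
  have "r (insert e X \<union> Y) + r (insert e X \<inter> Y) \<le> r (insert e X) + r Y"
    using assms eE by (intro r_submod) auto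
  moreover have "insert e X \<union> Y = insert e Y" using assms by auto
  moreover have "r X \<le> r (insert e X \<inter> Y)" using assms by (intro r_mono) auto
  moreover have "r Y \<le> r (insert e Y)" using assms eE by (intro r_mono) auto
  ultimately show "e \<in> cl Y" using re eE by (auto simp: rank_closure_def)
qed

lemma r_cl: "X \<subseteq> E \<Longrightarrow> r (cl X) = r X"
  using modular[of X X] by simp

lemma cl_cl:
  assumes "X \<subseteq> E"
  shows "cl (cl X) = cl X"
proof
  show "cl X \<subseteq> cl (cl X)" using cl_subset subset_cl by blast
  show "cl (cl X) \<subseteq> cl X"
  proof
    fix e assume "e \<in> cl (cl X)"
    then have eE: "e \<in> E" and re: "r (insert e (cl X)) = r X"
      using assms by (auto simp: rank_closure_def[of _ _ "cl X"] r_cl)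
    have "r (insert e X) \<le> r (insert e (cl X))"
      using subset_cl[OF assms] cl_subset eE by (intro r_mono) auto
    moreover have "r X \<le> r (insert e X)" using assms eE by (intro r_mono) auto
    ultimately show "e \<in> cl X" using eE re by (auto simp: rank_closure_def)
  qed
qed

lemma cl_least: "X \<subseteq> cl Y \<Longrightarrow> Y \<subseteq> E \<Longrightarrow> cl X \<subseteq> cl Y"
  using cl_mono[of X "cl Y"] cl_subset cl_cl by auto

lemma r_le_of_cl: "X \<subseteq> cl Y \<Longrightarrow> Y \<subseteq> E \<Longrightarrow> r X \<le> r Y"
  using r_mono[of X "cl Y"] cl_subset r_cl by metis

lemma exchange:
  assumes "X \<subseteq> E" "f \<in> E" "e \<in> cl (insert f X)" "e \<notin> cl X"
  shows "f \<in> cl (insert e X)"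
proof -
  have eE: "e \<in> E" using cl_in_ground[OF assms(3)] .
  have "r (insert e (insert f X)) = r (insert f X)" using assms by (auto simp: rank_closure_def)
  moreover have "r (insert e X) = Suc (r X)" using assms eE r_insert by blast
  moreover have "r (insert f X) \<le> Suc (r X)" using r_insert_le assms by blast
  moreover have "r (insert e X) \<le> r (insert e (insert f X))" using assms eE by (intro r_mono) auto
  ultimately show ?thesis using assms(2) by (auto simp: rank_closure_def insert_commute)
qed

lemma cl_insert_eq:
  assumes "X \<subseteq> E" "f \<in> E" "e \<in> cl (insert f X)" "e \<notin> cl X"
  shows "cl (insert e X) = cl (insert f X)"
proof -
  have eE: "e \<in> E" using cl_in_ground[OF assms(3)] .
  have "f \<in> cl (insert e X)" using exchange[OF assms] .
  then have "insert f X \<subseteq> cl (insert e X)" using subset_cl[of "insert e X"] assms(1) eE by simp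
  moreover have "insert e X \<subseteq> cl (insert f X)" using subset_cl[of "insert f X"] assms by simp
  ultimately show ?thesis using cl_least[of "insert e X" "insert f X"]
      cl_least[of "insert f X" "insert e X"] assms(1,2) eE by simp
qed

lemma r_loops: "X \<subseteq> cl {} \<Longrightarrow> r X = 0"
  using r_le_of_cl[of X "{}"] r_empty by auto

lemma nonloop_ex: "X \<subseteq> E \<Longrightarrow> r X > 0 \<Longrightarrow> \<exists>p\<in>X. p \<notin> cl {}"
  using r_loops[of X] by (metis less_irrefl subsetI)

lemma cl_eq_E_iff: "X \<subseteq> E \<Longrightarrow> cl X = E \<longleftrightarrow> r X = r E"
proof
  assume "X \<subseteq> E" "cl X = E" then show "r X = r E" using r_cl[of X] by simp
next
  assume X: "X \<subseteq> E" and rX: "r X = r E"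
  show "cl X = E"
  proof (rule ccontr)
    assume "cl X \<noteq> E"
    then obtain e where e: "e \<in> E" "e \<notin> cl X" using cl_subset by blast
    then have "r (insert e X) = Suc (r X)" using r_insert X by blast
    moreover have "r (insert e X) \<le> r E" using X e by (intro r_mono) auto
    ultimately show False using rX by linarith
  qed
qed

lemma flat_eq:
  assumes "X \<subseteq> cl Y" "Y \<subseteq> E" "r X = r Y"
  shows "cl X = cl Y"
proof
  show "cl X \<subseteq> cl Y" using assms cl_least by blast
  show "cl Y \<subseteq> cl X"
  proof
    fix e assume e: "e \<in> cl Y"
    have X: "X \<subseteq> E" using assms cl_subset by blast
    show "e \<in> cl X"
    proof (rule ccontr)
      assume "e \<notin> cl X"
      then have "r (insert e X) = Suc (r X)" using r_insert X e cl_in_ground by blast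
      moreover have "r (insert e X) \<le> r Y" using e assms by (intro r_le_of_cl) auto
      ultimately show False using assms by linarith
    qed
  qed
qed

text \<open>The Veblen--Young property of projective spaces.\<close>

lemma line_meet:
  assumes "X \<subseteq> E" "y \<in> E" "y \<notin> cl X" "x \<in> cl (insert y X)" "x \<notin> cl {y}"
  obtains p where "p \<in> cl X" "p \<in> cl {x, y}" "p \<notin> cl {y}" "x \<in> cl {p, y}"
proof -
  have xE: "x \<in> E" using cl_in_ground[OF assms(4)] .
  have ynl: "y \<notin> cl {}" using assms(1,3) cl_mono[of "{}" X] by auto
  have "r {x, y} = 2"
    using r_insert[OF _ xE assms(5)] r_insert[OF _ assms(2) ynl] assms(2) r_empty by simp
  moreover have "r ({x, y} \<union> X) = Suc (r X)"
  proof -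
    have "r ({x, y} \<union> X) = r (insert y X)" using assms(4) by (auto simp: rank_closure_def)
    then show ?thesis using r_insert[OF assms(1-3)] by simp
  qed
  moreover have "r ({x, y} \<union> X) + r (cl {x, y} \<inter> cl X) = r {x, y} + r X"
    using assms xE by (intro modular) auto
  \<comment> \<open>The line has rank 2 but adds only 1 to the rank of \<open>X\<close>, so rank 1
    is left for the intersection.\<close>
  ultimately have "r (cl {x, y} \<inter> cl X) > 0" by linarith
  moreover have "cl {x, y} \<inter> cl X \<subseteq> E" using cl_subset by blast
  ultimately obtain p where p: "p \<in> cl {x, y}" "p \<in> cl X" "p \<notin> cl {}" using nonloop_ex by blast
  have py: "p \<notin> cl {y}"
  proof
    assume "p \<in> cl {y}"
    then have "y \<in> cl {p}" using exchange[of "{}" y p] p(3) assms(2) by simp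
    then show False using cl_least[of "{p}" X] p(2) assms(1,3) by blast
  qed
  have "x \<in> cl {p, y}" using exchange[of "{y}" x p] p(1) py xE assms(2) by simp
  then show ?thesis using that p py by blast
qed

lemma parallel_sym: "x \<in> E \<Longrightarrow> y \<in> cl {x} \<Longrightarrow> y \<notin> cl {} \<Longrightarrow> x \<in> cl {y}"
  using exchange[of "{}" x y] by auto

text \<open>Induction on the part \<open>Z\<close> of \<open>Y\<close> in use: the projection
  \<open>p\<close> of \<open>x'\<close> from the new element \<open>y\<close> into
  \<open>cl (insert x Z)\<close> is covered by the induction hypothesis, and \<open>x'\<close> lies
  on the line through \<open>p\<close> and \<open>y\<close>. This reduces claims about cosets of a
  flat to claims about lines.\<close>

lemma translation_invariant:
  assumes Y: "Y \<subseteq> E"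
    and par: "\<And>x x'. x \<in> E - cl Y \<Longrightarrow> x' \<in> E - cl Y \<Longrightarrow> x' \<in> cl {x} \<Longrightarrow> Q x \<Longrightarrow> Q x'"
    and step: "\<And>x x' y. x \<in> E - cl Y \<Longrightarrow> x' \<in> E - cl Y \<Longrightarrow> y \<in> Y \<Longrightarrow> x' \<in> cl {x, y} \<Longrightarrow> Q x \<Longrightarrow> Q x'"
    and x: "x \<in> E - cl Y" "Q x"
    and x': "x' \<in> E - cl Y" "x' \<in> cl (insert x Y)"
  shows "Q x'"
proof -
  have "finite Y" using finite_subset[OF Y finite_E] .
  have "Z \<subseteq> Y \<Longrightarrow> x' \<in> E - cl Y \<Longrightarrow> x' \<in> cl (insert x Z) \<Longrightarrow> Q x'" if "finite Z" for Z x'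
    using that
  proof (induction Z arbitrary: x' rule: finite_induct)
    case empty
    then show ?case using par x by auto
  next
    case (insert y Z)
    have ZE: "insert x Z \<subseteq> E" "y \<in> E" using insert Y x by auto
    have yY: "y \<in> cl Y" using insert Y subset_cl by auto
    show ?case
    proof (cases "x' \<in> cl (insert x Z)")
      case True
      then show ?thesis using insert by auto
    next
      case False
      have 1: "y \<notin> cl (insert x Z)"
      proof
        assume "y \<in> cl (insert x Z)"
        then have "insert x (insert y Z) \<subseteq> cl (insert x Z)" using subset_cl[OF ZE(1)] by auto
        then show False using cl_least[OF _ ZE(1)] False insert.prems(3) by blast
      qed
      have 2: "x' \<notin> cl {y}" using insert.prems yY cl_least[of "{y}" Y] Y by blast
      have 3: "x' \<in> cl (insert y (insert x Z))" using insert.prems(3) by (simp add: insert_commute)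
      obtain p where p: "p \<in> cl (insert x Z)" "p \<in> cl {x', y}" "p \<notin> cl {y}" "x' \<in> cl {p, y}"
        using line_meet[OF ZE 1 3 2] by blast
      have "p \<notin> cl Y"
      proof
        assume "p \<in> cl Y"
        then have "cl {p, y} \<subseteq> cl Y" using cl_least[of "{p, y}" Y] yY Y by blast
        then show False using p insert.prems by blast
      qed
      then have pE: "p \<in> E - cl Y" using cl_in_ground[OF p(1)] by blast
      then have "Q p" using insert p by auto
      then show ?thesis using step[of p x' y] pE insert.prems p by auto
    qed
  qed
  then show ?thesis using x' \<open>finite Y\<close> by blast
qed

lemma hyperplane_above:
  "X \<subseteq> E \<Longrightarrow> r X < r E \<Longrightarrow> \<exists>K. X \<subseteq> K \<and> K \<subseteq> E \<and> cl K = K \<and> r E = Suc (r K)"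
proof (induction "r E - r X" arbitrary: X)
  case 0
  then show ?case by simp
next
  case (Suc n)
  show ?case
  proof (cases "r E = Suc (r X)")
    case True
    then show ?thesis using subset_cl[OF Suc.prems(1)] cl_subset cl_cl[OF Suc.prems(1)] r_cl[OF Suc.prems(1)]
      by (intro exI[of _ "cl X"]) simp
  next
    case False
    have "cl X \<noteq> E" using cl_eq_E_iff[OF Suc.prems(1)] Suc.prems(2) by simp
    then obtain e where e: "e \<in> E" "e \<notin> cl X" using cl_subset[of X] by blast
    have re: "r (insert e X) = Suc (r X)" using r_insert[OF Suc.prems(1) e] .
    have "n = r E - r (insert e X)" "insert e X \<subseteq> E" "r (insert e X) < r E"
      using re Suc.hyps(2) Suc.prems e(1) False by simp_all
    from Suc.hyps(1)[OF this]
    obtain K where "insert e X \<subseteq> K \<and> K \<subseteq> E \<and> cl K = K \<and> r E = Suc (r K)"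
      by (rule exE)
    then show ?thesis by (intro exI[of _ K]) simp
  qed
qed

lemma cl_closed: "cl F = F \<Longrightarrow> F \<subseteq> E \<Longrightarrow> X \<subseteq> F \<Longrightarrow> cl X \<subseteq> F"
  using cl_mono[of X F] by simp

text \<open>If \<open>a\<close> were needed to span \<open>p\<close>, exchange would put
  \<open>a\<close> into \<open>K\<close>. This serves to pull spans back into a hyperplane.\<close>

lemma flat_trace:
  assumes "K \<subseteq> E" "cl K = K" "X \<subseteq> K" "a \<in> E - K" "p \<in> K" "p \<in> cl (insert a X)"
  shows "p \<in> cl X"
proof (rule ccontr)
  assume "p \<notin> cl X"
  moreover have "X \<subseteq> E" "a \<in> E" using assms(1,3,4) by auto
  ultimately have "a \<in> cl (insert p X)" using exchange[OF _ _ assms(6)] by simp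
  then show False using cl_closed[OF assms(2,1), of "insert p X"] assms(3,4,5) by auto
qed

text \<open>\<open>K\<close> and \<open>a\<close> span everything, so \<open>line_meet\<close>
  applies: \<open>p\<close> is the projection of \<open>x\<close> from \<open>a\<close> onto the
  hyperplane.\<close>

lemma hyperplane_meet:
  assumes K: "K \<subseteq> E" "cl K = K" "r E = Suc (r K)" and a: "a \<in> E - K"
    and x: "x \<in> E" "x \<notin> cl {a}"
  obtains p where "p \<in> K" "p \<in> cl {x, a}" "p \<notin> cl {a}" "x \<in> cl {p, a}"
proof -
  have "cl (insert a K) = E" using cl_eq_E_iff[of "insert a K"] r_insert[of K a] K a by simp
  then have "x \<in> cl (insert a K)" using x by simp
  moreover have "a \<in> E" "a \<notin> cl K" using a K by auto
  ultimately obtain p where "p \<in> cl K" "p \<in> cl {x, a}" "p \<notin> cl {a}" "x \<in> cl {p, a}"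
    using line_meet[OF K(1) _ _ _ x(2)] by metis
  then show ?thesis using that K(2) by simp
qed

end

text \<open>Third points on lines are the form of connectivity that passes easily to flats and
  contractions.\<close>

locale projective_rank = modular_rank +
  assumes thick: "e \<in> E \<Longrightarrow> f \<in> E \<Longrightarrow> e \<notin> rank_closure E r {f} \<Longrightarrow> f \<notin> rank_closure E r {e} \<Longrightarrow>
    \<exists>g\<in>rank_closure E r {e, f}. g \<notin> rank_closure E r {e} \<and> g \<notin> rank_closure E r {f}"
begin

section \<open>Restriction to a flat and contraction\<close>

lemma restriction:
  assumes "K \<subseteq> E" "cl K = K"
  shows "projective_rank K r" and "X \<subseteq> K \<Longrightarrow> rank_closure K r X = cl X"
proof -
  have *: "rank_closure K r X = cl X" if "X \<subseteq> K" for X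
    using cl_mono[of X K] that assms by (auto simp: rank_closure_def)
  then show "X \<subseteq> K \<Longrightarrow> rank_closure K r X = cl X" .
  show "projective_rank K r"
  proof
    show "finite K" using assms finite_E finite_subset by blast
    show "r {} = 0" by (rule r_empty)
    show "r {e} \<le> 1" if "e \<in> K" for e using that assms r_single by blast
    show "r X \<le> r Y" if "X \<subseteq> Y" "Y \<subseteq> K" for X Y using that assms r_mono by blast
    show "r (X \<union> Y) + r (rank_closure K r X \<inter> rank_closure K r Y) = r X + r Y"
      if "X \<subseteq> K" "Y \<subseteq> K" for X Y
      using that assms modular[of X Y] * by simp
    show "\<exists>g\<in>rank_closure K r {e, f}. g \<notin> rank_closure K r {e} \<and> g \<notin> rank_closure K r {f}"
      if "e \<in> K" "f \<in> K" "e \<notin> rank_closure K r {f}" "f \<notin> rank_closure K r {e}" for e f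
      using that assms thick[of e f] * by auto
  qed
qed

text \<open>The contraction keeps the ground set, and the elements of \<open>H\<close> become loops.\<close>

lemma contraction:
  assumes H: "H \<subseteq> E"
  defines "s \<equiv> \<lambda>X. r (X \<union> H) - r H"
  shows "projective_rank E s" and "X \<subseteq> E \<Longrightarrow> rank_closure E s X = cl (X \<union> H)"
proof -
  \<comment> \<open>This bound keeps the subtraction in \<open>s\<close> from being
    truncated.\<close>
  have ge: "r H \<le> r (X \<union> H)" if "X \<subseteq> E" for X using that H by (intro r_mono) auto
  have *: "rank_closure E s X = cl (X \<union> H)" if "X \<subseteq> E" for X
  proof -
    have "s (insert e X) = s X \<longleftrightarrow> r (insert e (X \<union> H)) = r (X \<union> H)"
      if "e \<in> E" for e
      using ge[of X] ge[of "insert e X"] \<open>X \<subseteq> E\<close> that unfolding s_def by auto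
    then show ?thesis by (auto simp: rank_closure_def)
  qed
  then show "X \<subseteq> E \<Longrightarrow> rank_closure E s X = cl (X \<union> H)" .
  show "projective_rank E s"
  proof
    show "finite E" by (rule finite_E)
    show "s {} = 0" by (simp add: s_def)
    show "s {e} \<le> 1" if "e \<in> E" for e using r_insert_le[of H e] that H by (simp add: s_def)
    show "s X \<le> s Y" if "X \<subseteq> Y" "Y \<subseteq> E" for X Y
    proof -
      have "r (X \<union> H) \<le> r (Y \<union> H)" using that H by (intro r_mono) auto
      then show ?thesis by (simp add: s_def)
    qed
    show "s (X \<union> Y) + s (rank_closure E s X \<inter> rank_closure E s Y) = s X + s Y"
      if XY: "X \<subseteq> E" "Y \<subseteq> E" for X Y
    proof -
      have "r ((X \<union> H) \<union> (Y \<union> H)) + r (cl (X \<union> H) \<inter> cl (Y \<union> H)) = r (X \<union> H) + r (Y \<union> H)"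
        using XY H by (intro modular) auto
      moreover have "(X \<union> H) \<union> (Y \<union> H) = (X \<union> Y) \<union> H" by auto
      moreover have "cl (X \<union> H) \<inter> cl (Y \<union> H) = (rank_closure E s X \<inter> rank_closure E s Y) \<union> H"
        using * XY H subset_cl[of "X \<union> H"] subset_cl[of "Y \<union> H"] by auto
      moreover have "r H \<le> r ((rank_closure E s X \<inter> rank_closure E s Y) \<union> H)"
        using * XY cl_subset[of "X \<union> H"] by (intro ge) auto
      ultimately show ?thesis using ge[of X] ge[of Y] ge[of "X \<union> Y"] XY by (simp add: s_def)
    qed
    show "\<exists>g\<in>rank_closure E s {e, f}. g \<notin> rank_closure E s {e} \<and> g \<notin> rank_closure E s {f}"
      if ef: "e \<in> E" "f \<in> E" "e \<notin> rank_closure E s {f}" "f \<notin> rank_closure E s {e}" for e f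
    proof -
      have e: "e \<notin> cl (insert f H)" and f: "f \<notin> cl (insert e H)" using ef * by auto
      have sub: "cl {f} \<subseteq> cl (insert f H)" "cl {e} \<subseteq> cl (insert e H)" "cl {e, f} \<subseteq> cl (insert e (insert f H))"
        using ef H by (intro cl_mono; auto)+
      then obtain g where g: "g \<in> cl {e, f}" "g \<notin> cl {e}" "g \<notin> cl {f}"
        using thick[of e f] ef e f by blast
      \<comment> \<open>A third point stays third: \<open>g\<close> and \<open>e\<close> span the
        line, so \<open>g\<close> in the coset of \<open>e\<close> would bring \<open>f\<close>
        there as well.\<close>
      have "g \<notin> cl (insert e H)"
      proof
        assume "g \<in> cl (insert e H)"
        moreover have "f \<in> cl {g, e}" using exchange[of "{e}" f g] g ef by (simp add: insert_commute)
        moreover have "e \<in> cl (insert e H)" using subset_cl[of "insert e H"] ef H by auto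
        ultimately show False using cl_least[of "{g, e}" "insert e H"] f ef H by auto
      qed
      moreover have "g \<notin> cl (insert f H)"
      proof
        assume "g \<in> cl (insert f H)"
        moreover have "e \<in> cl {g, f}" using exchange[of "{f}" e g] g ef by (simp add: insert_commute)
        moreover have "f \<in> cl (insert f H)" using subset_cl[of "insert f H"] ef H by auto
        ultimately show False using cl_least[of "{g, f}" "insert f H"] e ef H by auto
      qed
      ultimately show ?thesis using * ef g sub by (intro bexI[of _ g]) auto
    qed
  qed
qed

end

section \<open>Planes\<close>

text \<open>Here \<open>p\<close> and \<open>p'\<close> are the numbers of points of \<open>A\<close> on a line meeting \<open>A\<close> and \<open>C\<close>, respectively
  \<open>A\<close> and \<open>B\<close>; likewise \<open>q\<close>, \<open>q'\<close> count points of \<open>B\<close> on \<open>AB\<close>- and \<open>BC\<close>-lines, and \<open>s\<close>, \<open>s'\<close> points of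
  \<open>C\<close> on \<open>BC\<close>- and \<open>AC\<close>-lines.  Each equation counts one class twice.  They say that
  \<open>(p - q') * (p' - s)\<close>, \<open>(q - s') * (q' - p)\<close> and \<open>(s - p') * (s' - q)\<close> are positive, but their
  product is minus a square.\<close>

lemma plane_counts_contradiction:
  fixes p p' q q' s s' :: int
  assumes "p * p' = 1 + q' * (p' - 1) + s * (p - 1)"
    and "q * q' = 1 + s' * (q' - 1) + p * (q - 1)"
    and "s * s' = 1 + p' * (s' - 1) + q * (s - 1)"
    and "2 \<le> p" "2 \<le> p'" "2 \<le> q" "2 \<le> q'" "2 \<le> s" "2 \<le> s'"
  shows False
proof -
  have "(p - q') * (p' - s) = (q' - 1) * (s - 1)" using assms(1) by (simp add: algebra_simps)
  then have 1: "(p - q') * (p' - s) > 0" using assms by simp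
  have "(q - s') * (q' - p) = (s' - 1) * (p - 1)" using assms(2) by (simp add: algebra_simps)
  then have 2: "(q - s') * (q' - p) > 0" using assms by simp
  have "(s - p') * (s' - q) = (p' - 1) * (q - 1)" using assms(3) by (simp add: algebra_simps)
  then have 3: "(s - p') * (s' - q) > 0" using assms by simp
  show False using 1 2 3 unfolding zero_less_mult_iff by linarith
qed

text \<open>No order of the plane is assumed; equal point counts come from perspectivities.
  \<open>ln x x\<close> is left unspecified, and the other two positions of
  \<open>not_rainbow\<close> follow from \<open>ln_unique\<close>.\<close>

locale coloured_plane =
  fixes P :: "'a set" and ln :: "'a \<Rightarrow> 'a \<Rightarrow> 'a set" and A B C :: "'a set"
  assumes finite_P: "finite P"
    and on_ln: "x \<in> P \<Longrightarrow> y \<in> P \<Longrightarrow> x \<noteq> y \<Longrightarrow> x \<in> ln x y \<and> y \<in> ln x y \<and> ln x y \<subseteq> P"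
    and ln_unique: "x \<in> P \<Longrightarrow> y \<in> P \<Longrightarrow> x \<noteq> y \<Longrightarrow> u \<in> ln x y \<Longrightarrow> v \<in> ln x y \<Longrightarrow> u \<noteq> v \<Longrightarrow> ln u v = ln x y"
    and ln_meet: "x \<in> P \<Longrightarrow> y \<in> P \<Longrightarrow> x \<noteq> y \<Longrightarrow> u \<in> P \<Longrightarrow> v \<in> P \<Longrightarrow> u \<noteq> v \<Longrightarrow> ln x y \<inter> ln u v \<noteq> {}"
    and cover: "P = A \<union> B \<union> C"
    and nonempty: "A \<noteq> {}" "B \<noteq> {}" "C \<noteq> {}"
    and disj: "A \<inter> B = {}" "A \<inter> C = {}" "B \<inter> C = {}"
    and not_rainbow: "a \<in> A \<Longrightarrow> b \<in> B \<Longrightarrow> c \<in> C \<Longrightarrow> c \<notin> ln a b"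
    and not_collinear: "x \<in> P \<Longrightarrow> y \<in> P \<Longrightarrow> x \<noteq> y \<Longrightarrow> \<not> A \<subseteq> ln x y \<and> \<not> B \<subseteq> ln x y \<and> \<not> C \<subseteq> ln x y"
begin

lemma ln_sym:
  assumes "x \<in> P" "y \<in> P" "x \<noteq> y"
  shows "ln y x = ln x y"
  using ln_unique[of x y y x] on_ln[of x y] assms by simp

lemma classes_ne:
  "a \<in> A \<Longrightarrow> b \<in> B \<Longrightarrow> a \<noteq> b" "a \<in> A \<Longrightarrow> c \<in> C \<Longrightarrow> a \<noteq> c" "b \<in> B \<Longrightarrow> c \<in> C \<Longrightarrow> b \<noteq> c"
  using disj by auto

lemma class_in_P: "a \<in> A \<Longrightarrow> a \<in> P" "b \<in> B \<Longrightarrow> b \<in> P" "c \<in> C \<Longrightarrow> c \<in> P"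
  using cover by auto

lemma not_rainbow':
  assumes "a \<in> A" "b \<in> B" "c \<in> C"
  shows "b \<notin> ln a c" "a \<notin> ln b c"
proof -
  note P = class_in_P(1)[OF assms(1)] class_in_P(2)[OF assms(2)] class_in_P(3)[OF assms(3)]
  note N = classes_ne(1)[OF assms(1,2)] classes_ne(2)[OF assms(1,3)] classes_ne(3)[OF assms(2,3)]
  show "b \<notin> ln a c"
  proof
    assume "b \<in> ln a c"
    then have "ln a b = ln a c" using ln_unique[of a c a b] on_ln[of a c] P N by simp
    then show False using not_rainbow[OF assms] on_ln[of a c] P N by simp
  qed
  show "a \<notin> ln b c"
  proof
    assume "a \<in> ln b c"
    then have "ln a b = ln b c" using ln_unique[of b c a b] on_ln[of b c] P N by simp
    then show False using not_rainbow[OF assms] on_ln[of b c] P N by simp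
  qed
qed

text \<open>With \<open>rotate\<close> this generates all permutations of the classes, so every
  count has to be made for \<open>A\<close> only.\<close>

lemma swap_BC: "coloured_plane P ln A C B"
proof
  show "finite P" by (rule finite_P)
  show "P = A \<union> C \<union> B" using cover by auto
  show "x \<in> ln x y \<and> y \<in> ln x y \<and> ln x y \<subseteq> P"
    if "x \<in> P" "y \<in> P" "x \<noteq> y" for x y
    by (rule on_ln[OF that])
  show "ln u v = ln x y" if "x \<in> P" "y \<in> P" "x \<noteq> y" "u \<in> ln x y" "v \<in> ln x y" "u \<noteq> v" for x y u v
    by (rule ln_unique[OF that])
  show "ln x y \<inter> ln u v \<noteq> {}"
    if "x \<in> P" "y \<in> P" "x \<noteq> y" "u \<in> P" "v \<in> P" "u \<noteq> v" for x y u v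
    by (rule ln_meet[OF that])
  show "b \<notin> ln a c" if "a \<in> A" "c \<in> C" "b \<in> B" for a b c
    by (rule not_rainbow'(1)[OF that(1,3,2)])
  show "\<not> A \<subseteq> ln x y \<and> \<not> C \<subseteq> ln x y \<and> \<not> B \<subseteq> ln x y"
    if "x \<in> P" "y \<in> P" "x \<noteq> y" for x y
    using not_collinear[OF that] by simp
qed (use disj nonempty in blast)+

lemma rotate: "coloured_plane P ln B C A"
proof
  show "finite P" by (rule finite_P)
  show "P = B \<union> C \<union> A" using cover by auto
  show "x \<in> ln x y \<and> y \<in> ln x y \<and> ln x y \<subseteq> P"
    if "x \<in> P" "y \<in> P" "x \<noteq> y" for x y
    by (rule on_ln[OF that])
  show "ln u v = ln x y" if "x \<in> P" "y \<in> P" "x \<noteq> y" "u \<in> ln x y" "v \<in> ln x y" "u \<noteq> v" for x y u v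
    by (rule ln_unique[OF that])
  show "ln x y \<inter> ln u v \<noteq> {}"
    if "x \<in> P" "y \<in> P" "x \<noteq> y" "u \<in> P" "v \<in> P" "u \<noteq> v" for x y u v
    by (rule ln_meet[OF that])
  show "a \<notin> ln b c" if "b \<in> B" "c \<in> C" "a \<in> A" for a b c
    by (rule not_rainbow'(2)[OF that(3,1,2)])
  show "\<not> B \<subseteq> ln x y \<and> \<not> C \<subseteq> ln x y \<and> \<not> A \<subseteq> ln x y"
    if "x \<in> P" "y \<in> P" "x \<noteq> y" for x y
    using not_collinear[OF that] by simp
qed (use disj nonempty in blast)+

lemma ln_fin: "x \<in> P \<Longrightarrow> y \<in> P \<Longrightarrow> x \<noteq> y \<Longrightarrow> finite (ln x y)"
  using on_ln[of x y] finite_subset[OF _ finite_P] by simp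

text \<open>Projection from a point \<open>c\<close> of \<open>C\<close> maps the
  \<open>A\<close>-points of the first line injectively to \<open>A\<close>-points of the second: an
  image is not in \<open>C\<close>, as it lies on a line meeting \<open>A\<close> and
  \<open>B\<close>, and not in \<open>B\<close>, as it lies on the line from \<open>c\<close> to an
  \<open>A\<close>-point.\<close>

lemma AB_card_le:
  assumes "a \<in> A" "b \<in> B" "a' \<in> A" "b' \<in> B"
  shows "card (ln a b \<inter> A) \<le> card (ln a' b' \<inter> A)"
proof -
  obtain c where c: "c \<in> C" using nonempty by blast
  note P = class_in_P(1)[OF assms(1)] class_in_P(2)[OF assms(2)] class_in_P(1)[OF assms(3)] class_in_P(2)[OF assms(4)] class_in_P(3)[OF c]
  note N = classes_ne(1)[OF assms(1,2)] classes_ne(1)[OF assms(3,4)]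
  define g where "g y = (SOME z. z \<in> ln c y \<inter> ln a' b')" for y
  have g: "g y \<in> ln c y" "g y \<in> ln a' b'" if "y \<in> A" for y
  proof -
    have "\<exists>z. z \<in> ln c y \<inter> ln a' b'"
      using ln_meet[of c y a' b'] P N class_in_P(1)[OF that] classes_ne(2)[OF that c] by auto
    then have "g y \<in> ln c y \<inter> ln a' b'" unfolding g_def by (rule someI_ex)
    then show "g y \<in> ln c y" "g y \<in> ln a' b'" by auto
  qed
  have gA: "g y \<in> A" if "y \<in> A" for y
  proof -
    have "g y \<in> P" using g(2)[OF that] on_ln P N by blast
    moreover have "g y \<notin> C" using g(2)[OF that] not_rainbow assms by blast
    moreover have "g y \<notin> B" using g(1)[OF that] not_rainbow'(1)[OF that _ c]
        ln_sym[of y c] class_in_P(1)[OF that] P classes_ne(2)[OF that c] by auto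
    ultimately show ?thesis using cover by blast
  qed
  have "inj_on g (ln a b \<inter> A)"
  proof
    fix y z assume yz: "y \<in> ln a b \<inter> A" "z \<in> ln a b \<inter> A" "g y = g z"
    have yA: "y \<in> A" "z \<in> A" using yz by auto
    have gc: "g y \<noteq> c" using gA[OF yA(1)] c classes_ne(2) by blast
    have *: "ln c (g x) = ln c x" if "x \<in> A" "g x = g y" for x
      using ln_unique[of c x c "g x"] on_ln[of c x] class_in_P(1)[OF that(1)] P classes_ne(2)[OF that(1) c] g(1)[OF that(1)] gc that(2) by auto
    have eq: "ln c y = ln c z" using *[of y] *[of z] yA yz(3) by simp
    \<comment> \<open>Otherwise the line through \<open>c\<close>, \<open>y\<close> and
      \<open>z\<close> would be \<open>ln a b\<close>, which would then meet all three
      classes.\<close>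
    show "y = z"
    proof (rule ccontr)
      assume "y \<noteq> z"
      moreover have "z \<in> ln c y" "y \<in> ln c y" "c \<in> ln c y"
        using eq on_ln[of c z] on_ln[of c y] P class_in_P(1)[OF yA(1)] class_in_P(1)[OF yA(2)] classes_ne(2)[OF yA(1) c] classes_ne(2)[OF yA(2) c] by auto
      ultimately have "ln y z = ln c y" "ln y z = ln a b"
        using ln_unique[of c y y z] ln_unique[of a b y z] P N class_in_P(1)[OF yA(1)] classes_ne(2)[OF yA(1) c] yz by auto
      then show False using not_rainbow[OF assms(1,2) c] \<open>c \<in> ln c y\<close> by simp
    qed
  qed
  moreover have "g ` (ln a b \<inter> A) \<subseteq> ln a' b' \<inter> A" using g gA by auto
  moreover have "finite (ln a' b' \<inter> A)" using ln_fin P N by simp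
  ultimately show ?thesis by (metis card_inj_on_le)
qed

lemma AB_card_eq:
  "a \<in> A \<Longrightarrow> b \<in> B \<Longrightarrow> a' \<in> A \<Longrightarrow> b' \<in> B \<Longrightarrow> card (ln a b \<inter> A) = card (ln a' b' \<inter> A)"
  by (intro antisym AB_card_le)

lemma AC_card_eq:
  "a \<in> A \<Longrightarrow> c \<in> C \<Longrightarrow> a' \<in> A \<Longrightarrow> c' \<in> C \<Longrightarrow> card (ln a c \<inter> A) = card (ln a' c' \<inter> A)"
  using coloured_plane.AB_card_eq[OF swap_BC] .

lemma finA: "finite A"
  using cover finite_P by simp

text \<open>With \<open>pencil_cover\<close> this gives the partition behind both counts of
  \<open>A\<close>: the lines from \<open>x\<close> to the points of a line missing \<open>x\<close>
  partition the other points.\<close>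

lemma pencil_disjoint:
  assumes "x \<in> P" "u \<in> P" "v \<in> P" "u \<noteq> v" "x \<notin> ln u v"
    and "y \<in> ln u v" "z \<in> ln u v" "y \<noteq> z"
  shows "ln x y \<inter> ln x z \<subseteq> {x}"
proof (rule ccontr)
  assume "\<not> ln x y \<inter> ln x z \<subseteq> {x}"
  then obtain w where w: "w \<in> ln x y" "w \<in> ln x z" "w \<noteq> x" by auto
  have yz: "y \<in> P" "z \<in> P" "x \<noteq> y" "x \<noteq> z" using assms on_ln[of u v] by auto
  have "ln x w = ln x y" "ln x w = ln x z"
    using ln_unique[of x y x w] ln_unique[of x z x w] on_ln[of x y] on_ln[of x z] yz assms(1) w by auto
  then have "z \<in> ln x y" using on_ln[of x z] yz assms by auto
  then have "ln y z = ln x y" using ln_unique[of x y y z] on_ln[of x y] yz assms by auto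
  moreover have "ln y z = ln u v" using ln_unique[of u v y z] assms by auto
  ultimately show False using assms(5) on_ln[of x y] yz assms(1) by auto
qed

lemma pencil_cover:
  assumes "x \<in> P" "u \<in> P" "v \<in> P" "u \<noteq> v" "x \<notin> ln u v" "w \<in> P" "w \<noteq> x"
  obtains y where "y \<in> ln u v" "y \<in> ln x w" "w \<in> ln x y"
proof -
  obtain y where y: "y \<in> ln u v" "y \<in> ln x w" using ln_meet[of x w u v] assms by auto
  have "ln x y = ln x w" using ln_unique[of x w x y] on_ln[of x w] assms y by auto
  then show ?thesis using that[of y] y on_ln[of x w] assms by auto
qed

text \<open>Project \<open>A\<close> from \<open>b\<close> onto \<open>ln a c\<close>. The images
  are in \<open>A\<close>, because \<open>ln a c\<close> has no \<open>B\<close>-points and a line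
  from \<open>b\<close> to an \<open>A\<close>-point has no \<open>C\<close>-points. Each fibre
  consists of the \<open>A\<close>-points of a line meeting \<open>A\<close> and \<open>B\<close>,
  and all these fibres have the same size.\<close>

lemma card_A_product:
  assumes "a \<in> A" "b \<in> B" "c \<in> C"
  shows "card A = card (ln a c \<inter> A) * card (ln a b \<inter> A)"
proof -
  note P = class_in_P(1)[OF assms(1)] class_in_P(2)[OF assms(2)] class_in_P(3)[OF assms(3)]
  note N = classes_ne(1)[OF assms(1,2)] classes_ne(2)[OF assms(1,3)] classes_ne(3)[OF assms(2,3)]
  have b: "b \<notin> ln a c" using not_rainbow'[OF assms] by blast
  have "A = (\<Union>y\<in>ln a c \<inter> A. ln b y \<inter> A)"
  proof
    show "A \<subseteq> (\<Union>y\<in>ln a c \<inter> A. ln b y \<inter> A)"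
    proof
      fix w assume w: "w \<in> A"
      obtain y where y: "y \<in> ln a c" "y \<in> ln b w" "w \<in> ln b y"
        using pencil_cover[OF P(2,1,3) N(2) b class_in_P(1)[OF w] classes_ne(1)[OF w assms(2)]] .
      have "y \<in> P" using y on_ln P N by blast
      moreover have "y \<notin> B" using y(1) not_rainbow'(1) assms by blast
      moreover have "y \<notin> C"
        using y(2) ln_sym[of w b] not_rainbow[OF w assms(2)] class_in_P(1)[OF w] P classes_ne(1)[OF w assms(2)] by auto
      ultimately have "y \<in> A" using cover by blast
      then show "w \<in> (\<Union>y\<in>ln a c \<inter> A. ln b y \<inter> A)" using y w by auto
    qed
  qed auto
  then have "card A = card (\<Union>y\<in>ln a c \<inter> A. ln b y \<inter> A)" by simp
  also have "\<dots> = (\<Sum>y\<in>ln a c \<inter> A. card (ln b y \<inter> A))"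
  proof (rule card_UN_disjoint)
    show "finite (ln a c \<inter> A)" using finA by simp
    show "\<forall>i\<in>ln a c \<inter> A. finite (ln b i \<inter> A)" using finA by simp
    show "\<forall>i\<in>ln a c \<inter> A. \<forall>j\<in>ln a c \<inter> A. i \<noteq> j \<longrightarrow> (ln b i \<inter> A) \<inter> (ln b j \<inter> A) = {}"
    proof (intro ballI impI)
      fix i j assume "i \<in> ln a c \<inter> A" "j \<in> ln a c \<inter> A" "i \<noteq> j"
      then have "ln b i \<inter> ln b j \<subseteq> {b}"
        using pencil_disjoint[OF P(2,1,3) N(2) b, of i j] by simp
      then show "(ln b i \<inter> A) \<inter> (ln b j \<inter> A) = {}" using assms(2) disj by auto
    qed
  qed
  also have "\<dots> = (\<Sum>y\<in>ln a c \<inter> A. card (ln a b \<inter> A))"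
  proof (rule sum.cong)
    fix y assume "y \<in> ln a c \<inter> A"
    then have y: "y \<in> A" by simp
    then have "ln b y = ln y b"
      using ln_sym[of y b] P class_in_P(1)[OF y] classes_ne(1)[OF y assms(2)] by auto
    then show "card (ln b y \<inter> A) = card (ln a b \<inter> A)"
      using AB_card_eq[OF y assms(2,1,2)] by simp
  qed simp
  finally show ?thesis by simp
qed

text \<open>Count along the lines through \<open>a\<close>, indexed by the points of
  \<open>ln b c\<close>, all of which are in \<open>B\<close> or \<open>C\<close>. The point
  \<open>a\<close> is on every one of these lines, hence the subtractions and the single 1 in
  front.\<close>

lemma card_A_pencil:
  assumes "a \<in> A" "b \<in> B" "c \<in> C"
  shows "card A = 1 + card (ln b c \<inter> B) * (card (ln a b \<inter> A) - 1) + card (ln b c \<inter> C) * (card (ln a c \<inter> A) - 1)"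
proof -
  note P = class_in_P(1)[OF assms(1)] class_in_P(2)[OF assms(2)] class_in_P(3)[OF assms(3)]
  note N = classes_ne(1)[OF assms(1,2)] classes_ne(2)[OF assms(1,3)] classes_ne(3)[OF assms(2,3)]
  have a: "a \<notin> ln b c" using not_rainbow'[OF assms] by blast
  have bc: "ln b c \<subseteq> B \<union> C"
    using on_ln[OF P(2,3) N(3)] cover not_rainbow'(2)[OF _ assms(2,3)] by blast
  have "A - {a} = (\<Union>y\<in>ln b c. ln a y \<inter> A - {a})"
  proof
    show "A - {a} \<subseteq> (\<Union>y\<in>ln b c. ln a y \<inter> A - {a})"
    proof
      fix w assume w: "w \<in> A - {a}"
      then obtain y where "y \<in> ln b c" "y \<in> ln a w" "w \<in> ln a y"
        using pencil_cover[OF P(1,2,3) N(3) a, of w] class_in_P(1) by blast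
      then show "w \<in> (\<Union>y\<in>ln b c. ln a y \<inter> A - {a})" using w by auto
    qed
  qed auto
  then have "card (A - {a}) = card (\<Union>y\<in>ln b c. ln a y \<inter> A - {a})" by simp
  also have "\<dots> = (\<Sum>y\<in>ln b c. card (ln a y \<inter> A - {a}))"
  proof (rule card_UN_disjoint)
    show "finite (ln b c)" using ln_fin P N by simp
    show "\<forall>i\<in>ln b c. finite (ln a i \<inter> A - {a})" using finA by simp
    show "\<forall>i\<in>ln b c. \<forall>j\<in>ln b c. i \<noteq> j \<longrightarrow> (ln a i \<inter> A - {a}) \<inter> (ln a j \<inter> A - {a}) = {}"
      using pencil_disjoint[OF P(1,2,3) N(3) a] by blast
  qed
  also have "\<dots> = (\<Sum>y\<in>(ln b c \<inter> B) \<union> (ln b c \<inter> C). card (ln a y \<inter> A - {a}))"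
    using bc by (intro sum.cong) auto
  also have "\<dots> = (\<Sum>y\<in>ln b c \<inter> B. card (ln a y \<inter> A - {a})) + (\<Sum>y\<in>ln b c \<inter> C. card (ln a y \<inter> A - {a}))"
    using ln_fin[OF P(2,3) N(3)] disj by (intro sum.union_disjoint) auto
  also have "(\<Sum>y\<in>ln b c \<inter> B. card (ln a y \<inter> A - {a})) = (\<Sum>y\<in>ln b c \<inter> B. card (ln a b \<inter> A) - 1)"
  proof (rule sum.cong)
    fix y assume "y \<in> ln b c \<inter> B"
    then have y: "y \<in> B" by simp
    have "a \<in> ln a y" using on_ln[of a y] P class_in_P(2)[OF y] classes_ne(1)[OF assms(1) y] by simp
    then show "card (ln a y \<inter> A - {a}) = card (ln a b \<inter> A) - 1"
      using AB_card_eq[OF assms(1) y assms(1,2)] assms(1) by simp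
  qed simp
  also have "(\<Sum>y\<in>ln b c \<inter> C. card (ln a y \<inter> A - {a})) = (\<Sum>y\<in>ln b c \<inter> C. card (ln a c \<inter> A) - 1)"
  proof (rule sum.cong)
    fix y assume "y \<in> ln b c \<inter> C"
    then have y: "y \<in> C" by simp
    have "a \<in> ln a y" using on_ln[of a y] P class_in_P(3)[OF y] classes_ne(2)[OF assms(1) y] by simp
    then show "card (ln a y \<inter> A - {a}) = card (ln a c \<inter> A) - 1"
      using AC_card_eq[OF assms(1) y assms(1,3)] assms(1) by simp
  qed simp
  finally have "card (A - {a}) = card (ln b c \<inter> B) * (card (ln a b \<inter> A) - 1) + card (ln b c \<inter> C) * (card (ln a c \<inter> A) - 1)"
    by simp
  moreover have "card A = 1 + card (A - {a})" using card.remove[OF finA assms(1)] by simp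
  ultimately show ?thesis by simp
qed

text \<open>With only one \<open>A\<close>-point on \<open>ln a b\<close>, the product formula would
  put all of \<open>A\<close> on the line \<open>ln a c\<close>.\<close>

lemma AB_card_ge:
  assumes "a \<in> A" "b \<in> B"
  shows "card (ln a b \<inter> A) \<ge> 2"
proof (rule ccontr)
  obtain c where c: "c \<in> C" using nonempty by blast
  note P = class_in_P(1)[OF assms(1)] class_in_P(2)[OF assms(2)] class_in_P(3)[OF c]
  note N = classes_ne(1)[OF assms(1,2)] classes_ne(2)[OF assms(1) c]
  assume "\<not> card (ln a b \<inter> A) \<ge> 2"
  moreover have "card (ln a b \<inter> A) \<noteq> 0" using on_ln[OF P(1,2) N(1)] assms finA by auto
  ultimately have "card (ln a b \<inter> A) = 1" by linarith
  then have "card (ln a c \<inter> A) = card A" using card_A_product[OF assms c] by simp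
  then have "ln a c \<inter> A = A" using finA by (intro card_subset_eq) auto
  then show False using not_collinear[OF P(1,3) N(2)] by blast
qed

lemma AC_card_ge: "a \<in> A \<Longrightarrow> c \<in> C \<Longrightarrow> card (ln a c \<inter> A) \<ge> 2"
  using coloured_plane.AB_card_ge[OF swap_BC] .

lemma A_equation:
  assumes "a \<in> A" "b \<in> B" "c \<in> C"
  shows "int (card (ln a c \<inter> A)) * int (card (ln a b \<inter> A)) =
    1 + int (card (ln b c \<inter> B)) * (int (card (ln a b \<inter> A)) - 1) + int (card (ln b c \<inter> C)) * (int (card (ln a c \<inter> A)) - 1)"
proof -
  have "card (ln a c \<inter> A) * card (ln a b \<inter> A) =
    1 + card (ln b c \<inter> B) * (card (ln a b \<inter> A) - 1) + card (ln b c \<inter> C) * (card (ln a c \<inter> A) - 1)"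
    using card_A_product[OF assms] card_A_pencil[OF assms] by simp
  then have "int (card (ln a c \<inter> A) * card (ln a b \<inter> A)) =
    int (1 + card (ln b c \<inter> B) * (card (ln a b \<inter> A) - 1) + card (ln b c \<inter> C) * (card (ln a c \<inter> A) - 1))"
    by (rule arg_cong)
  \<comment> \<open>Both counts are at least 2, so the natural subtractions agree with those of
    integers.\<close>
  then show ?thesis using AB_card_ge[OF assms(1,2)] AC_card_ge[OF assms(1,3)] by (simp add: of_nat_diff)
qed

theorem no_coloured_plane: False
proof -
  obtain a b c where abc: "a \<in> A" "b \<in> B" "c \<in> C" using nonempty by blast
  note P = class_in_P(1)[OF abc(1)] class_in_P(2)[OF abc(2)] class_in_P(3)[OF abc(3)]
  note N = classes_ne(1)[OF abc(1,2)] classes_ne(2)[OF abc(1,3)] classes_ne(3)[OF abc(2,3)]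
  have [simp]: "ln b a = ln a b" "ln c a = ln a c" "ln c b = ln b c" using ln_sym P N by auto
  note rr = coloured_plane.rotate[OF rotate]
  show False
  proof (rule plane_counts_contradiction)
    show "int (card (ln a c \<inter> A)) * int (card (ln a b \<inter> A)) =
      1 + int (card (ln b c \<inter> B)) * (int (card (ln a b \<inter> A)) - 1) + int (card (ln b c \<inter> C)) * (int (card (ln a c \<inter> A)) - 1)"
      using A_equation abc by blast
    show "int (card (ln a b \<inter> B)) * int (card (ln b c \<inter> B)) =
      1 + int (card (ln a c \<inter> C)) * (int (card (ln b c \<inter> B)) - 1) + int (card (ln a c \<inter> A)) * (int (card (ln a b \<inter> B)) - 1)"
      using coloured_plane.A_equation[OF rotate abc(2,3,1)] by simp
    show "int (card (ln b c \<inter> C)) * int (card (ln a c \<inter> C)) =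
      1 + int (card (ln a b \<inter> A)) * (int (card (ln a c \<inter> C)) - 1) + int (card (ln a b \<inter> B)) * (int (card (ln b c \<inter> C)) - 1)"
      using coloured_plane.A_equation[OF rr abc(3,1,2)] by simp
    show "2 \<le> int (card (ln a c \<inter> A))" "2 \<le> int (card (ln a b \<inter> A))"
      using AB_card_ge[OF abc(1,2)] AC_card_ge[OF abc(1,3)] by simp_all
    show "2 \<le> int (card (ln a b \<inter> B))" "2 \<le> int (card (ln b c \<inter> B))"
      using coloured_plane.AB_card_ge[OF rotate abc(2,3)] coloured_plane.AC_card_ge[OF rotate abc(2,1)]
        by simp_all
    show "2 \<le> int (card (ln b c \<inter> C))" "2 \<le> int (card (ln a c \<inter> C))"
      using coloured_plane.AB_card_ge[OF rr abc(3,1)] coloured_plane.AC_card_ge[OF rr abc(3,2)] by simp_all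
  qed
qed

end

section \<open>Three classes without a rainbow line\<close>

text \<open>The rank condition \<open>indep\<close> does several things at once: members of
  different classes are neither loops nor parallel, and no line meets all three classes. Loops are
  exempt from \<open>cover\<close>, so that contraction need not shrink \<open>E\<close>.
  \<open>rank_pos\<close> makes the spanning classes nonempty.\<close>

locale three_classes = projective_rank E r for E :: "'a set" and r +
  fixes A B C :: "'a set"
  assumes cover: "E - rank_closure E r {} \<subseteq> A \<union> B \<union> C"
    and A_sub: "A \<subseteq> E" and B_sub: "B \<subseteq> E" and C_sub: "C \<subseteq> E"
    and indep: "a \<in> A \<Longrightarrow> b \<in> B \<Longrightarrow> c \<in> C \<Longrightarrow> r {a, b, c} = 3"
    and A_span: "rank_closure E r A = E" and B_span: "rank_closure E r B = E"
      and C_span: "rank_closure E r C = E"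
    and rank_pos: "r E > 0"
begin

lemma swap_BC: "three_classes E r A C B"
proof
  show "E - cl {} \<subseteq> A \<union> C \<union> B" using cover by auto
  show "r {a, c, b} = 3" if "a \<in> A" "c \<in> C" "b \<in> B" for a b c
    using indep[OF that(1,3,2)] by (simp add: insert_commute)
qed (rule A_sub B_sub C_sub A_span B_span C_span rank_pos)+

lemma rotate: "three_classes E r B C A"
proof
  show "E - cl {} \<subseteq> B \<union> C \<union> A" using cover by auto
  show "r {b, c, a} = 3" if "b \<in> B" "c \<in> C" "a \<in> A" for a b c
    using indep[OF that(3,1,2)] by (simp add: insert_commute)
qed (rule A_sub B_sub C_sub A_span B_span C_span rank_pos)+

lemma A_ne: "A \<noteq> {}"
proof
  assume "A = {}"
  then have "r E = 0" using r_cl[of "{}"] A_span r_empty by simp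
  then show False using rank_pos by simp
qed

lemma B_ne: "B \<noteq> {}" using three_classes.A_ne[OF rotate] .
lemma C_ne: "C \<noteq> {}" using three_classes.A_ne[OF three_classes.rotate[OF rotate]] .

lemma r_pair: "x \<in> E \<Longrightarrow> y \<in> E \<Longrightarrow> r {x, y} \<le> 2"
  using r_insert_le[of "{y}" x] r_single[of y] by simp

lemma C_not_on_line:
  assumes "a \<in> A" "b \<in> B" "c \<in> C"
  shows "c \<notin> cl {a, b}"
proof
  assume "c \<in> cl {a, b}"
  then have "r {a, b, c} = r {a, b}" by (simp add: rank_closure_def insert_commute)
  then show False using indep[OF assms] r_pair[of a b] A_sub B_sub assms by auto
qed

lemma A_not_on_line: "a \<in> A \<Longrightarrow> b \<in> B \<Longrightarrow> c \<in> C \<Longrightarrow> a \<notin> cl {b, c}"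
  using three_classes.C_not_on_line[OF rotate, of b c a] by simp

lemma AB_skew:
  assumes "a \<in> A" "b \<in> B"
  shows "a \<notin> cl {b}"
proof
  assume a: "a \<in> cl {b}"
  obtain c where c: "c \<in> C" using C_ne by blast
  have "{b, c} \<subseteq> E" using B_sub C_sub assms c by blast
  then have "a \<in> cl {b, c}" using a cl_mono[of "{b}" "{b, c}"] by blast
  then show False using A_not_on_line assms c by blast
qed

lemma AC_skew: "a \<in> A \<Longrightarrow> c \<in> C \<Longrightarrow> a \<notin> cl {c}"
  using three_classes.AB_skew[OF swap_BC] .

lemma A_nonloop:
  assumes "a \<in> A"
  shows "a \<notin> cl {}"
proof -
  obtain b where b: "b \<in> B" using B_ne by blast
  then have "b \<in> E" using B_sub by blast
  then show ?thesis using AB_skew[OF assms b] cl_mono[of "{}" "{b}"] by blast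
qed

lemma A_parallel:
  assumes "a \<in> A" "x \<in> cl {a}" "x \<notin> cl {}"
  shows "x \<in> A"
proof -
  have "x \<in> A \<union> B \<union> C" using cover cl_in_ground[OF assms(2)] assms(3) by blast
  moreover have ax: "a \<in> cl {x}" using parallel_sym[of a x] assms A_sub by blast
  moreover have "x \<notin> B" using AB_skew[of a x] ax assms by blast
  moreover have "x \<notin> C" using AC_skew[of a x] ax assms by blast
  ultimately show ?thesis by blast
qed

lemma rank_ge: "r E \<ge> 3"
proof -
  obtain a b c where abc: "a \<in> A" "b \<in> B" "c \<in> C" using A_ne B_ne C_ne by blast
  then show ?thesis using indep[OF abc] r_mono[of "{a, b, c}" E] A_sub B_sub C_sub by auto
qed

end

text \<open>The points of a plane are represented by one element from each parallel class.\<close>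

lemma (in three_classes) rank_ne_3: "r E \<noteq> 3"
proof
  assume r3: "r E = 3"
  \<comment> \<open>The choice depends on \<open>x\<close> only through \<open>cl {x}\<close>, so
    parallel elements get the same representative.\<close>
  define rep where "rep x = (SOME y. y \<in> cl {x} - cl {})" for x
  define R where "R = rep ` (E - cl {})"
  have rep: "rep x \<in> cl {x}" "rep x \<notin> cl {}" "cl {rep x} = cl {x}" if x: "x \<in> E - cl {}" for x
  proof -
    have "x \<in> cl {x} - cl {}" using subset_cl[of "{x}"] x by auto
    then have "rep x \<in> cl {x} - cl {}" unfolding rep_def by (rule someI)
    then show 1: "rep x \<in> cl {x}" "rep x \<notin> cl {}" by auto
    show "cl {rep x} = cl {x}" using cl_insert_eq[of "{}" x "rep x"] x 1 by simp
  qed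
  have RE: "R \<subseteq> E - cl {}" using rep(1,2) cl_in_ground unfolding R_def by blast
  have Rpar: "x \<notin> cl {y}" if xy: "x \<in> R" "y \<in> R" "x \<noteq> y" for x y
  proof
    assume "x \<in> cl {y}"
    moreover have xE: "x \<in> E - cl {}" "y \<in> E - cl {}" using xy RE by auto
    ultimately have "cl {x} = cl {y}" using cl_insert_eq[of "{}" y x] by simp
    moreover obtain u v where uv: "x = rep u" "u \<in> E - cl {}" "y = rep v" "v \<in> E - cl {}"
      using xy unfolding R_def by blast
    ultimately have "cl {u} = cl {v}" using rep(3)[OF uv(2)] rep(3)[OF uv(4)] by simp
    then have "x = y" unfolding uv rep_def by simp
    then show False using xy by simp
  qed
  have Rrank: "r {x, y} = 2" if xy: "x \<in> R" "y \<in> R" "x \<noteq> y" for x y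
  proof -
    have "x \<in> E" "y \<in> E" "y \<notin> cl {}" using xy RE by auto
    then show ?thesis using r_insert[OF _ _ Rpar[OF xy]] r_insert[of "{}" y] r_empty by simp
  qed
  have colour: "rep a \<in> X \<inter> R" if "three_classes E r X Y Z" "a \<in> X" for a X Y Z
  proof -
    interpret X: three_classes E r X Y Z by fact
    have "a \<in> E - cl {}" using X.A_sub X.A_nonloop that by blast
    then show ?thesis using rep[of a] X.A_parallel[OF that(2)] unfolding R_def by blast
  qed
  have not_on_line: "\<not> X \<inter> R \<subseteq> cl {x, y} \<inter> R" if X: "three_classes E r X Y Z"
    and xy: "x \<in> R" "y \<in> R" "x \<noteq> y" for x y X Y Z
  proof
    assume on: "X \<inter> R \<subseteq> cl {x, y} \<inter> R"
    interpret X: three_classes E r X Y Z by fact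
    have xyE: "{x, y} \<subseteq> E" using xy RE by blast
    have "X \<subseteq> cl {x, y}"
    proof
      fix a assume a: "a \<in> X"
      have aE: "a \<in> E - cl {}" using X.A_sub X.A_nonloop a by blast
      have "a \<in> cl {rep a}" using rep(3)[OF aE] subset_cl[of "{a}"] aE by simp
      moreover have "rep a \<in> cl {x, y}" using colour[OF X a] on by blast
      ultimately show "a \<in> cl {x, y}" using cl_least[of "{rep a}" "{x, y}"] xyE by blast
    qed
    then have "E \<subseteq> cl {x, y}" using cl_least[of X "{x, y}"] xyE X.A_span by simp
    then show False using r_le_of_cl[of E "{x, y}"] xyE r3 Rrank[OF xy] by simp
  qed
  have t1: "three_classes E r A B C" by unfold_locales
  note t2 = rotate and t3 = three_classes.rotate[OF rotate]
  have "coloured_plane R (\<lambda>x y. cl {x, y} \<inter> R) (A \<inter> R) (B \<inter> R) (C \<inter> R)"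
  proof
    show "finite R" using RE finite_E finite_subset by (metis finite_Diff)
    show "x \<in> cl {x, y} \<inter> R \<and> y \<in> cl {x, y} \<inter> R \<and> cl {x, y} \<inter> R \<subseteq> R" if "x \<in> R" "y \<in> R" "x \<noteq> y" for x y
      using subset_cl[of "{x, y}"] that RE by auto
    show "cl {u, v} \<inter> R = cl {x, y} \<inter> R"
      if "x \<in> R" "y \<in> R" "x \<noteq> y" "u \<in> cl {x, y} \<inter> R" "v \<in> cl {x, y} \<inter> R" "u \<noteq> v" for x y u v
    proof -
      have "{x, y} \<subseteq> E" "{u, v} \<subseteq> cl {x, y}" "r {u, v} = r {x, y}"
        using Rrank[of u v] Rrank[of x y] that RE by auto
      then show ?thesis using flat_eq[of "{u, v}" "{x, y}"] by simp
    qed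
    show "(cl {x, y} \<inter> R) \<inter> (cl {u, v} \<inter> R) \<noteq> {}"
      if xy: "x \<in> R" "y \<in> R" "x \<noteq> y" "u \<in> R" "v \<in> R" "u \<noteq> v" for x y u v
    proof -
      have sE: "{x, y} \<subseteq> E" "{u, v} \<subseteq> E" using xy RE by auto
      have "r ({x, y} \<union> {u, v}) \<le> 3" using r_mono[of "{x, y} \<union> {u, v}" E] sE r3 by simp
      \<comment> \<open>Two lines in rank 3 meet, since 2 + 2 - 3 is positive.\<close>
      then have "r (cl {x, y} \<inter> cl {u, v}) > 0"
        using modular[OF sE] Rrank[OF xy(1-3)] Rrank[OF xy(4-6)] by linarith
      then obtain p where p: "p \<in> cl {x, y}" "p \<in> cl {u, v}" "p \<notin> cl {}"
        using nonloop_ex[of "cl {x, y} \<inter> cl {u, v}"] cl_subset by blast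
      have pE: "p \<in> E - cl {}" using p cl_in_ground by blast
      have "cl {p} \<subseteq> cl {x, y}" "cl {p} \<subseteq> cl {u, v}"
        using cl_least[of "{p}"] p sE by simp_all
      then have "rep p \<in> cl {x, y} \<inter> cl {u, v} \<inter> R"
        using rep(1)[OF pE] pE unfolding R_def by blast
      then show ?thesis by blast
    qed
    show "R = A \<inter> R \<union> B \<inter> R \<union> C \<inter> R" using cover RE by blast
    show "A \<inter> R \<noteq> {}" using colour[OF t1] A_ne by blast
    show "B \<inter> R \<noteq> {}" using colour[OF t2] B_ne by blast
    show "C \<inter> R \<noteq> {}" using colour[OF t3] C_ne by blast
    have sk: "a \<in> A \<Longrightarrow> a \<in> cl {a}" for a using subset_cl[of "{a}"] A_sub by blast
    have sk': "b \<in> B \<Longrightarrow> b \<in> cl {b}" for b using subset_cl[of "{b}"] B_sub by blast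
    show "(A \<inter> R) \<inter> (B \<inter> R) = {}" using AB_skew sk by blast
    show "(A \<inter> R) \<inter> (C \<inter> R) = {}" using AC_skew sk by blast
    show "(B \<inter> R) \<inter> (C \<inter> R) = {}" using three_classes.AB_skew[OF t2] sk' by blast
    show "c \<notin> cl {a, b} \<inter> R"
      if "a \<in> A \<inter> R" "b \<in> B \<inter> R" "c \<in> C \<inter> R" for a b c
      using C_not_on_line[of a b c] that by simp
    show "\<not> A \<inter> R \<subseteq> cl {x, y} \<inter> R \<and> \<not> B \<inter> R \<subseteq> cl {x, y} \<inter> R \<and> \<not> C \<inter> R \<subseteq> cl {x, y} \<inter> R"
      if xy: "x \<in> R" "y \<in> R" "x \<noteq> y" for x y
      using not_on_line[OF t1 xy] not_on_line[OF t2 xy] not_on_line[OF t3 xy] by blast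
  qed
  then show False by (rule coloured_plane.no_coloured_plane)
qed

section \<open>Contracting the span of one class inside a hyperplane\<close>

locale split_classes = three_classes +
  fixes K :: "'a set"
  assumes K_sub: "K \<subseteq> E" and K_flat: "rank_closure E r K = K" and K_rank: "r E = Suc (r K)"
    and A_split: "rank_closure E r (A \<inter> K) \<noteq> K"
begin

definition H where "H = cl (A \<inter> K)"

text \<open>This is the first class in the contraction. It lies outside \<open>K\<close> because
  \<open>A \<inter> K\<close> is contained in \<open>H\<close> and turns into loops.\<close>

definition S where "S = {e \<in> E - K. \<exists>a\<in>A - K. e \<in> cl (insert a H)}"

lemma H_sub: "H \<subseteq> K"
  unfolding H_def by (rule cl_closed[OF K_flat K_sub]) simp

lemma H_subE: "H \<subseteq> E"
  using H_sub K_sub by blast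

lemma H_flat: "cl H = H"
  unfolding H_def by (rule cl_cl) (use A_sub in blast)

lemma H_ne_K: "H \<noteq> K"
  using A_split by (simp add: H_def)

lemma loops_H: "cl {} \<subseteq> H"
  unfolding H_def by (rule cl_mono) (use A_sub in auto)

lemma A_K: "a \<in> A \<Longrightarrow> a \<in> K \<Longrightarrow> a \<in> H"
  using subset_cl[of "A \<inter> K"] A_sub unfolding H_def by blast

lemma swap_split: "split_classes E r A C B K"
  using swap_BC K_sub K_flat K_rank A_split by (simp add: split_classes_def split_classes_axioms_def)

text \<open>\<open>H\<close> is spanned by points of \<open>A\<close>, so it suffices to move along
  lines towards such points. A line from a \<open>B\<close>-point to an \<open>A\<close>-point has
  no \<open>C\<close>-points, and inside \<open>K\<close> all points of \<open>A\<close> are in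
  \<open>H\<close>.\<close>

lemma B_invariant:
  assumes "x \<in> B" "x \<in> K - H" "x' \<in> K - H" "x' \<in> cl (insert x H)"
  shows "x' \<in> B"
proof -
  have YE: "A \<inter> K \<subseteq> E" using A_sub by blast
  have "insert x H \<subseteq> cl (insert x (A \<inter> K))"
    using subset_cl[of "insert x (A \<inter> K)"] cl_mono[of "A \<inter> K" "insert x (A \<inter> K)"] YE assms K_sub unfolding H_def by blast
  then have "x' \<in> cl (insert x (A \<inter> K))"
    using cl_least[of "insert x H" "insert x (A \<inter> K)"] YE assms K_sub by blast
  moreover have "x \<in> E - cl (A \<inter> K)" "x' \<in> E - cl (A \<inter> K)"
    using assms K_sub by (auto simp: H_def)
  ultimately have "x' \<in> B \<inter> K"
  proof (intro translation_invariant[OF YE, where Q = "\<lambda>z. z \<in> B \<inter> K" and x = x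
    and x' = x'])
    fix z z' assume z: "z' \<in> E - cl (A \<inter> K)" "z' \<in> cl {z}" "z \<in> B \<inter> K"
    have "z' \<in> B" using three_classes.A_parallel[OF rotate, of z z'] z loops_H by (auto simp: H_def)
    moreover have "z' \<in> K" using cl_closed[OF K_flat K_sub, of "{z}"] z by blast
    ultimately show "z' \<in> B \<inter> K" by simp
  next
    fix z z' y assume z: "z' \<in> E - cl (A \<inter> K)" "y \<in> A \<inter> K" "z' \<in> cl {z, y}" "z \<in> B \<inter> K"
    have zK: "z' \<in> K" using cl_closed[OF K_flat K_sub, of "{z, y}"] z by blast
    moreover have "z' \<notin> A" using A_K[of z'] zK z by (auto simp: H_def)
    moreover have "z' \<notin> C" using C_not_on_line[of y z z'] z by (auto simp: insert_commute)
    moreover have "z' \<notin> cl {}" using z loops_H by (auto simp: H_def)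
    ultimately show "z' \<in> B \<inter> K" using cover z by blast
  qed (use assms in auto)
  then show ?thesis by simp
qed

lemma C_invariant:
  assumes "x \<in> C" "x \<in> K - H" "x' \<in> K - H" "x' \<in> cl (insert x H)"
  shows "x' \<in> C"
  using split_classes.B_invariant[OF swap_split] assms
  unfolding split_classes.H_def[OF swap_split] H_def by blast

lemma K_minus_H: "x \<in> K - H \<Longrightarrow> x \<in> B \<or> x \<in> C"
  using cover loops_H A_K[of x] K_sub by blast

lemma BC_disjoint: "x \<in> B \<Longrightarrow> x \<in> C \<Longrightarrow> False"
  using three_classes.AB_skew[OF rotate, of x x] subset_cl[of "{x}"] B_sub by blast

lemma A_outside: obtains a where "a \<in> A" "a \<in> E - K"
proof -
  have "\<not> A \<subseteq> K"
  proof
    assume "A \<subseteq> K"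
    then have "E \<subseteq> K" using cl_closed[OF K_flat K_sub, of A] A_span by simp
    then have "E = K" using K_sub by blast
    then show False using K_rank by simp
  qed
  then show ?thesis using that A_sub by blast
qed

text \<open>The projection from \<open>a\<close> avoids \<open>H\<close> because \<open>b\<close> is
  not in the coset of \<open>a\<close>; so it is in \<open>B\<close> or \<open>C\<close>, and
  \<open>C\<close> is excluded by the line through \<open>a\<close> and \<open>b\<close>.\<close>

lemma project_B:
  assumes "b \<in> B" "a \<in> A" "a \<in> E - K" "b \<notin> cl (insert a H)"
  obtains x where "x \<in> B" "x \<in> K - H" "x \<in> cl {b, a}" "b \<in> cl {x, a}"
proof -
  have aH: "insert a H \<subseteq> E" using assms H_subE by blast
  have "b \<notin> cl {a}" using assms(4) cl_mono[of "{a}" "insert a H"] aH by blast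
  then obtain p where p: "p \<in> K" "p \<in> cl {b, a}" "p \<notin> cl {a}" "b \<in> cl {p, a}"
    using hyperplane_meet[OF K_sub K_flat K_rank assms(3), of b] assms B_sub by blast
  have pH: "p \<notin> H"
  proof
    assume "p \<in> H"
    then have "cl {p, a} \<subseteq> cl (insert a H)" using aH by (intro cl_mono) auto
    then show False using p assms by blast
  qed
  have "p \<notin> C" using C_not_on_line[of a b p] assms p by (auto simp: insert_commute)
  then show ?thesis using that[of p] p pH K_minus_H[of p] by blast
qed

text \<open>Project the spanning class \<open>B\<close> from a point \<open>a\<close> of
  \<open>A\<close> outside \<open>K\<close>. Each point of \<open>B\<close> is either spanned by
  \<open>a\<close> and \<open>H\<close> or projects into \<open>B \<inter> (K - H)\<close>; so
  \<open>a\<close> and the set in question span \<open>E\<close>, and the set has at least the rank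
  of \<open>K\<close>.\<close>

lemma span_BK: "cl (H \<union> (B \<inter> (K - H))) = K"
proof -
  let ?Y = "H \<union> (B \<inter> (K - H))"
  have YK: "?Y \<subseteq> K" using H_sub by blast
  then have YE: "?Y \<subseteq> E" using K_sub by blast
  obtain a where a: "a \<in> A" "a \<in> E - K" using A_outside by blast
  have aY: "insert a ?Y \<subseteq> E" using a YE by blast
  have "B \<subseteq> cl (insert a ?Y)"
  proof
    fix b assume b: "b \<in> B"
    show "b \<in> cl (insert a ?Y)"
    proof (cases "b \<in> cl (insert a H)")
      case True
      moreover have "cl (insert a H) \<subseteq> cl (insert a ?Y)" using aY by (intro cl_mono) auto
      ultimately show ?thesis by blast
    next
      case False
      then obtain x where "x \<in> B" "x \<in> K - H" "b \<in> cl {x, a}" using project_B[OF b a] by blast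
      moreover from this have "cl {x, a} \<subseteq> cl (insert a ?Y)" using aY by (intro cl_mono) auto
      ultimately show ?thesis by blast
    qed
  qed
  then have "r E \<le> r (insert a ?Y)"
    using r_le_of_cl[of E "insert a ?Y"] cl_least[of B "insert a ?Y"] aY B_span by simp
  then have "r K \<le> r ?Y" using r_insert_le[of ?Y a] YE a K_rank by simp
  moreover have "r ?Y \<le> r K" using YK K_sub r_mono by blast
  moreover have "?Y \<subseteq> cl K" using YK K_flat by simp
  ultimately have "cl ?Y = cl K" using flat_eq[of ?Y K] K_sub by simp
  then show ?thesis using K_flat by simp
qed

lemma S_coset:
  assumes "x \<in> S" "x' \<in> E - K" "x' \<in> cl (insert x H)"
  shows "x' \<in> S"
proof -
  obtain a where a: "a \<in> A - K" "x \<in> cl (insert a H)" using assms unfolding S_def by blast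
  have aH: "insert a H \<subseteq> E" using a A_sub H_subE by blast
  then have "insert x H \<subseteq> cl (insert a H)" using a subset_cl[of "insert a H"] by blast
  then have "x' \<in> cl (insert a H)" using cl_least[of "insert x H" "insert a H"] assms aH by blast
  then show ?thesis using a assms unfolding S_def by blast
qed

lemma not_in_coset:
  assumes "b \<in> E" "b \<notin> H" "b \<notin> S" "a \<in> A" "a \<in> E - K"
  shows "b \<notin> cl (insert a H)"
proof
  assume b: "b \<in> cl (insert a H)"
  show False
  proof (cases "b \<in> K")
    case True
    then show False using flat_trace[OF K_sub K_flat H_sub assms(5) True b] H_flat assms(2) by simp
  next
    case False
    then show False using assms b unfolding S_def by blast
  qed
qed

text \<open>Replace \<open>s\<close> by a point \<open>a\<close> of \<open>A\<close> in its coset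
  and project \<open>b\<close> and \<open>c\<close> from \<open>a\<close> to \<open>x\<close> and
  \<open>y\<close> in \<open>K\<close>. By \<open>B_invariant\<close>, \<open>x\<close> and
  \<open>y\<close> are in different cosets of \<open>H\<close>, and \<open>a\<close> is outside
  \<open>K\<close>. So \<open>a\<close>, \<open>x\<close>, \<open>y\<close> have rank 3 over
  \<open>H\<close>, while they lie in the span of \<open>H\<close>, \<open>s\<close>,
  \<open>b\<close>, \<open>c\<close>.\<close>

lemma quotient_indep:
  assumes s: "s \<in> S" and b: "b \<in> B - H - S" and c: "c \<in> C - H - S"
  shows "r ({s, b, c} \<union> H) = r H + 3"
proof -
  obtain a where a: "a \<in> A" "a \<in> E - K" "s \<in> cl (insert a H)"
    using s A_sub unfolding S_def by blast
  have sE: "s \<in> E" "s \<notin> K" using s unfolding S_def by auto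
  have bE: "b \<in> E" and cE: "c \<in> E" using b c B_sub C_sub by auto
  have sH: "s \<notin> cl H" using sE H_flat H_sub by blast
  have ba: "b \<notin> cl (insert a H)" and ca: "c \<notin> cl (insert a H)"
    using not_in_coset[OF _ _ _ a(1,2)] b c bE cE by auto
  have aE: "a \<in> E" using a by blast
  have eq: "cl (insert s H) = cl (insert a H)" using cl_insert_eq[OF H_subE aE a(3) sH] .
  have r1: "r (insert s H) = Suc (r H)" using r_insert[OF H_subE sE(1) sH] .
  have sHE: "insert s H \<subseteq> E" using sE H_subE by blast
  have r2: "r (insert b (insert s H)) = Suc (Suc (r H))" using r_insert[OF sHE bE] r1 ba eq by simp
  have L: "insert b (insert s H) \<subseteq> E" using sHE bE by blast
  have "c \<notin> cl (insert b (insert s H))"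
  proof
    assume cL: "c \<in> cl (insert b (insert s H))"
    obtain x where x: "x \<in> B" "x \<in> K - H" "x \<in> cl {b, a}"
      using project_B[OF _ a(1,2) ba] b by blast
    obtain y where y: "y \<in> C" "y \<in> K - H" "y \<in> cl {c, a}"
    proof -
      have "c \<notin> cl (insert a (split_classes.H E r A K))"
        using ca unfolding split_classes.H_def[OF swap_split] H_def .
      then show ?thesis using split_classes.project_B[OF swap_split, of c a] c a that
        unfolding split_classes.H_def[OF swap_split] H_def by blast
    qed
    have aL: "a \<in> cl (insert b (insert s H))"
      using eq subset_cl[of "insert a H"] aE H_subE cl_mono[of "insert s H" "insert b (insert s H)"] L
        by blast
    have bL: "b \<in> cl (insert b (insert s H))" "H \<subseteq> cl (insert b (insert s H))"
      using subset_cl[OF L] by auto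
    have xL: "x \<in> cl (insert b (insert s H))" using cl_least[of "{b, a}", OF _ L] aL bL x by blast
    have yL: "y \<in> cl (insert b (insert s H))" using cl_least[of "{c, a}", OF _ L] aL cL y by blast
    have xE: "x \<in> E" "y \<in> E" using x y K_sub by auto
    have "y \<notin> cl (insert x H)" using B_invariant[OF x(1,2) y(2)] BC_disjoint y by blast
    then have "r (insert y (insert x H)) = Suc (Suc (r H))"
      using r_insert[of "insert x H" y] r_insert[of H x] xE H_subE x H_flat by simp
    moreover have "a \<notin> cl (insert y (insert x H))"
      using cl_closed[OF K_flat K_sub, of "insert y (insert x H)"] x y H_sub a by blast
    ultimately have "r (insert a (insert y (insert x H))) = Suc (Suc (Suc (r H)))"
      using r_insert[of "insert y (insert x H)" a] xE aE H_subE by simp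
    then show False using r_le_of_cl[of "insert a (insert y (insert x H))", OF _ L] aL bL xL yL r2 by simp
  qed
  then have "r (insert c (insert b (insert s H))) = r H + 3" using r_insert[OF L cE] r2 by simp
  moreover have "insert c (insert b (insert s H)) = {s, b, c} \<union> H" by auto
  ultimately show ?thesis by simp
qed

text \<open>\<open>S\<close> avoids \<open>K\<close>, so the \<open>B\<close>-points of
  \<open>K - H\<close> keep their class and span \<open>K\<close> together with \<open>H\<close>.
  One \<open>B\<close>-point outside \<open>K\<close> and \<open>S\<close> then suffices.\<close>

lemma quotient_span:
  assumes "b \<in> B - K - S"
  shows "cl (H \<union> (B - H - S)) = E"
proof -
  let ?Y = "H \<union> (B - H - S)"
  have YE: "?Y \<subseteq> E" using H_subE B_sub by blast
  have "K \<subseteq> cl ?Y"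
    using span_BK cl_mono[of "H \<union> (B \<inter> (K - H))" ?Y] YE unfolding S_def by blast
  moreover have bY: "b \<in> cl ?Y" using subset_cl[OF YE] assms H_sub by blast
  ultimately have "r (insert b K) \<le> r ?Y" using r_le_of_cl[of "insert b K" ?Y] YE by simp
  moreover have "r (insert b K) = r E" using r_insert[of K b] K_sub K_flat assms B_sub K_rank by auto
  moreover have "r ?Y \<le> r E" using YE r_mono by blast
  ultimately show ?thesis using cl_eq_E_iff[OF YE] by simp
qed

lemma quotient_classes:
  assumes b: "b \<in> B - K - S" and c: "c \<in> C - K - S"
  shows "three_classes E (\<lambda>X. r (X \<union> H) - r H) S (B - H - S) (C - H - S)"
proof -
  interpret Q: projective_rank E "\<lambda>X. r (X \<union> H) - r H" by (rule contraction[OF H_subE])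
  note Qcl = contraction(2)[OF H_subE]
  show ?thesis
  proof
    show "E - Q.cl {} \<subseteq> S \<union> (B - H - S) \<union> (C - H - S)"
    proof
      fix e assume "e \<in> E - Q.cl {}"
      then have e: "e \<in> E" "e \<notin> H" using Qcl[of "{}"] H_flat by auto
      have "e \<in> A \<union> B \<union> C" using cover loops_H e by blast
      moreover have "e \<in> S" if "e \<in> A"
        using that e A_K[of e] subset_cl[of "insert e H"] H_subE unfolding S_def by blast
      ultimately show "e \<in> S \<union> (B - H - S) \<union> (C - H - S)" using e by blast
    qed
    show SE: "S \<subseteq> E" unfolding S_def by blast
    show BE: "B - H - S \<subseteq> E" and CE: "C - H - S \<subseteq> E" using B_sub C_sub by auto
    show "r ({s, b, c} \<union> H) - r H = 3" if "s \<in> S" "b \<in> B - H - S" "c \<in> C - H - S" for s b c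
      using quotient_indep[OF that] by simp
    have SHE: "S \<union> H \<subseteq> E" using SE H_subE by blast
    have "A \<subseteq> S \<union> H"
    proof
      fix a assume a: "a \<in> A"
      show "a \<in> S \<union> H"
        using a A_K[of a] subset_cl[of "insert a H"] A_sub H_subE unfolding S_def by blast
    qed
    then have "cl (S \<union> H) = E" using cl_mono[OF _ SHE] A_span cl_subset by blast
    then show "Q.cl S = E" using Qcl[OF SE] by simp
    show "Q.cl (B - H - S) = E" using Qcl[OF BE] quotient_span[OF b] by (simp add: Un_commute)
    have "cl (H \<union> (C - H - S)) = E"
      using split_classes.quotient_span[OF swap_split, of c] c
      unfolding split_classes.H_def[OF swap_split] split_classes.S_def[OF swap_split] H_def S_def .
    then show "Q.cl (C - H - S) = E" using Qcl[OF CE] by (simp add: Un_commute)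
    have "r H \<le> r K" using H_sub K_sub r_mono by blast
    then show "r (E \<union> H) - r H > 0" using K_rank H_subE by (simp add: Un_absorb2)
  qed
qed

text \<open>In the contraction, \<open>B \<inter> (K - H)\<close> spans \<open>K\<close>, so every
  coset outside \<open>K\<close> is reached from one in \<open>S\<close> by moving along lines
  towards these \<open>B\<close>-points. An element reached is not in \<open>C\<close>, because up
  to a coset already in \<open>S\<close> it is on a line meeting \<open>A\<close> and
  \<open>B\<close>; and its being in \<open>A\<close> or \<open>B\<close> puts it into
  \<open>S\<close>.\<close>

lemma outside_K_in_S:
  assumes BS: "B - K \<subseteq> S" and e: "e \<in> E - K"
  shows "e \<in> S"
proof -
  interpret Q: projective_rank E "\<lambda>X. r (X \<union> H) - r H" by (rule contraction[OF H_subE])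
  note Qcl = contraction(2)[OF H_subE]
  let ?Y = "B \<inter> (K - H)"
  have YE: "?Y \<subseteq> E" using B_sub by blast
  have QY: "Q.cl ?Y = K" using Qcl[OF YE] span_BK by (simp add: Un_commute)
  obtain a where a: "a \<in> A" "a \<in> E - K" using A_outside by blast
  have aS: "a \<in> S" using a subset_cl[of "insert a H"] H_subE unfolding S_def by blast
  show ?thesis
  proof (rule Q.translation_invariant[OF YE, where Q = "\<lambda>z. z \<in> S" and x = a and x' = e])
    fix x x' assume "x \<in> E - Q.cl ?Y" "x' \<in> E - Q.cl ?Y" "x' \<in> Q.cl {x}" "x \<in> S"
    then show "x' \<in> S" using S_coset[of x x'] QY Qcl[of "{x}"] by auto
  next
    fix x x' y assume x: "x \<in> E - Q.cl ?Y" "x' \<in> E - Q.cl ?Y" and y: "y \<in> ?Y"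
      and xy: "x' \<in> Q.cl {x, y}" and xS: "x \<in> S"
    have yE: "y \<in> E" using y B_sub by blast
    obtain a where a: "a \<in> A" "a \<in> E - K" "x \<in> cl (insert a H)"
      using xS A_sub unfolding S_def by blast
    have L: "insert a (insert y H) \<subseteq> E" using a yE H_subE by blast
    have "insert x (insert y H) \<subseteq> cl (insert a (insert y H))"
      using subset_cl[OF L] a cl_mono[of "insert a H" "insert a (insert y H)"] L by blast
    moreover have "x' \<in> cl (insert x (insert y H))" using xy Qcl[of "{x, y}"] x yE by auto
    ultimately have x'L: "x' \<in> cl (insert a (insert y H))" using cl_least[OF _ L] by blast
    have x'K: "x' \<in> E" "x' \<notin> K" using x QY by auto
    show "x' \<in> S"
    proof (cases "x' \<in> cl (insert a H)")
      case True
      then show ?thesis using a x'K unfolding S_def by blast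
    next
      case False
      have aH: "insert a H \<subseteq> E" using a H_subE by blast
      have "x' \<notin> cl {a}" using False cl_mono[of "{a}" "insert a H"] aH by blast
      then obtain p where p: "p \<in> K" "p \<in> cl {x', a}" "p \<notin> cl {a}" "x' \<in> cl {p, a}"
        using hyperplane_meet[OF K_sub K_flat K_rank a(2) x'K(1)] by blast
      have pH: "p \<notin> H"
      proof
        assume "p \<in> H"
        then have "cl {p, a} \<subseteq> cl (insert a H)" using aH by (intro cl_mono) auto
        then show False using p False by blast
      qed
      have yHK: "insert y H \<subseteq> K" using y H_sub by blast
      \<comment> \<open>The projection \<open>p\<close> of \<open>x'\<close> lies in the coset of
        \<open>y\<close> over \<open>H\<close>, hence has the class of \<open>y\<close>.\<close>
      have "p \<in> cl (insert a (insert y H))"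
        using p(2) cl_least[of "{x', a}", OF _ L] x'L subset_cl[OF L] by blast
      then have "p \<in> cl (insert y H)" using flat_trace[OF K_sub K_flat yHK a(2) p(1)] by blast
      then have "p \<in> B" using B_invariant[of y p] y p(1) pH by blast
      then have "x' \<notin> C" using C_not_on_line[of a p x'] a p by (auto simp: insert_commute)
      moreover have "x' \<in> S" if "x' \<in> A"
        using that x'K subset_cl[of "insert x' H"] H_subE unfolding S_def by blast
      moreover have "x' \<in> A \<union> B \<union> C" using cover x'K loops_H H_sub by blast
      ultimately show ?thesis using BS x'K by blast
    qed
  next
    show "a \<in> E - Q.cl ?Y" "e \<in> E - Q.cl ?Y" using a e QY by auto
    show "a \<in> S" by (rule aS)
    have "?Y \<union> H = H \<union> ?Y" by blast
    have aK: "insert a K \<subseteq> E" using a K_sub by blast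
    have "cl (insert a K) = E" using cl_eq_E_iff[OF aK] r_insert[of K a] K_sub a K_flat K_rank by simp
    moreover have "insert a K \<subseteq> cl (insert a ?Y \<union> H)"
      using subset_cl[of "insert a ?Y \<union> H"] cl_mono[of "H \<union> ?Y" "insert a ?Y \<union> H"] span_BK a YE H_subE by auto
    ultimately have "cl (insert a ?Y \<union> H) = E"
      using cl_least[of "insert a K" "insert a ?Y \<union> H"] a YE H_subE cl_subset by blast
    then show "e \<in> Q.cl (insert a ?Y)" using Qcl[of "insert a ?Y"] a YE e by simp
  qed
qed

text \<open>Otherwise \<open>S\<close> is everything outside \<open>K\<close>. Take \<open>b\<close>
  in \<open>B\<close> outside \<open>K\<close>, \<open>c\<close> in \<open>C\<close> inside
  \<open>K - H\<close>, and a third point \<open>t\<close> of their line. As \<open>t\<close> is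
  outside \<open>K\<close>, its coset contains some \<open>a\<close> in \<open>A\<close>. Projecting
  \<open>b\<close> from \<open>a\<close> gives a point of \<open>K\<close> in the coset of
  \<open>c\<close>, hence in \<open>C\<close>, on the line through \<open>a\<close> and
  \<open>b\<close>.\<close>

lemma not_B_in_S: "\<not> B - K \<subseteq> S"
proof
  assume BS: "B - K \<subseteq> S"
  have "\<not> B \<subseteq> K"
  proof
    assume "B \<subseteq> K"
    then have "E \<subseteq> K" using cl_closed[OF K_flat K_sub, of B] B_span by simp
    then have "E = K" using K_sub by blast
    then show False using K_rank by simp
  qed
  then obtain b where b: "b \<in> B" "b \<in> E - K" using B_sub by blast
  have "C \<inter> (K - H) \<noteq> {}"
  proof
    assume "C \<inter> (K - H) = {}"
    then have "cl H = K" using split_classes.span_BK[OF swap_split]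
      unfolding split_classes.H_def[OF swap_split] H_def by simp
    then show False using H_flat H_ne_K by simp
  qed
  then obtain c where c: "c \<in> C" "c \<in> K - H" by blast
  have cE: "c \<in> E" using c C_sub by blast
  have bE: "b \<in> E" using b by blast
  have "b \<notin> cl {c}" using cl_closed[OF K_flat K_sub, of "{c}"] b c by blast
  moreover have "c \<notin> cl {b}"
    using three_classes.AB_skew[OF three_classes.swap_BC[OF three_classes.rotate[OF rotate]], of c b] c b
      by blast
  ultimately obtain t where t: "t \<in> cl {b, c}" "t \<notin> cl {b}" "t \<notin> cl {c}"
    using thick[OF bE cE] by blast
  have tE: "t \<in> E" using t(1) by (rule cl_in_ground)
  have btc: "b \<in> cl {t, c}" using exchange[of "{c}" b t] t bE cE by (simp add: insert_commute)
  have ctb: "c \<in> cl {t, b}" using exchange[of "{b}" c t] t bE cE by (simp add: insert_commute)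
  have tK: "t \<notin> K" using cl_closed[OF K_flat K_sub, of "{t, c}"] btc c b by blast
  have "t \<in> S" using outside_K_in_S[OF BS] tE tK by blast
  then obtain a where a: "a \<in> A" "a \<in> E - K" "t \<in> cl (insert a H)"
    using A_sub unfolding S_def by blast
  have aE: "a \<in> E" using a by blast
  have aH: "insert a H \<subseteq> E" using aE H_subE by blast
  have ba: "b \<notin> cl (insert a H)"
  proof
    assume "b \<in> cl (insert a H)"
    then have "c \<in> cl (insert a H)" using cl_least[of "{t, b}" "insert a H"] aH a ctb by blast
    then have "c \<in> H" using flat_trace[OF K_sub K_flat H_sub a(2)] c H_flat by blast
    then show False using c by blast
  qed
  have "b \<notin> cl {a}" using ba cl_mono[of "{a}" "insert a H"] aH by blast
  then obtain p where p: "p \<in> K" "p \<in> cl {b, a}" "p \<notin> cl {a}" "b \<in> cl {p, a}"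
    using hyperplane_meet[OF K_sub K_flat K_rank a(2) bE] by blast
  have pH: "p \<notin> H"
  proof
    assume "p \<in> H"
    then have "cl {p, a} \<subseteq> cl (insert a H)" using aH by (intro cl_mono) auto
    then show False using p ba by blast
  qed
  have L: "insert b (insert c H) \<subseteq> E" using bE cE H_subE by blast
  have "t \<notin> cl H" using tK H_flat H_sub by blast
  then have "a \<in> cl (insert t H)" using exchange[OF H_subE aE a(3)] by blast
  moreover have "t \<in> cl (insert b (insert c H))"
    using t(1) cl_mono[of "{b, c}" "insert b (insert c H)"] L by blast
  moreover have "insert t H \<subseteq> cl (insert b (insert c H))"
    using calculation(2) subset_cl[OF L] by blast
  ultimately have "a \<in> cl (insert b (insert c H))" using cl_least[OF _ L] by blast
  then have "{b, a} \<subseteq> cl (insert b (insert c H))" using subset_cl[OF L] by blast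
  then have "p \<in> cl (insert b (insert c H))" using cl_least[OF _ L] p(2) by blast
  moreover have cHK: "insert c H \<subseteq> K" using c H_sub by blast
  ultimately have "p \<in> cl (insert c H)" using flat_trace[OF K_sub K_flat cHK b(2) p(1)] by blast
  then have "p \<in> C" using C_invariant[of c p] c p(1) pH by blast
  then show False using C_not_on_line[of a b p] a b p by (auto simp: insert_commute)
qed

lemma not_C_in_S: "\<not> C - K \<subseteq> S"
  using split_classes.not_B_in_S[OF swap_split]
  unfolding split_classes.S_def[OF swap_split] split_classes.H_def[OF swap_split] S_def H_def .

text \<open>The rank drops because \<open>H\<close> contains the nonloop \<open>a\<close>. This is
  why the hyperplane is taken through a point of each class.\<close>

lemma smaller_classes:
  assumes "a \<in> A" "a \<in> K"
  shows "\<exists>s S' B' C'. three_classes E s S' B' C' \<and> s E < r E"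
proof -
  obtain b c where "b \<in> B - K - S" "c \<in> C - K - S" using not_B_in_S not_C_in_S by blast
  note * = quotient_classes[OF this]
  have "a \<in> H" using A_K assms by blast
  then have "r {a} \<le> r H" using H_subE by (intro r_mono) auto
  moreover have "r {a} = 1" using r_insert[of "{}" a] A_nonloop[OF assms(1)] A_sub assms r_empty by auto
  ultimately have "r (E \<union> H) - r H < r E" using rank_pos H_subE by (simp add: Un_absorb2)
  then show ?thesis using * by blast
qed

end

theorem no_three_classes: "\<not> three_classes E r A B C"
proof (induction "r E" arbitrary: E r A B C rule: less_induct)
  case less
  show ?case
  proof
    assume three: "three_classes E r A B C"
    then interpret three_classes E r A B C .
    obtain a b c where abc: "a \<in> A" "b \<in> B" "c \<in> C" using A_ne B_ne C_ne by blast
    have abcE: "{a, b, c} \<subseteq> E" using abc A_sub B_sub C_sub by blast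
    \<comment> \<open>Rank 3 is excluded by the count in the plane, so the three points lie in a
      hyperplane.\<close>
    have "r {a, b, c} < r E" using indep[OF abc] rank_ge rank_ne_3 by simp
    then obtain K where K: "{a, b, c} \<subseteq> K" "K \<subseteq> E" "cl K = K" "r E = Suc (r K)"
      using hyperplane_above[OF abcE] by blast
    have split: False if X: "three_classes E r X Y Z" and x: "x \<in> X \<inter> K"
      and "cl (X \<inter> K) \<noteq> K" for X Y Z x
    proof -
      have "split_classes E r X Y Z K"
        using X K that by (simp add: split_classes_def split_classes_axioms_def)
      then obtain s S' B' C' where "three_classes E s S' B' C'" "s E < r E"
        using split_classes.smaller_classes[of E r X Y Z K x] x by auto
      then show False using less by blast
    qed
    have span: "cl (A \<inter> K) = K" "cl (B \<inter> K) = K" "cl (C \<inter> K) = K"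
      using split[OF three] split[OF rotate] split[OF three_classes.rotate[OF rotate]] abc K by blast+
    interpret R: projective_rank K r by (rule restriction[OF K(2,3)])
    note Rcl = restriction(2)[OF K(2,3)]
    \<comment> \<open>Now every class spans \<open>K\<close>, so the restriction to \<open>K\<close>
      is itself a counterexample of smaller rank.\<close>
    have "three_classes K r (A \<inter> K) (B \<inter> K) (C \<inter> K)"
    proof
      show "K - R.cl {} \<subseteq> A \<inter> K \<union> B \<inter> K \<union> C \<inter> K"
        using Rcl[of "{}"] cover K by auto
      show "r {a, b, c} = 3" if "a \<in> A \<inter> K" "b \<in> B \<inter> K" "c \<in> C \<inter> K" for a b c
        using indep that by simp
      show "R.cl (A \<inter> K) = K" "R.cl (B \<inter> K) = K" "R.cl (C \<inter> K) = K"
        using Rcl[of "A \<inter> K"] Rcl[of "B \<inter> K"] Rcl[of "C \<inter> K"] span by auto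
      show "r K > 0" using K(4) rank_ge by simp
    qed auto
    then show False using less[of r K] K(4) by simp
  qed
qed

section \<open>Invariant flats of a colouring without rainbow triangles\<close>

text \<open>The name recalls Gallai's edge colourings of complete graphs without rainbow triangles.
  \<open>no_rainbow\<close> concerns pairwise nonparallel elements of a line; parallel elements may
  differ in colour.\<close>

locale gallai_colouring = projective_rank E r for E :: "'a set" and r +
  fixes f :: "'a \<Rightarrow> 'c"
  assumes loopless: "rank_closure E r {} = {}"
    and no_rainbow: "x \<in> E \<Longrightarrow> y \<in> E \<Longrightarrow> z \<in> rank_closure E r {x, y} \<Longrightarrow> y \<notin> rank_closure E r {x} \<Longrightarrow> z \<notin> rank_closure E r {x} \<Longrightarrow>
      z \<notin> rank_closure E r {y} \<Longrightarrow> f x = f y \<or> f x = f z \<or> f y = f z"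
begin

text \<open>This is what makes \<open>f\<close> constant on the parallel classes of the contraction
  by \<open>H\<close>. The empty flat qualifies only if \<open>f\<close> is constant on parallel
  classes to begin with.\<close>

definition invariant_flat :: "'a set \<Rightarrow> bool" where
  "invariant_flat H \<longleftrightarrow> cl H = H \<and> H \<subseteq> E \<and> H \<noteq> E \<and> (\<forall>e\<in>E - H. \<forall>e'\<in>cl (insert e H) - H. f e' = f e)"

lemma singleton_cl_sym: "x \<in> E \<Longrightarrow> y \<in> cl {x} \<Longrightarrow> x \<in> cl {y}"
  using parallel_sym[of x y] loopless by simp

lemma cl_parallel: "x \<in> E \<Longrightarrow> y \<in> cl {x} \<Longrightarrow> cl {y} = cl {x}"
  using cl_insert_eq[of "{}" x y] loopless by simp

lemma invariant_flatD:
  "invariant_flat H \<Longrightarrow> e \<in> E - H \<Longrightarrow> e' \<in> cl (insert e H) - H \<Longrightarrow> f e' = f e"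
  by (simp add: invariant_flat_def)

text \<open>Project \<open>c\<close> from \<open>b\<close> into the coset of \<open>a\<close>: the
  projection has the colour of \<open>a\<close> and would form a rainbow triangle with
  \<open>b\<close> and \<open>c\<close>.\<close>

lemma invariant_flat_independent:
  assumes H: "invariant_flat H" and abc: "a \<in> E - H" "b \<in> E - H" "c \<in> E - H"
    and ne: "f a \<noteq> f b" "f a \<noteq> f c" "f b \<noteq> f c"
  shows "c \<notin> cl (insert b (insert a H))"
proof
  assume c: "c \<in> cl (insert b (insert a H))"
  have HE: "H \<subseteq> E" using H by (simp add: invariant_flat_def)
  have aH: "insert a H \<subseteq> E" and bH: "insert b H \<subseteq> E" and cH: "insert c H \<subseteq> E"
    using HE abc by auto
  have bE: "b \<in> E" using abc by blast
  have b: "b \<notin> cl (insert a H)" using invariant_flatD[OF H abc(1), of b] abc(2) ne(1) by auto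
  have c': "c \<notin> cl (insert b H)" using invariant_flatD[OF H abc(2), of c] abc(3) ne(3) by auto
  have cb: "c \<notin> cl {b}" using c' cl_mono[of "{b}" "insert b H"] bH by auto
  obtain p where p: "p \<in> cl (insert a H)" "p \<in> cl {c, b}" "p \<notin> cl {b}" "c \<in> cl {p, b}"
    using line_meet[OF aH bE b c cb] .
  have pE: "p \<in> E" using cl_in_ground[OF p(1)] .
  have pH: "p \<notin> H"
  proof
    assume "p \<in> H"
    then have "cl {p, b} \<subseteq> cl (insert b H)" using bH by (intro cl_mono) auto
    then show False using p(4) c' by blast
  qed
  have fp: "f p = f a" using invariant_flatD[OF H abc(1), of p] p(1) pH by simp
  have "p \<notin> cl {c}"
  proof
    assume "p \<in> cl {c}"
    then have "p \<in> cl (insert c H)" using cl_mono[of "{c}" "insert c H"] cH by auto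
    then have "f p = f c" using invariant_flatD[OF H abc(3), of p] pH by simp
    then show False using fp ne by simp
  qed
  then have cp: "c \<notin> cl {p}" using singleton_cl_sym[OF pE, of c] by blast
  have bp: "b \<notin> cl {p}" using singleton_cl_sym[OF pE, of b] p(3) by blast
  show False using no_rainbow[OF pE bE p(4) bp cp cb] fp ne by simp
qed

lemma invariant_flat_rank:
  assumes H: "invariant_flat H" and abc: "a \<in> E - H" "b \<in> E - H" "c \<in> E - H"
    and ne: "f a \<noteq> f b" "f a \<noteq> f c" "f b \<noteq> f c"
  shows "r ({a, b, c} \<union> H) = r H + 3"
proof -
  have HE: "H \<subseteq> E" "cl H = H" using H by (auto simp: invariant_flat_def)
  have "r (insert a H) = Suc (r H)" using r_insert[of H a] HE abc by simp
  moreover have "b \<notin> cl (insert a H)" using invariant_flatD[OF H abc(1), of b] abc(2) ne(1) by auto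
  then have "r (insert b (insert a H)) = Suc (r (insert a H))" using HE abc by (intro r_insert) auto
  moreover have "r (insert c (insert b (insert a H))) = Suc (r (insert b (insert a H)))"
    using HE abc invariant_flat_independent[OF assms] by (intro r_insert) auto
  moreover have "insert c (insert b (insert a H)) = {a, b, c} \<union> H" by auto
  ultimately show ?thesis by simp
qed

text \<open>By \<open>full\<close>, \<open>X\<close> is a union of whole colour classes outside
  \<open>H\<close>. When \<open>x\<close> moves to \<open>x'\<close> along a line of the contraction
  towards \<open>y\<close> in \<open>X\<close>, both ends differ in colour from \<open>y\<close>; if
  they also differed from each other, three dependent elements would have three colours.\<close>

lemma invariant_flat_extend:
  assumes H: "invariant_flat H" and X: "X \<subseteq> E - H"
    and full: "\<And>x y. x \<in> X \<Longrightarrow> y \<in> E - H \<Longrightarrow> f y = f x \<Longrightarrow> y \<in> X"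
    and proper: "cl (X \<union> H) \<noteq> E"
  shows "invariant_flat (cl (X \<union> H))"
proof -
  have HE: "H \<subseteq> E" "cl H = H" using H by (auto simp: invariant_flat_def)
  have XE: "X \<subseteq> E" using X by blast
  have XH: "X \<union> H \<subseteq> E" using XE HE by blast
  interpret Q: projective_rank E "\<lambda>X. r (X \<union> H) - r H" by (rule contraction[OF HE(1)])
  note Qcl = contraction(2)[OF HE(1)]
  have QX: "Q.cl X = cl (X \<union> H)" using Qcl[OF XE] .
  have off: "x \<in> E - H \<and> x \<notin> X" if "x \<in> E - Q.cl X" for x
    using that subset_cl[OF XH] QX by blast
  have "f e' = f e" if e: "e \<in> E - cl (X \<union> H)"
    and e': "e' \<in> cl (insert e (cl (X \<union> H))) - cl (X \<union> H)" for e e'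
  proof (rule Q.translation_invariant[OF XE, where Q = "\<lambda>z. f z = f e" and x = e and x' = e'])
    fix x x' assume x: "x \<in> E - Q.cl X" "x' \<in> E - Q.cl X" "x' \<in> Q.cl {x}" "f x = f e"
    have "x' \<in> cl (insert x H) - H" using x(3) Qcl[of "{x}"] off[OF x(1)] off[OF x(2)] by simp
    then show "f x' = f e" using invariant_flatD[OF H, of x x'] off[OF x(1)] x(4) by simp
  next
    fix x x' y assume x: "x \<in> E - Q.cl X" "x' \<in> E - Q.cl X" "y \<in> X" "x' \<in> Q.cl {x, y}" "f x = f e"
    have yE: "y \<in> E - H" using x(3) X by blast
    have "x' \<in> cl (insert x (insert y H))" using x(4) Qcl[of "{x, y}"] off[OF x(1)] yE by simp
    moreover have "f y \<noteq> f x" "f y \<noteq> f x'"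
      using full[OF x(3)] off[OF x(1)] off[OF x(2)] by metis+
    ultimately have "f x = f x'"
      using invariant_flat_independent[OF H yE, of x x'] off[OF x(1)] off[OF x(2)] by blast
    then show "f x' = f e" using x(5) by simp
  next
    show "e \<in> E - Q.cl X" "e' \<in> E - Q.cl X" using e e' QX cl_in_ground by auto
    have "insert e X \<union> H \<subseteq> E" using XE HE e by blast
    then have "insert e (cl (X \<union> H)) \<subseteq> cl (insert e X \<union> H)"
      using subset_cl[of "insert e X \<union> H"] cl_mono[of "X \<union> H" "insert e X \<union> H"] by blast
    then have "e' \<in> cl (insert e X \<union> H)"
      using e' cl_least[of "insert e (cl (X \<union> H))" "insert e X \<union> H"] \<open>insert e X \<union> H \<subseteq> E\<close> by blast
    then show "e' \<in> Q.cl (insert e X)" using Qcl[of "insert e X"] e XE by simp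
  qed simp
  then show ?thesis using cl_cl[OF XH] cl_subset proper unfolding invariant_flat_def by simp
qed

lemma maximal_invariant_flat_colours:
  assumes H: "invariant_flat H" and max: "\<And>H'. invariant_flat H' \<Longrightarrow> card H' \<le> card H"
  shows "card (f ` (E - H)) \<le> 2"
proof (rule ccontr)
  assume "\<not> card (f ` (E - H)) \<le> 2"
  then obtain T where T: "T \<subseteq> f ` (E - H)" "card T = 3"
    using obtain_subset_with_card_n[of 3 "f ` (E - H)"] by auto
  then obtain k1 k2 k3 where k: "T = {k1, k2, k3}" "k1 \<noteq> k2" "k1 \<noteq> k3" "k2 \<noteq> k3"
    by (auto simp: card_3_iff)
  have HE: "H \<subseteq> E" "cl H = H" "H \<noteq> E" using H by (auto simp: invariant_flat_def)
  interpret Q: projective_rank E "\<lambda>X. r (X \<union> H) - r H" by (rule contraction[OF HE(1)])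
  note Qcl = contraction(2)[OF HE(1)]
  let ?A = "{e \<in> E - H. f e = k1}" and ?B = "{e \<in> E - H. f e = k2}"
    and ?C = "{e \<in> E - H. f e \<noteq> k1 \<and> f e \<noteq> k2}"
  have spanning: "Q.cl X = E" if X: "X \<subseteq> E - H" "X \<noteq> {}"
    and full: "\<And>x y. x \<in> X \<Longrightarrow> y \<in> E - H \<Longrightarrow> f y = f x \<Longrightarrow> y \<in> X" for X
  proof (rule ccontr)
    assume "Q.cl X \<noteq> E"
    moreover have XE: "X \<subseteq> E" using X by blast
    ultimately have "cl (X \<union> H) \<noteq> E" using Qcl[OF XE] by simp
    then have "invariant_flat (cl (X \<union> H))" using invariant_flat_extend[OF H X(1)] full by blast
    then have "card (cl (X \<union> H)) \<le> card H" by (rule max)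
    moreover have "H \<subset> cl (X \<union> H)" using subset_cl[of "X \<union> H"] XE HE X by blast
    then have "card H < card (cl (X \<union> H))"
      by (intro psubset_card_mono finite_subset[OF cl_subset finite_E]) auto
    ultimately show False by simp
  qed
  have "three_classes E (\<lambda>X. r (X \<union> H) - r H) ?A ?B ?C"
  proof
    show "E - Q.cl {} \<subseteq> ?A \<union> ?B \<union> ?C" using Qcl[of "{}"] HE by auto
    show "r ({a, b, c} \<union> H) - r H = 3" if "a \<in> ?A" "b \<in> ?B" "c \<in> ?C" for a b c
    proof -
      have "f a \<noteq> f b" "f a \<noteq> f c" "f b \<noteq> f c" using that k(2) by auto
      then show ?thesis using invariant_flat_rank[OF H, of a b c] that by simp
    qed
    have ne: "?A \<noteq> {}" "?B \<noteq> {}" using T k by auto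
    obtain e where "e \<in> E - H" "f e = k3" using T k by auto
    then have "e \<in> ?C" using k by auto
    then have ne3: "?C \<noteq> {}" by blast
    show "Q.cl ?A = E" by (rule spanning[OF _ ne(1)]) auto
    show "Q.cl ?B = E" by (rule spanning[OF _ ne(2)]) auto
    show "Q.cl ?C = E" by (rule spanning[OF _ ne3]) auto
    obtain e where e: "e \<in> E - H" using HE by blast
    have "Suc (r H) \<le> r E" using r_insert[of H e] r_mono[of "insert e H" E] e HE by simp
    then show "r (E \<union> H) - r H > 0" using HE by (simp add: Un_absorb2)
  qed auto
  then show False using no_three_classes by blast
qed

text \<open>All colour changes within a coset of \<open>H\<close> are between \<open>a\<close> and \<open>b\<close>, so enlarging \<open>H\<close> by
  such a coset ends in an invariant flat.\<close>

definition two_coloured_flat :: "'c \<Rightarrow> 'c \<Rightarrow> 'a set \<Rightarrow> bool" where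
  "two_coloured_flat a b H \<longleftrightarrow> cl H = H \<and> H \<subseteq> E \<and> (\<exists>y\<in>E - H. f y \<noteq> a \<and> f y \<noteq> b) \<and>
    (\<forall>y\<in>E - H. f y \<noteq> a \<longrightarrow> f y \<noteq> b \<longrightarrow> (\<forall>z\<in>cl (insert y H) - H. f z = f y))"

lemma two_coloured_flatD:
  "two_coloured_flat a b H \<Longrightarrow> y \<in> E - H \<Longrightarrow> f y \<noteq> a \<Longrightarrow> f y \<noteq> b \<Longrightarrow> z \<in> cl (insert y H) - H \<Longrightarrow> f z = f y"
  unfolding two_coloured_flat_def by (elim conjE) metis

text \<open>Project \<open>z\<close> from an element \<open>h\<close> of the mixed coset onto
  \<open>cl (insert y H)\<close>. The projection has the colour of \<open>y\<close>, so
  \<open>z\<close> has the colour of \<open>y\<close> or of \<open>h\<close>. Using both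
  \<open>e\<close> and \<open>g\<close> for \<open>h\<close>, whose colours differ, leaves the
  colour of \<open>y\<close>.\<close>

lemma two_coloured_flat_extend:
  assumes H: "two_coloured_flat a b H" and e: "e \<in> E - H" and g: "g \<in> cl (insert e H) - H"
    and ne: "f g \<noteq> f e"
  shows "two_coloured_flat a b (cl (insert e H))"
proof -
  let ?K = "cl (insert e H)"
  have HE: "H \<subseteq> E" "cl H = H" using H by (auto simp: two_coloured_flat_def)
  have eH: "insert e H \<subseteq> E" using e HE by blast
  have eE: "e \<in> E" using e by blast
  have gE: "g \<in> E - H" using g cl_in_ground by blast
  have geq: "cl (insert g H) = ?K" using cl_insert_eq[of H e g] g HE eE by simp
  have eg: "e \<in> cl (insert g H) - H" using geq subset_cl[OF eH] e by simp
  have ab_e: "f e = a \<or> f e = b" using two_coloured_flatD[OF H e, of g] g ne by auto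
  have ab_g: "f g = a \<or> f g = b" using two_coloured_flatD[OF H gE, of e] eg ne by auto
  have outside: "y \<notin> ?K" if y: "y \<in> E - H" "f y \<noteq> a" "f y \<noteq> b" for y
  proof
    assume "y \<in> ?K"
    then have "e \<in> cl (insert y H)" using exchange[of H e y] HE eE y by auto
    then have "f e = f y" using two_coloured_flatD[OF H y, of e] e by simp
    then show False using ab_e y by simp
  qed
  have colour: "f z = f y \<or> f z = f h"
    if y: "y \<in> E - ?K" "f y \<noteq> a" "f y \<noteq> b"
      and z: "z \<in> cl (insert y ?K) - ?K" "z \<notin> cl (insert y H)"
      and h: "h \<in> E - H" "cl (insert h H) = ?K" "f h = a \<or> f h = b" for y z h
  proof -
    have yH: "y \<in> E - H" using y subset_cl[OF eH] by blast
    have yHE: "insert y H \<subseteq> E" and hHE: "insert h H \<subseteq> E" using yH HE h by auto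
    have hE: "h \<in> E" using h by blast
    have yE: "y \<in> E" using y by blast
    have hy: "h \<notin> cl (insert y H)"
    proof
      assume "h \<in> cl (insert y H)"
      then have "y \<in> cl (insert h H)" using exchange[of H y h] HE h yE by auto
      then show False using h y by simp
    qed
    have L: "insert h (insert y H) \<subseteq> E" using yHE hE by blast
    have "insert y ?K \<subseteq> cl (insert h (insert y H))"
      using subset_cl[OF L] cl_mono[of "insert h H" "insert h (insert y H)"] L h(2) by blast
    then have z1: "z \<in> cl (insert h (insert y H))" using cl_least[OF _ L] z by blast
    have zh: "z \<notin> cl {h}" using cl_mono[of "{h}" "insert h H"] hHE h(2) z(1) by auto
    obtain p where p: "p \<in> cl (insert y H)" "p \<in> cl {z, h}" "p \<notin> cl {h}" "z \<in> cl {p, h}"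
      using line_meet[OF yHE hE hy z1 zh] .
    have pE: "p \<in> E" using cl_in_ground[OF p(1)] .
    have pH: "p \<notin> H"
    proof
      assume "p \<in> H"
      then have "cl {p, h} \<subseteq> cl (insert h H)" using hHE by (intro cl_mono) auto
      then show False using p(4) z h by blast
    qed
    have fp: "f p = f y" using two_coloured_flatD[OF H yH y(2,3), of p] p(1) pH by simp
    have zp: "z \<notin> cl {p}" using cl_least[of "{p}" "insert y H"] p(1) yHE z(2) by blast
    have hp: "h \<notin> cl {p}" using singleton_cl_sym[OF pE, of h] p(3) by blast
    have "f p = f h \<or> f p = f z \<or> f h = f z" using no_rainbow[OF pE hE p(4) hp zp zh] .
    then show ?thesis using fp h(3) y by auto
  qed
  have mono: "f z = f y" if y: "y \<in> E - ?K" "f y \<noteq> a" "f y \<noteq> b"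
    and z: "z \<in> cl (insert y ?K) - ?K" for y z
  proof (cases "z \<in> cl (insert y H)")
    case True
    have "z \<notin> H" "y \<notin> H" using z y subset_cl[OF eH] by auto
    then show ?thesis using two_coloured_flatD[OF H _ y(2,3), of z] True y(1) by simp
  next
    case False
    show ?thesis using colour[OF y z False e refl ab_e] colour[OF y z False gE geq ab_g] ne by auto
  qed
  obtain y where y: "y \<in> E - H" "f y \<noteq> a" "f y \<noteq> b"
    using H unfolding two_coloured_flat_def by blast
  have "y \<in> E - ?K" using outside[OF y] y by simp
  then show ?thesis unfolding two_coloured_flat_def
    by (intro conjI ballI impI cl_cl[OF eH] cl_subset bexI[of _ y] y mono)
qed

lemma invariant_flat_of_two_coloured:
  assumes "two_coloured_flat a b H"
  shows "\<exists>H. invariant_flat H"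
proof -
  have "\<forall>H. two_coloured_flat a b H \<longrightarrow> card H < Suc (card E)"
    using card_mono[OF finite_E] by (simp add: two_coloured_flat_def less_Suc_eq_le)
  from ex_has_greatest_nat[of "two_coloured_flat a b", OF assms this]
  obtain H where H: "two_coloured_flat a b H"
    and max: "\<And>H'. two_coloured_flat a b H' \<Longrightarrow> card H' \<le> card H" by blast
  have HE: "H \<subseteq> E" "cl H = H" using H by (auto simp: two_coloured_flat_def)
  have "f e' = f e" if e: "e \<in> E - H" "e' \<in> cl (insert e H) - H" for e e'
  proof (rule ccontr)
    assume "f e' \<noteq> f e"
    then have "two_coloured_flat a b (cl (insert e H))" using two_coloured_flat_extend[OF H e] by blast
    then have "card (cl (insert e H)) \<le> card H" by (rule max)
    moreover have "H \<subset> cl (insert e H)" using subset_cl[of "insert e H"] HE e by blast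
    then have "card H < card (cl (insert e H))"
      by (intro psubset_card_mono finite_subset[OF cl_subset finite_E]) auto
    ultimately show False by simp
  qed
  moreover have "H \<noteq> E" using H by (auto simp: two_coloured_flat_def)
  ultimately have "invariant_flat H" using HE by (simp add: invariant_flat_def)
  then show ?thesis by blast
qed

text \<open>If nonparallel \<open>x\<close> and \<open>x'\<close> on a line through \<open>e\<close>
  differed in colour, every element of \<open>cl {e}\<close> would have one of their two colours,
  but three occur there. Parallel \<open>x\<close> and \<open>x'\<close> are compared through a
  third point of the line to \<open>e\<close>.\<close>

lemma invariant_point:
  assumes rank: "r E \<ge> 2"
    and e: "e \<in> E" "u \<in> cl {e}" "v \<in> cl {e}" "f e \<noteq> f u" "f e \<noteq> f v" "f u \<noteq> f v"
  shows "invariant_flat (cl {e})"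
proof -
  have eE: "{e} \<subseteq> E" using e by simp
  have nonpar: "f x' = f x" if x: "x \<in> E" "x \<notin> cl {e}"
    and x': "x' \<in> cl {x, e}" "x' \<notin> cl {e}" "x' \<notin> cl {x}" for x x'
  proof (rule ccontr)
    assume ne: "f x' \<noteq> f x"
    have "f w = f x \<or> f w = f x'" if w: "w \<in> cl {e}" for w
    proof -
      have wE: "w \<in> E" using cl_in_ground[OF w] .
      have weq: "cl {w} = cl {e}" using cl_parallel[OF e(1) w] .
      have "{x, e} \<subseteq> cl {x, w}"
        using subset_cl[of "{x, w}"] cl_mono[of "{w}" "{x, w}"] x wE weq subset_cl[OF eE] by auto
      then have "x' \<in> cl {x, w}" using cl_least[of "{x, e}" "{x, w}"] x wE x' by auto
      moreover have "w \<notin> cl {x}" using singleton_cl_sym[OF x(1), of w] weq x(2) by auto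
      ultimately have "f x = f w \<or> f x = f x' \<or> f w = f x'"
        using no_rainbow[OF x(1) wE] x' weq by simp
      then show ?thesis using ne by auto
    qed
    from this[of e] this[OF e(2)] this[OF e(3)] show False using e(4-6) subset_cl[OF eE] by auto
  qed
  have "f x' = f x" if x: "x \<in> E - cl {e}" and x': "x' \<in> cl (insert x (cl {e})) - cl {e}" for x x'
  proof -
    have xe: "{x, e} \<subseteq> E" using x e by blast
    have "insert x (cl {e}) \<subseteq> cl {x, e}"
      using subset_cl[OF xe] cl_mono[of "{e}" "{x, e}"] xe by blast
    then have x'1: "x' \<in> cl {x, e}" using cl_least[OF _ xe] x' by blast
    show ?thesis
    proof (cases "x' \<in> cl {x}")
      case False
      then show ?thesis using nonpar[of x x'] x x' x'1 by simp
    next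
      case True
      have xE: "x \<in> E" using x by blast
      have "e \<notin> cl {x}" using singleton_cl_sym[OF xE, of e] x by blast
      then obtain t where t: "t \<in> cl {x, e}" "t \<notin> cl {x}" "t \<notin> cl {e}"
        using thick[of x e] x e by auto
      have eq: "cl {x'} = cl {x}" using cl_parallel[OF xE True] .
      have x'E: "x' \<in> E" using cl_in_ground[OF True] .
      have x'eE: "{x', e} \<subseteq> E" using x'E e by blast
      have "{x, e} \<subseteq> cl {x', e}"
        using subset_cl[OF x'eE] cl_mono[of "{x'}" "{x', e}"] x'eE eq subset_cl[of "{x}"] xE by auto
      then have "t \<in> cl {x', e}" using cl_least[OF _ x'eE] t by blast
      then show ?thesis using nonpar[of x t] nonpar[of x' t] t x x' x'E eq by simp
    qed
  qed
  moreover have "cl {e} \<noteq> E" using r_cl[OF eE] r_single[OF e(1)] rank by auto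
  ultimately show ?thesis using cl_cl[OF eE] cl_subset unfolding invariant_flat_def by simp
qed

text \<open>If two colours can be exempted so that all elements of other colours have monochromatic
  parallel classes, then the empty flat starts the enlargement. Otherwise there are a mixed parallel
  class and an element of a third colour whose class is mixed too. These classes coincide, so one
  class has three colours, or else a third point on the line joining them has no possible
  colour.\<close>

lemma invariant_flat_exists:
  assumes rank: "r E \<ge> 2" and colours: "card (f ` E) \<ge> 3"
  shows "\<exists>H. invariant_flat H"
proof (cases "\<exists>a b. \<forall>y\<in>E. f y \<noteq> a \<longrightarrow> f y \<noteq> b \<longrightarrow> (\<forall>z\<in>cl {y}. f z = f y)")
  case True
  then obtain a b where ab: "\<And>y z. y \<in> E \<Longrightarrow> f y \<noteq> a \<Longrightarrow> f y \<noteq> b \<Longrightarrow> z \<in> cl {y} \<Longrightarrow> f z = f y" by blast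
  have "\<not> f ` E \<subseteq> {a, b}"
  proof
    assume "f ` E \<subseteq> {a, b}"
    then have "card (f ` E) \<le> card {a, b}" by (intro card_mono) auto
    also have "\<dots> \<le> 2" by (simp add: card_insert_if)
    finally show False using colours by simp
  qed
  then have "\<exists>y\<in>E - {}. f y \<noteq> a \<and> f y \<noteq> b" by auto
  then have "two_coloured_flat a b {}" unfolding two_coloured_flat_def
    by (intro conjI ballI impI loopless empty_subsetI) (assumption, rule ab, auto)
  then show ?thesis by (rule invariant_flat_of_two_coloured)
next
  case False
  then have multi: "\<exists>y z. y \<in> E \<and> f y \<noteq> a \<and> f y \<noteq> b \<and> z \<in> cl {y} \<and> f z \<noteq> f y" for a b by blast
  obtain e e' where e: "e \<in> E" "e' \<in> cl {e}" "f e' \<noteq> f e" using multi by blast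
  obtain y z where y: "y \<in> E" "f y \<noteq> f e" "f y \<noteq> f e'" "z \<in> cl {y}" "f z \<noteq> f y"
    using multi by blast
  show ?thesis
  proof (cases "y \<in> cl {e}")
    case True
    then have "invariant_flat (cl {e})" using invariant_point[OF rank e(1,2), of y] e y by auto
    then show ?thesis by blast
  next
    case False
    have ey: "e \<notin> cl {y}" using singleton_cl_sym[OF y(1), of e] False by blast
    obtain t where t: "t \<in> cl {e, y}" "t \<notin> cl {e}" "t \<notin> cl {y}"
      using thick[OF e(1) y(1) ey False] by blast
    have tri: "f u = f v \<or> f u = f t \<or> f v = f t" if u: "u \<in> cl {e}"
      and v: "v \<in> cl {y}" for u v
    proof -
      have uv: "u \<in> E" "v \<in> E" using cl_in_ground[OF u] cl_in_ground[OF v] by auto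
      have eq: "cl {u} = cl {e}" "cl {v} = cl {y}" using cl_parallel[OF e(1) u] cl_parallel[OF y(1) v] .
      have uvE: "{u, v} \<subseteq> E" using uv by blast
      have "{e, y} \<subseteq> cl {u, v}"
        using cl_mono[of "{u}" "{u, v}"] cl_mono[of "{v}" "{u, v}"] uvE eq subset_cl[of "{e}"] subset_cl[of "{y}"] e(1) y(1) by auto
      then have "t \<in> cl {u, v}" using cl_least[OF _ uvE] t by blast
      moreover have "v \<notin> cl {u}"
        using cl_parallel[OF uv(1), of v] eq False subset_cl[of "{y}"] y(1) by auto
      ultimately show ?thesis using no_rainbow[OF uv] t eq by simp
    qed
    have self: "e \<in> cl {e}" "y \<in> cl {y}"
      using subset_cl[of "{e}"] subset_cl[of "{y}"] e(1) y(1) by auto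
    \<comment> \<open>Comparing \<open>y\<close> with \<open>e\<close> and \<open>e'\<close> gives
      \<open>t\<close> the colour of \<open>y\<close>; then \<open>z\<close> would need the colours
      of both \<open>e\<close> and \<open>e'\<close>.\<close>
    have False
      using tri[OF self] tri[OF e(2) self(2)] tri[OF self(1) y(4)] tri[OF e(2) y(4)] e(3) y(2,3,5) by metis
    then show ?thesis ..
  qed
qed

theorem invariant_decomposition:
  assumes rank: "r E \<ge> 2" and colours: "card (f ` E) \<ge> 3"
  obtains H where "invariant_flat H" "H \<noteq> {}" "card (f ` (E - H)) \<le> 2"
proof -
  obtain H0 where H0: "invariant_flat H0" using invariant_flat_exists[OF assms] by blast
  have "\<forall>H. invariant_flat H \<longrightarrow> card H < Suc (card E)"
    using card_mono[OF finite_E] by (simp add: invariant_flat_def less_Suc_eq_le)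
  from ex_has_greatest_nat[of invariant_flat, OF H0 this]
  obtain H where H: "invariant_flat H"
    and max: "\<And>H'. invariant_flat H' \<Longrightarrow> card H' \<le> card H" by blast
  have two: "card (f ` (E - H)) \<le> 2" using maximal_invariant_flat_colours[OF H max] .
  \<comment> \<open>At least three colours occur, but at most two outside \<open>H\<close>.\<close>
  moreover have "H \<noteq> {}" using two colours by auto
  ultimately show ?thesis using that H by blast
qed

end

section \<open>Modular matroids\<close>

context matroid
begin

lemma finite_ranks: "finite {card I | I. I \<subseteq> X \<and> indep M I}"
proof (rule finite_subset)
  show "{card I | I. I \<subseteq> X \<and> indep M I} \<subseteq> {..card (ground M)}"
    using card_mono[OF finite_ground] indep_subset_ground by auto
qed simp

lemma card_le_rank: "I \<subseteq> X \<Longrightarrow> indep M I \<Longrightarrow> card I \<le> mrank M X"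
  unfolding mrank_def by (rule Max_ge[OF finite_ranks]) auto

lemma basis_exists: obtains I where "I \<subseteq> X" "indep M I" "card I = mrank M X"
proof -
  have "mrank M X \<in> {card I | I. I \<subseteq> X \<and> indep M I}"
    unfolding mrank_def using indep_empty by (intro Max_in[OF finite_ranks]) auto
  then show ?thesis using that by auto
qed

lemma indep_finite: "indep M I \<Longrightarrow> finite I"
  using indep_subset_ground finite_ground finite_subset by blast

lemma rank_le_card: "finite X \<Longrightarrow> mrank M X \<le> card X"
  using basis_exists[of X] card_mono[of X] by metis

lemma rank_mono: "X \<subseteq> Y \<Longrightarrow> mrank M X \<le> mrank M Y"
  using basis_exists[of X] card_le_rank[of _ Y] by (metis order_trans)

lemma indep_iff_rank: "X \<subseteq> ground M \<Longrightarrow> indep M X \<longleftrightarrow> mrank M X = card X"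
proof
  assume "indep M X"
  then show "mrank M X = card X"
    using card_le_rank[of X X] rank_le_card[OF indep_finite] by fastforce
next
  assume X: "X \<subseteq> ground M" "mrank M X = card X"
  obtain I where "I \<subseteq> X" "indep M I" "card I = mrank M X" using basis_exists .
  then have "I = X" using X finite_subset[OF _ finite_ground] by (intro card_subset_eq) auto
  then show "indep M X" using \<open>indep M I\<close> by simp
qed

lemma indep_extend:
  assumes "indep M I" "indep M J" "card I \<le> card J"
  shows "\<exists>I'. I \<subseteq> I' \<and> I' \<subseteq> I \<union> J \<and> indep M I' \<and> card I' = card J"
  using assms
proof (induction "card J - card I" arbitrary: I)
  case 0
  then show ?case by (intro exI[of _ I]) auto
next
  case (Suc n)
  then have "card I < card J" by linarith
  then obtain e where e: "e \<in> J - I" "indep M (insert e I)" using indep_augment Suc.prems by blast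
  have c: "card (insert e I) = Suc (card I)" using e indep_finite[OF Suc.prems(1)] by simp
  then have "n = card J - card (insert e I)" "card (insert e I) \<le> card J"
    using Suc.hyps(2) \<open>card I < card J\<close> by simp_all
  then obtain I' where "insert e I \<subseteq> I'" "I' \<subseteq> insert e I \<union> J" "indep M I'" "card I' = card J"
    using Suc.hyps(1)[OF _ e(2) Suc.prems(2)] by blast
  then show ?case using e by (intro exI[of _ I']) auto
qed

text \<open>Extend a basis of \<open>X\<close> by elements of a basis of \<open>insert e Y\<close>
  to the size of the latter. The result is too large for \<open>Y\<close> and so contains
  \<open>e\<close>; hence \<open>e\<close> already extends the basis of \<open>X\<close>.\<close>

lemma rank_insert_mono:
  assumes "X \<subseteq> Y" "mrank M (insert e X) = mrank M X"
  shows "mrank M (insert e Y) = mrank M Y"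
proof (rule ccontr)
  assume "mrank M (insert e Y) \<noteq> mrank M Y"
  then have less: "mrank M Y < mrank M (insert e Y)" using rank_mono[OF subset_insertI, of Y e] by linarith
  then have eY: "e \<notin> Y" by (auto simp: insert_absorb)
  obtain I where I: "I \<subseteq> X" "indep M I" "card I = mrank M X" using basis_exists .
  obtain J where J: "J \<subseteq> insert e Y" "indep M J" "card J = mrank M (insert e Y)"
    using basis_exists .
  have "card I \<le> card J" using I(3) J(3) rank_mono[OF assms(1)] less by linarith
  from indep_extend[OF I(2) J(2) this]
  obtain I' where I': "I \<subseteq> I'" "I' \<subseteq> I \<union> J" "indep M I'" "card I' = card J"
    by blast
  have "e \<in> I'"
  proof (rule ccontr)
    assume "e \<notin> I'"
    then have "I' \<subseteq> Y" using I' I J assms(1) by blast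
    then show False using card_le_rank[OF _ I'(3), of Y] I' J less by simp
  qed
  then have "indep M (insert e I)" using I' indep_mono by blast
  then have "card (insert e I) \<le> mrank M (insert e X)" using I by (intro card_le_rank) auto
  moreover have "e \<notin> I" using eY I(1) assms(1) by blast
  ultimately show False using assms(2) I(3) indep_finite[OF I(2)] by simp
qed

lemma rank_Un_spanned:
  assumes "finite Z" "\<And>z. z \<in> Z \<Longrightarrow> mrank M (insert z X) = mrank M X"
  shows "mrank M (X \<union> Z) = mrank M X"
  using assms
proof (induction Z rule: finite_induct)
  case (insert z Z)
  have "mrank M (X \<union> Z) = mrank M X" by (rule insert.IH) (rule insert.prems, blast)
  moreover have "mrank M (insert z (X \<union> Z)) = mrank M (X \<union> Z)"
    by (rule rank_insert_mono[OF Un_upper1 insert.prems]) blast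
  ultimately show ?case by simp
qed simp

lemma mcl_eq_rank_closure: "mcl M X = rank_closure (ground M) (mrank M) X"
  by (simp add: mcl_def rank_closure_def)

lemma rank_mcl:
  assumes "X \<subseteq> ground M"
  shows "mrank M (mcl M X) = mrank M X"
proof -
  have "mrank M (X \<union> mcl M X) = mrank M X"
    using finite_ground by (intro rank_Un_spanned) (auto simp: mcl_def)
  moreover have "X \<union> mcl M X = mcl M X" using assms by (auto simp: mcl_def insert_absorb)
  ultimately show ?thesis by simp
qed

lemma mflat_mcl:
  assumes "X \<subseteq> ground M"
  shows "mflat M (mcl M X)"
proof -
  have "X \<subseteq> mcl M X" using assms by (auto simp: mcl_def insert_absorb)
  then have spanned: "mrank M (insert e X) = mrank M X"
    if "mrank M (insert e (mcl M X)) = mrank M (mcl M X)" for e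
    using rank_mono[OF insert_mono, of X "mcl M X" e] rank_mono[OF subset_insertI, of X e] rank_mcl[OF assms] that
    by linarith
  have "mcl M (mcl M X) \<subseteq> mcl M X"
  proof
    fix e assume "e \<in> mcl M (mcl M X)"
    then have e: "e \<in> ground M" "mrank M (insert e (mcl M X)) = mrank M (mcl M X)"
      by (simp_all add: mcl_def[of _ "mcl M X"])
    show "e \<in> mcl M X" using e(1) spanned[OF e(2)] by (simp add: mcl_def[of _ X])
  qed
  moreover have "mcl M X \<subseteq> mcl M (mcl M X)"
  proof
    fix e assume e: "e \<in> mcl M X"
    then have "e \<in> ground M" by (simp add: mcl_def)
    then show "e \<in> mcl M (mcl M X)" using e by (simp add: mcl_def[of _ "mcl M X"] insert_absorb)
  qed
  moreover have "mcl M X \<subseteq> ground M" by (auto simp: mcl_def)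
  ultimately show ?thesis by (simp add: mflat_def)
qed

end

locale modular_matroid = matroid M for M :: "'a matroid" +
  assumes mmodular: "mmodular M"

text \<open>Modularity of a matroid speaks of flats only; passing from sets to their closures
  changes neither their ranks nor the rank of their union.\<close>

sublocale modular_matroid \<subseteq> modular_rank "ground M" "mrank M"
proof
  show "finite (ground M)" by (rule finite_ground)
  show "mrank M {} = 0" using rank_le_card[of "{}"] by simp
  show "mrank M {e} \<le> 1" for e using rank_le_card[of "{e}"] by simp
  show "mrank M X \<le> mrank M Y" if "X \<subseteq> Y" for X Y by (rule rank_mono[OF that])
  show "mrank M (X \<union> Y) + mrank M (rank_closure (ground M) (mrank M) X \<inter> rank_closure (ground M) (mrank M) Y) = mrank M X + mrank M Y"
    if XY: "X \<subseteq> ground M" "Y \<subseteq> ground M" for X Y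
  proof -
    have "mrank M (mcl M X) + mrank M (mcl M Y) = mrank M (mcl M X \<union> mcl M Y) + mrank M (mcl M X \<inter> mcl M Y)"
      using mmodular mflat_mcl XY unfolding mmodular_def by simp
    moreover have "mrank M ((X \<union> Y) \<union> (mcl M X \<union> mcl M Y)) = mrank M (X \<union> Y)"
    proof (rule rank_Un_spanned)
      show "finite (mcl M X \<union> mcl M Y)" using finite_ground by (auto simp: mcl_def)
      show "mrank M (insert z (X \<union> Y)) = mrank M (X \<union> Y)"
        if "z \<in> mcl M X \<union> mcl M Y" for z
        using that rank_insert_mono[of X "X \<union> Y" z] rank_insert_mono[of Y "X \<union> Y" z]
          by (auto simp: mcl_def)
    qed
    moreover have "(X \<union> Y) \<union> (mcl M X \<union> mcl M Y) = mcl M X \<union> mcl M Y"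
      using XY by (auto simp: mcl_def insert_absorb)
    ultimately show ?thesis using rank_mcl XY by (simp add: mcl_eq_rank_closure)
  qed
qed

section \<open>Circuits and triangles in a modular matroid\<close>

context modular_matroid
begin

lemma mflat_iff: "mflat M F \<longleftrightarrow> F \<subseteq> ground M \<and> cl F = F"
  by (simp add: mflat_def mcl_eq_rank_closure)

lemma indep_insert:
  assumes "indep M X" "e \<in> ground M" "e \<notin> X"
  shows "indep M (insert e X) \<longleftrightarrow> e \<notin> cl X"
proof -
  have X: "X \<subseteq> ground M" using indep_subset_ground[OF assms(1)] .
  have "indep M (insert e X) \<longleftrightarrow> mrank M (insert e X) = Suc (mrank M X)"
    using indep_iff_rank[of "insert e X"] indep_iff_rank[OF X] assms X indep_finite[OF assms(1)] by simp
  also have "\<dots> \<longleftrightarrow> e \<notin> cl X"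
    using r_insert[OF X assms(2)] assms(2) by (auto simp: rank_closure_def)
  finally show ?thesis .
qed

lemma circuit_closure:
  assumes "mcircuit M C" "e \<in> C" "f \<in> C" "e \<noteq> f"
  shows "f \<notin> cl (C - {e, f})" "e \<in> cl (insert f (C - {e, f}))"
proof -
  have CE: "C \<subseteq> ground M" and dep: "\<not> indep M C"
    and sub: "\<And>X. X \<subset> C \<Longrightarrow> indep M X"
    using assms(1) by (auto simp: mcircuit_def)
  have "indep M (C - {e, f})" "indep M (C - {e})" using assms by (intro sub; blast)+
  moreover have "C - {e} = insert f (C - {e, f})" "C = insert e (C - {e})" using assms by auto
  ultimately show "f \<notin> cl (C - {e, f})" "e \<in> cl (insert f (C - {e, f}))"
    using indep_insert[of "C - {e, f}" f] indep_insert[of "C - {e}" e] CE dep assms by auto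
qed

text \<open>The line through \<open>e\<close> and \<open>f\<close> meets the flat spanned by the
  rest of the circuit, and the minimality of the circuit keeps the common point off both ends. The
  lemma serves twice: for third points on lines and for shortening circuits.\<close>

lemma circuit_point:
  assumes C: "mcircuit M C" "e \<in> C" "f \<in> C" "e \<noteq> f" and ef: "e \<notin> cl {f}"
  obtains p where "p \<in> cl (C - {e, f})" "p \<in> cl {e, f}" "p \<notin> cl {e}" "p \<notin> cl {f}" "e \<in> cl {p, f}"
proof -
  let ?X = "C - {e, f}"
  have CE: "C \<subseteq> ground M" using C by (simp add: mcircuit_def)
  then have XE: "?X \<subseteq> ground M" and fE: "f \<in> ground M" and eE: "e \<in> ground M"
    using C by auto
  obtain p where p: "p \<in> cl ?X" "p \<in> cl {e, f}" "p \<notin> cl {f}" "e \<in> cl {p, f}"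
    using line_meet[OF XE fE circuit_closure[OF C] ef] .
  have "p \<notin> cl {e}"
  proof
    assume "p \<in> cl {e}"
    moreover have "p \<notin> cl {}" using p(3) cl_mono[of "{}" "{f}"] fE by auto
    ultimately have "e \<in> cl {p}" using parallel_sym[OF eE] by simp
    then have "e \<in> cl ?X" using cl_least[of "{p}" ?X] p(1) XE by auto
    moreover have "C - {e, f} = C - {f, e}" by auto
    ultimately show False using circuit_closure(1)[OF C(1,3,2)] C(4) by simp
  qed
  then show ?thesis using that p by simp
qed

text \<open>With \<open>triangleD\<close> this identifies triangles with triples of pairwise
  nonparallel elements of a line, the form used in \<open>gallai_colouring\<close>.\<close>

lemma triangleI:
  assumes xy: "x \<in> ground M" "y \<in> ground M" "z \<in> cl {x, y}" "y \<notin> cl {x}" "z \<notin> cl {x}" "z \<notin> cl {y}"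
  shows "mtriangle M {x, y, z}"
proof -
  have zE: "z \<in> ground M" using cl_in_ground[OF xy(3)] .
  have yE: "{y} \<subseteq> ground M" and xE: "{x} \<subseteq> ground M" using xy by auto
  have selfx: "x \<in> cl {x}" "y \<in> cl {y}" using subset_cl[OF xE] subset_cl[OF yE] by auto
  have x0: "x \<notin> cl {}"
  proof
    assume "x \<in> cl {}"
    then have "x \<in> cl {y}" using cl_mono[of "{}" "{y}"] yE by auto
    then have "cl {x, y} \<subseteq> cl {y}" using cl_least[of "{x, y}" "{y}"] yE selfx by simp
    then show False using xy by blast
  qed
  have y0: "y \<notin> cl {}" using xy(4) cl_mono[of "{}" "{x}"] xE by auto
  have d: "x \<noteq> y" "x \<noteq> z" "y \<noteq> z" using xy selfx by auto
  have i1: "indep M {x}" "indep M {y}" using indep_insert[of "{}"] indep_empty x0 y0 xy by simp_all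
  have i2: "indep M {y, x}" "indep M {z, x}" "indep M {z, y}"
    using indep_insert[OF i1(1), of y] indep_insert[OF i1(1), of z] indep_insert[OF i1(2), of z] xy zE d
      by auto
  have "\<not> indep M {z, x, y}"
    using indep_insert[of "{x, y}" z] i2(1) zE d xy(3) by (auto simp: insert_commute)
  then have "\<not> indep M {x, y, z}" by (simp add: insert_commute)
  moreover have "indep M X" if X: "X \<subset> {x, y, z}" for X
  proof -
    have "X \<subseteq> {y, x} \<or> X \<subseteq> {z, x} \<or> X \<subseteq> {z, y}" using X by blast
    then show ?thesis using i2 indep_mono by blast
  qed
  ultimately show ?thesis using xy zE d by (auto simp: mtriangle_def mcircuit_def)
qed

lemma triangleD:
  assumes "mtriangle M T" "T = {x, y, z}"
  shows "x \<in> ground M" "y \<notin> cl {x}" "z \<in> cl {x, y}" "x \<noteq> y" "x \<noteq> z" "y \<noteq> z" "z \<notin> cl {x}" "z \<notin> cl {y}"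
proof -
  have C: "mcircuit M {x, y, z}" and c3: "card {x, y, z} = 3" using assms by (auto simp: mtriangle_def)
  show d: "x \<noteq> y" "x \<noteq> z" "y \<noteq> z"
    using c3 by (auto simp: card_insert_if split: if_splits)
  show "x \<in> ground M" using C by (simp add: mcircuit_def)
  have diff: "{x, y, z} - {z, y} = {x}" "{x, y, z} - {y, z} = {x}" "{x, y, z} - {x, z} = {y}"
    using d by auto
  show "y \<notin> cl {x}" using circuit_closure(1)[OF C, of z y] d diff(1) by simp
  show "z \<in> cl {x, y}" using circuit_closure(2)[OF C, of z y] d diff(1) by (simp add: insert_commute)
  show "z \<notin> cl {x}" using circuit_closure(1)[OF C, of y z] d diff(2) by simp
  show "z \<notin> cl {y}" using circuit_closure(1)[OF C, of x z] d diff(3) by simp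
qed

lemma triangle_rank:
  assumes "mtriangle M T"
  shows "mrank M T = 2"
proof -
  obtain x y z where T: "T = {x, y, z}" using assms by (auto simp: mtriangle_def card_3_iff)
  note t = triangleD[OF assms T]
  have C: "mcircuit M T" "card T = 3" using assms by (auto simp: mtriangle_def)
  have "{x, y} \<subset> T" using T t(5,6) by auto
  then have "indep M {x, y}" using C(1) unfolding mcircuit_def by blast
  then have "mrank M {x, y} = 2" using indep_iff_rank[OF indep_subset_ground] t(4) by simp
  moreover have "mrank M {x, y, z} = mrank M {x, y}"
    using t(3) by (auto simp: rank_closure_def insert_commute)
  ultimately show ?thesis using T by simp
qed

text \<open>The line through two elements of a long circuit meets the flat spanned by the others in a point
  which, by its colour, either completes a rainbow triangle or shortens the rainbow circuit.\<close>

lemma rainbow_triangle_of_circuit: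
  "mcircuit M C \<Longrightarrow> 3 \<le> card C \<Longrightarrow> rainbow c C \<Longrightarrow> \<exists>T. mtriangle M T \<and> rainbow c T"
proof (induction "card C" arbitrary: C rule: less_induct)
  case less
  show ?case
  proof (cases "card C = 3")
    case True
    then show ?thesis using less.prems by (auto simp: mtriangle_def)
  next
    case False
    have CE: "C \<subseteq> ground M" using less.prems by (simp add: mcircuit_def)
    have finC: "finite C" using finite_subset[OF CE finite_ground] .
    have "C \<noteq> {}" using less.prems(2) by auto
    then obtain e where e: "e \<in> C" by blast
    have "card (C - {e}) \<noteq> 0" using less.prems(2) e finC by simp
    then have "C - {e} \<noteq> {}" by (metis card.empty)
    then obtain f where f: "f \<in> C" "e \<noteq> f" by blast
    let ?X = "C - {e, f}"
    have XE: "?X \<subseteq> ground M" and eE: "e \<in> ground M" and fE: "f \<in> ground M"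
      using CE e f by auto
    have proper: "indep M Y" if "Y \<subset> C" for Y using less.prems(1) that by (simp add: mcircuit_def)
    have cardX: "card ?X = card C - 2" using e f finC by (simp add: card_Diff_subset)
    have "{f, e} \<noteq> C" using less.prems(2) by (auto simp: card_insert_if split: if_splits)
    then have "indep M {f, e}" "indep M {f}" using e f by (intro proper; blast)+
    then have ef: "e \<notin> cl {f}" using indep_insert[of "{f}" e] eE f(2) by (simp add: insert_commute)
    obtain p where p: "p \<in> cl ?X" "p \<in> cl {e, f}" "p \<notin> cl {e}" "p \<notin> cl {f}" "e \<in> cl {p, f}"
      using circuit_point[OF less.prems(1) e f ef] .
    have pE: "p \<in> ground M" using cl_in_ground[OF p(1)] .
    show ?thesis
    proof (cases "c p = c e \<or> c p = c f")
      case False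
      have "f \<notin> cl {e}"
      proof
        assume "f \<in> cl {e}"
        then have "cl {e, f} \<subseteq> cl {e}"
          using cl_least[of "{e, f}" "{e}"] subset_cl[of "{e}"] eE by simp
        then show False using p by blast
      qed
      then have "mtriangle M {e, f, p}" using triangleI[OF eE fE p(2)] p by simp
      moreover have "c e \<noteq> c f" using less.prems(3) e f by (auto simp: rainbow_def inj_on_def)
      then have "rainbow c {e, f, p}" using False by (auto simp: rainbow_def inj_on_def)
      ultimately show ?thesis by blast
    next
      case True
      have pX: "p \<notin> ?X"
      proof
        assume "p \<in> ?X"
        then have pC: "p \<in> C" "p \<noteq> e" "p \<noteq> f" by auto
        have "card {e, p, f} \<le> 3" by (simp add: card_insert_if)
        then have "{e, p, f} \<noteq> C" using less.prems(2) \<open>card C \<noteq> 3\<close> by auto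
        then have "indep M {e, p, f}" "indep M {p, f}" using pC e f by (intro proper; blast)+
        then show False using indep_insert[of "{p, f}" e] eE p(5) pC(2) f(2) by auto
      qed
      have indX: "indep M ?X" using e by (intro proper) blast
      have "\<not> indep M (insert p ?X)" using indep_insert[OF indX pE pX] p(1) by simp
      moreover have "indep M Y" if Y: "Y \<subset> insert p ?X" for Y
      proof (cases "p \<in> Y")
        case False
        then have "Y \<subseteq> ?X" using Y by blast
        then show ?thesis by (rule indep_mono[OF indX])
      next
        case pY: True
        then obtain y where y: "y \<in> ?X" "Y \<subseteq> insert p (?X - {y})" using Y by blast
        have iy: "indep M (?X - {y})" by (rule indep_mono[OF indX]) blast
        \<comment> \<open>Otherwise \<open>e\<close> would be spanned by \<open>f\<close> and
          \<open>?X - {y}\<close>, although \<open>C - {y}\<close> is independent.\<close>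
        have "p \<notin> cl (?X - {y})"
        proof
          assume p': "p \<in> cl (?X - {y})"
          let ?Z = "insert f (?X - {y})"
          have ZE: "?Z \<subseteq> ground M" using XE fE by blast
          have "cl (?X - {y}) \<subseteq> cl ?Z" by (rule cl_mono[OF _ ZE]) blast
          then have "p \<in> cl ?Z" using p' by blast
          then have "cl {p, f} \<subseteq> cl ?Z" using cl_least[of "{p, f}" ?Z] ZE subset_cl[OF ZE] by simp
          then have "e \<in> cl ?Z" using p(5) by blast
          moreover have "indep M ?Z" "indep M (insert e ?Z)" using e f y by (intro proper; blast)+
          ultimately show False using indep_insert[of ?Z e] eE f by simp
        qed
        moreover have "p \<notin> ?X - {y}" using pX by blast
        ultimately have "indep M (insert p (?X - {y}))" using indep_insert[OF iy pE] by blast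
        then show ?thesis by (rule indep_mono[OF _ y(2)])
      qed
      ultimately have circ: "mcircuit M (insert p ?X)" using XE pE by (simp add: mcircuit_def)
      have "card (insert p ?X) = card C - 1" using pX finC cardX less.prems(2) by simp
      moreover have "card C - 1 < card C" "3 \<le> card C - 1"
        using False less.prems(2) \<open>card C \<noteq> 3\<close> by auto
      \<comment> \<open>\<open>p\<close> has the colour of \<open>e\<close> or \<open>f\<close>, and
        no remaining element has either.\<close>
      moreover have "rainbow c (insert p ?X)"
      proof -
        have inj: "inj_on c C" using less.prems(3) by (simp add: rainbow_def)
        then have "inj_on c ?X" by (rule inj_on_subset) blast
        moreover have "c p \<notin> c ` ?X" using True inj e f by (auto simp: inj_on_def)
        ultimately show ?thesis using pX by (simp add: rainbow_def)
      qed
      ultimately show ?thesis using less.hyps[of "insert p ?X"] circ by simp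
    qed
  qed
qed

end

section \<open>Lift-joins\<close>

lemma lift_joins_snoc: "cs \<noteq> [] \<Longrightarrow> lift_joins M (cs @ [d]) = lift_join M (lift_joins M cs) d"
  by (cases cs) auto

lemma finite_colours: "finite X \<Longrightarrow> finite (colours c X)"
proof -
  assume "finite X"
  moreover have "colours c X \<subseteq> (\<lambda>e. the (c e)) ` X" by (force simp: colours_def)
  ultimately show ?thesis using finite_surj by blast
qed

lemma card_rainbow_le:
  assumes "inj_on d T" "\<And>e. e \<in> T \<Longrightarrow> \<exists>k\<in>K. d e = Some k" "finite K"
  shows "card T \<le> card K"
proof -
  have "card T = card (d ` T)" using card_image[OF assms(1)] by simp
  also have "\<dots> \<le> card (Some ` K)" using assms(2,3) by (intro card_mono) force+
  also have "\<dots> = card K" by (simp add: card_image)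
  finally show ?thesis .
qed

context modular_matroid
begin

lemma finite_sub: "X \<subseteq> ground M \<Longrightarrow> finite X"
  using finite_subset[OF _ finite_ground] .

lemma rank_cl_Un:
  assumes "X \<subseteq> ground M" "Y \<subseteq> ground M"
  shows "mrank M (cl X \<union> Y) = mrank M (X \<union> Y)"
proof (rule antisym)
  have XY: "X \<union> Y \<subseteq> ground M" using assms by blast
  have "cl X \<subseteq> cl (X \<union> Y)" by (rule cl_mono[OF _ XY]) blast
  then show "mrank M (cl X \<union> Y) \<le> mrank M (X \<union> Y)"
    using subset_cl[OF XY] by (intro r_le_of_cl[OF _ XY]) blast
  show "mrank M (X \<union> Y) \<le> mrank M (cl X \<union> Y)"
    using subset_cl[OF assms(1)] by (intro rank_mono) blast
qed

text \<open>Write d and g for the ranks of \<open>D\<close> and \<open>G\<close>: modularity leaves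
  (d + 1) + g - (d + g) = 1. This is what makes the definite description in \<open>lift_join\<close>
  meaningful.\<close>

lemma skew_trace_rank:
  assumes D: "D \<subseteq> ground M" "cl D = D" and G: "G \<subseteq> ground M" "cl G = G"
    and skew: "mrank M (D \<union> G) = mrank M D + mrank M G"
    and e: "e \<in> cl (D \<union> G)" "e \<notin> D"
  shows "mrank M (cl (insert e D) \<inter> G) = 1"
proof -
  have eE: "e \<in> ground M" using cl_in_ground[OF e(1)] .
  have DG: "D \<union> G \<subseteq> ground M" and eD: "insert e D \<subseteq> ground M" using D G eE by auto
  have "mrank M (insert e D \<union> G) = mrank M (D \<union> G)" using e(1) by (simp add: rank_closure_def)
  moreover have "mrank M (insert e D) = Suc (mrank M D)" using r_insert[OF D(1) eE] D(2) e(2) by simp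
  moreover have "mrank M (insert e D \<union> G) + mrank M (cl (insert e D) \<inter> cl G) = mrank M (insert e D) + mrank M G"
    by (rule modular[OF eD G(1)])
  ultimately show ?thesis using skew G(2) by simp
qed

text \<open>This replaces the circuit conditions of \<open>simple_colouring\<close> by a rank
  condition that fits the trace of rank 1.\<close>

lemma simple_colouring_parallel:
  assumes d: "simple_colouring M d"
    and xy: "x \<in> dom d" "y \<in> dom d" "x \<in> ground M" "y \<in> ground M"
      and le: "mrank M {x, y} \<le> 1"
  shows "d x = d y"
proof (cases "x = y")
  case False
  have nl: "indep M {z}" if "z \<in> dom d" "z \<in> ground M" for z
  proof -
    have "\<not> mcircuit M {z}" using d that by (auto simp: simple_colouring_def mloop_def)
    moreover have "indep M X" if "X \<subset> {z}" for X
    proof -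
      have "X = {}" using that by blast
      then show ?thesis using indep_empty by simp
    qed
    ultimately show ?thesis using that(2) by (auto simp: mcircuit_def)
  qed
  have "indep M X" if X: "X \<subset> {x, y}" for X
  proof -
    have "X \<subseteq> {x} \<or> X \<subseteq> {y}" using X by blast
    then show ?thesis using indep_mono[OF nl[OF xy(1,3)]] indep_mono[OF nl[OF xy(2,4)]] by blast
  qed
  moreover have "\<not> indep M {x, y}" using indep_iff_rank[of "{x, y}"] xy le False by simp
  ultimately have "mparallel M x y" using False xy by (simp add: mparallel_def mcircuit_def)
  then show ?thesis using d xy(1,2) unfolding simple_colouring_def by blast
qed simp

text \<open>Outside \<open>D\<close> the lift-join only sees the colours of its second argument and is constant on
  \<open>cl (insert e D) - D\<close>, so a rainbow triangle would need three colours there.\<close>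

lemma lift_join_no_rainbow_triangle:
  assumes D: "D \<subseteq> ground M" "cl D = D" "dom d = D"
    and G: "G \<subseteq> ground M" "cl G = G" "dom d2 = G"
    and skew: "mrank M (D \<union> G) = mrank M D + mrank M G"
    and simple: "simple_colouring M d2" and two: "card (colours d2 G) \<le> 2"
    and IH: "\<And>T. T \<subseteq> D \<Longrightarrow> mtriangle M T \<Longrightarrow> \<not> rainbow d T"
  shows "dom (lift_join M d d2) = cl (D \<union> G)"
    and "T \<subseteq> cl (D \<union> G) \<Longrightarrow> mtriangle M T \<Longrightarrow> \<not> rainbow (lift_join M d d2) T"
proof -
  let ?d = "lift_join M d d2"
  have DG: "D \<union> G \<subseteq> ground M" using D G by blast
  have DL: "D \<subseteq> cl (D \<union> G)" using subset_cl[OF DG] by blast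
  show "dom ?d = cl (D \<union> G)"
    using DL D(3) G(3) by (auto simp: lift_join_def mcl_eq_rank_closure dom_def split: if_splits)
  have onD: "?d e = d e" if "e \<in> D" for e using that D(3) by (simp add: lift_join_def)
  \<comment> \<open>By \<open>offD\<close> the colour depends on \<open>e\<close> only through
    \<open>cl (insert e D)\<close>, which yields constancy on cosets of \<open>D\<close>.\<close>
  define h where "h X = (THE k. k \<in> colours d2 (X \<inter> G))" for X
  have offD: "?d e = Some (h (cl (insert e D)))" if "e \<in> cl (D \<union> G)" "e \<notin> D" for e
    using that D(3) G(3) by (simp add: lift_join_def mcl_eq_rank_closure h_def)
  have taken: "\<exists>k\<in>colours d2 G. ?d e = Some k"
    if e: "e \<in> cl (D \<union> G)" "e \<notin> D" for e
  proof -
    let ?L = "cl (insert e D) \<inter> G"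
    have r1: "mrank M ?L = 1" using skew_trace_rank[OF D(1,2) G(1,2) skew e] .
    then have "?L \<noteq> {}" using r_empty by auto
    then obtain x where x: "x \<in> ?L" by blast
    then obtain k where k: "d2 x = Some k" using G(3) by blast
    have same: "d2 y = Some k" if y: "y \<in> ?L" for y
    proof -
      have "{x, y} \<subseteq> ?L" using x y by blast
      then have "mrank M {x, y} \<le> 1" using rank_mono[of "{x, y}" ?L] r1 by linarith
      moreover have "x \<in> dom d2" "y \<in> dom d2" "x \<in> ground M" "y \<in> ground M"
        using x y G(1,3) by auto
      ultimately show ?thesis using simple_colouring_parallel[OF simple, of x y] k by simp
    qed
    have "h (cl (insert e D)) = k" unfolding h_def
      by (rule the_equality) (use x k same in \<open>auto simp: colours_def\<close>)
    moreover have "k \<in> colours d2 G" using x k by (auto simp: colours_def)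
    ultimately show ?thesis using offD[OF e] by simp
  qed
  assume T: "T \<subseteq> cl (D \<union> G)" "mtriangle M T"
  show "\<not> rainbow ?d T"
  proof
    assume "rainbow ?d T"
    then have inj: "inj_on ?d T" by (simp add: rainbow_def)
    have cT: "card T = 3" using T(2) by (simp add: mtriangle_def)
    show False
    proof (cases "T \<inter> D = {}")
      case True
      have "card T \<le> card (colours d2 G)"
      proof (rule card_rainbow_le[OF inj _ finite_colours[OF finite_sub[OF G(1)]]])
        show "\<exists>k\<in>colours d2 G. ?d e = Some k" if "e \<in> T" for e
          using taken[of e] that T(1) True by blast
      qed
      then show False using two cT by simp
    next
      case False
      then obtain x where x: "x \<in> T" "x \<in> D" by blast
      have "card (T - {x}) = 2" using cT x card_Diff_singleton[of x T] by simp
      then obtain y z where "T - {x} = {y, z}" by (auto simp: card_2_iff)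
      then have Tx: "T = {x, y, z}" using x by blast
      note t = triangleD[OF T(2) Tx]
      have xzy: "T = {x, z, y}" using Tx by auto
      note t' = triangleD[OF T(2) xzy]
      have yE: "y \<in> ground M" "z \<in> ground M" using T Tx cl_in_ground by auto
      \<comment> \<open>A flat with two elements of a triangle contains the third. So the triangle
        lies in \<open>D\<close>, or \<open>y\<close> and \<open>z\<close> are in one coset of
        \<open>D\<close> and agree in colour.\<close>
      have yz: "y \<in> D \<longleftrightarrow> z \<in> D"
        using cl_closed[OF D(2,1), of "{x, y}"] cl_closed[OF D(2,1), of "{x, z}"] t(3) t'(3) x(2) by blast
      show False
      proof (cases "y \<in> D")
        case True
        then have "T \<subseteq> D" using yz x Tx by blast
        moreover have "rainbow d T"
          using inj onD \<open>T \<subseteq> D\<close> unfolding rainbow_def by (metis inj_on_cong subsetD)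
        ultimately show False using IH T(2) by blast
      next
        case yD: False
        have yDE: "insert y D \<subseteq> ground M" using yE D by blast
        have "cl {x, y} \<subseteq> cl (insert y D)" by (rule cl_mono[OF _ yDE]) (use x in auto)
        then have "z \<in> cl (insert y D)" using t(3) by blast
        then have "cl (insert z D) = cl (insert y D)" using cl_insert_eq[OF D(1) yE(1)] yz yD D(2) by simp
        then have "?d y = ?d z" using offD[of y] offD[of z] T(1) Tx yz yD by auto
        then show False using inj t(6) Tx by (auto simp: inj_on_def)
      qed
    qed
  qed
qed

lemma rank_Union_le: "(\<And>F. F \<in> set Fs \<Longrightarrow> F \<subseteq> ground M) \<Longrightarrow> mrank M (\<Union>(set Fs)) \<le> (\<Sum>F\<leftarrow>Fs. mrank M F)"
proof (induction Fs)
  case Nil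
  then show ?case using r_empty by simp
next
  case (Cons F Fs)
  have "mrank M (F \<union> \<Union>(set Fs)) \<le> mrank M F + mrank M (\<Union>(set Fs))"
    using Cons.prems by (intro r_Un_le) auto
  moreover have "mrank M (\<Union>(set Fs)) \<le> (\<Sum>F\<leftarrow>Fs. mrank M F)" using Cons by simp
  ultimately show ?case by simp
qed

text \<open>Induction from the right follows \<open>foldl\<close>: the last factor is the right
  operand of the outermost lift-join. The domain is carried along because each step needs a
  colouring of a flat on the left.\<close>

lemma lift_joins_no_rainbow_triangle:
  assumes c: "dom c = ground M" and F: "mflat M F" "mrank M F = 1 \<or> card (colours c F) \<le> 2"
  shows "(\<forall>G\<in>set Gs. mflat M G \<and> simple_colouring M (c |` G) \<and> card (colours c G) \<le> 2) \<Longrightarrow>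
    mutually_skew M (F # Gs) \<Longrightarrow>
    dom (lift_joins M (map (\<lambda>F. c |` F) (F # Gs))) = cl (\<Union>(set (F # Gs))) \<and>
    (\<forall>T\<subseteq>cl (\<Union>(set (F # Gs))). mtriangle M T \<longrightarrow> \<not> rainbow (lift_joins M (map (\<lambda>F. c |` F) (F # Gs))) T)"
proof (induction Gs rule: rev_induct)
  case Nil
  have FE: "F \<subseteq> ground M" "cl F = F" using F by (auto simp: mflat_iff)
  have "\<not> rainbow (c |` F) T" if T: "T \<subseteq> F" "mtriangle M T" for T
  proof
    assume "rainbow (c |` F) T"
    then have inj: "inj_on (c |` F) T" by (simp add: rainbow_def)
    \<comment> \<open>A triangle has rank 2, so a flat of rank 1 may have arbitrarily many
      colours.\<close>
    have "mrank M F \<noteq> 1" using rank_mono[OF T(1)] triangle_rank[OF T(2)] by simp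
    then have two: "card (colours c F) \<le> 2" using F by simp
    have "card T \<le> card (colours c F)"
    proof (rule card_rainbow_le[OF inj _ finite_colours[OF finite_sub[OF FE(1)]]])
      show "\<exists>k\<in>colours c F. (c |` F) e = Some k" if "e \<in> T" for e
      proof -
        have "e \<in> F" "e \<in> dom c" using that T FE c by auto
        then show ?thesis by (auto simp: colours_def)
      qed
    qed
    then show False using two T by (simp add: mtriangle_def)
  qed
  then show ?case using FE c by auto
next
  case (snoc G Gs)
  let ?U = "\<Union>(set (F # Gs))" and ?d = "lift_joins M (map (\<lambda>F. c |` F) (F # Gs))"
  have G: "G \<subseteq> ground M" "cl G = G" and simple: "simple_colouring M (c |` G)"
    and two: "card (colours c G) \<le> 2"
    using snoc.prems(1) by (auto simp: mflat_iff)
  have sub: "X \<subseteq> ground M" if "X \<in> set (F # Gs)" for X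
    using that F snoc.prems(1) by (auto simp: mflat_iff)
  then have UE: "?U \<subseteq> ground M" by blast
  have "mrank M (?U \<union> G) = (\<Sum>F\<leftarrow>F # Gs. mrank M F) + mrank M G"
    using snoc.prems(2) by (simp add: mutually_skew_def Un_ac)
  moreover have "mrank M (?U \<union> G) \<le> mrank M ?U + mrank M G" by (rule r_Un_le[OF UE G(1)])
  moreover have "mrank M ?U \<le> (\<Sum>F\<leftarrow>F # Gs. mrank M F)"
    using rank_Union_le[of "F # Gs"] sub by blast
  \<comment> \<open>Rank is subadditive, so equality for the whole list forces equality for its
    initial part.\<close>
  ultimately have skew: "mrank M ?U = (\<Sum>F\<leftarrow>F # Gs. mrank M F)" "mrank M (?U \<union> G) = mrank M ?U + mrank M G"
    by linarith+
  have "mutually_skew M (F # Gs)" using skew(1) by (simp add: mutually_skew_def)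
  then have IH: "dom ?d = cl ?U" "\<And>T. T \<subseteq> cl ?U \<Longrightarrow> mtriangle M T \<Longrightarrow> \<not> rainbow ?d T"
    using snoc.IH snoc.prems(1) by auto
  have skew': "mrank M (cl ?U \<union> G) = mrank M (cl ?U) + mrank M G"
    using skew(2) rank_cl_Un[OF UE G(1)] r_cl[OF UE] by simp
  have domG: "dom (c |` G) = G" using G c by auto
  have "colours (c |` G) G = colours c G" by (auto simp: colours_def)
  then have two': "card (colours (c |` G) G) \<le> 2" using two by simp
  note step = lift_join_no_rainbow_triangle[OF cl_subset cl_cl[OF UE] IH(1) G domG skew' simple two' IH(2)]
  have "cl (cl ?U \<union> G) = cl (?U \<union> G)"
  proof
    have UG: "?U \<union> G \<subseteq> ground M" using UE G by blast
    have "cl ?U \<subseteq> cl (?U \<union> G)" by (rule cl_mono[OF _ UG]) blast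
    then show "cl (cl ?U \<union> G) \<subseteq> cl (?U \<union> G)"
      using subset_cl[OF UG] by (intro cl_least[OF _ UG]) blast
    have "cl ?U \<union> G \<subseteq> ground M" using cl_subset G by blast
    then show "cl (?U \<union> G) \<subseteq> cl (cl ?U \<union> G)"
      using subset_cl[OF UE] by (intro cl_mono) blast+
  qed
  moreover have "\<Union>(set (F # Gs @ [G])) = ?U \<union> G" by auto
  moreover have "lift_joins M (map (\<lambda>F. c |` F) (F # Gs @ [G])) = lift_join M ?d (c |` G)"
    using lift_joins_snoc[of "map (\<lambda>F. c |` F) (F # Gs)" M "c |` G"] by simp
  ultimately show ?case using step by simp
qed

end

section \<open>Decompositions\<close>

context modular_matroid
begin

text \<open>Take a subset of \<open>F\<close> of greatest rank among those skew to \<open>H\<close>: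
  an element of \<open>F\<close> not spanned by it and \<open>H\<close> could be added. Then pass to
  the closure.\<close>

lemma complement_exists:
  assumes H: "H \<subseteq> F" and F: "F \<subseteq> ground M" "cl F = F"
  obtains G where "G \<subseteq> F" "cl G = G" "mrank M (H \<union> G) = mrank M H + mrank M G" "mrank M (H \<union> G) = mrank M F"
proof -
  have HE: "H \<subseteq> ground M" using H F by blast
  define P where "P G \<longleftrightarrow> G \<subseteq> F \<and> mrank M (H \<union> G) = mrank M H + mrank M G" for G
  have P0: "P {}" using r_empty by (simp add: P_def)
  have bound: "\<forall>G. P G \<longrightarrow> mrank M G < Suc (mrank M F)"
    using rank_mono by (simp add: P_def less_Suc_eq_le)
  from ex_has_greatest_nat[OF P0 bound]
  obtain X where "P X \<and> (\<forall>G. P G \<longrightarrow> mrank M G \<le> mrank M X)" by (rule exE)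
  then have X: "X \<subseteq> F" "mrank M (H \<union> X) = mrank M H + mrank M X"
    and max: "\<And>G. P G \<Longrightarrow> mrank M G \<le> mrank M X" by (auto simp: P_def)
  have XE: "X \<subseteq> ground M" and HX: "H \<union> X \<subseteq> ground M" using X(1) F HE by auto
  have "F \<subseteq> cl (H \<union> X)"
  proof
    fix e assume e: "e \<in> F"
    have eE: "e \<in> ground M" using e F by blast
    show "e \<in> cl (H \<union> X)"
    proof (rule ccontr)
      assume "e \<notin> cl (H \<union> X)"
      then have "mrank M (H \<union> insert e X) = Suc (mrank M (H \<union> X))"
        using r_insert[OF HX eE] by simp
      moreover have "mrank M (insert e X) \<le> Suc (mrank M X)" by (rule r_insert_le[OF XE eE])
      moreover have "mrank M (H \<union> insert e X) \<le> mrank M H + mrank M (insert e X)"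
        using r_Un_le[of H "insert e X"] HE XE eE by simp
      ultimately have *: "mrank M (insert e X) = Suc (mrank M X)" "mrank M (H \<union> insert e X) = mrank M H + mrank M (insert e X)"
        using X(2) by linarith+
      then have "P (insert e X)" using X(1) e by (simp add: P_def)
      then show False using max *(1) by fastforce
    qed
  qed
  then have rF: "mrank M (H \<union> X) = mrank M F"
    using r_le_of_cl[OF _ HX, of F] rank_mono[of "H \<union> X" F] X(1) H by simp
  have rG: "mrank M (H \<union> cl X) = mrank M (H \<union> X)"
    using rank_cl_Un[OF XE HE] by (simp add: Un_commute)
  show ?thesis
  proof (rule that[of "cl X"])
    show "cl X \<subseteq> F" by (rule cl_closed[OF F(2,1) X(1)])
    show "cl (cl X) = cl X" by (rule cl_cl[OF XE])
    show "mrank M (H \<union> cl X) = mrank M H + mrank M (cl X)" using rG X(2) r_cl[OF XE] by simp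
    show "mrank M (H \<union> cl X) = mrank M F" using rG rF by simp
  qed
qed

end

locale connected_modular_matroid = modular_matroid +
  assumes connected: "mconnected M"

sublocale connected_modular_matroid \<subseteq> projective_rank "ground M" "mrank M"
proof
  fix e f
  assume ef: "e \<in> ground M" "f \<in> ground M" "e \<notin> cl {f}" "f \<notin> cl {e}"
  have "e \<noteq> f" using ef subset_cl[of "{e}"] by auto
  then obtain C where "mcircuit M C" "e \<in> C" "f \<in> C"
    using connected ef unfolding mconnected_def by blast
  from circuit_point[OF this \<open>e \<noteq> f\<close> ef(3)]
  show "\<exists>g\<in>cl {e, f}. g \<notin> cl {e} \<and> g \<notin> cl {f}" by blast
qed

context connected_modular_matroid
begin

text \<open>A circuit through the loop and another element would properly contain the circuit
  \<open>{e}\<close>.\<close>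

lemma ground_of_loop:
  assumes "e \<in> cl {}"
  shows "ground M = {e}"
proof -
  have eE: "e \<in> ground M" using cl_in_ground[OF assms] .
  have "f = e" if f: "f \<in> ground M" for f
  proof (rule ccontr)
    assume "f \<noteq> e"
    then obtain C where C: "mcircuit M C" "e \<in> C" "f \<in> C"
      using connected f eE unfolding mconnected_def by blast
    then have "{e} \<subset> C" using \<open>f \<noteq> e\<close> by blast
    then have "indep M {e}" using C(1) unfolding mcircuit_def by blast
    then show False using indep_insert[OF indep_empty eE] assms by simp
  qed
  then show ?thesis using eE by blast
qed

lemma colours_eq_image:
  assumes "dom c = ground M" "X \<subseteq> ground M"
  shows "colours c X = (\<lambda>e. the (c e)) ` X"
proof -
  have "c e = Some (the (c e))" if "e \<in> X" for e
    using that assms by (metis domIff option.collapse subsetD)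
  then show ?thesis unfolding colours_def by (auto simp: image_iff) (metis option.inject)
qed

text \<open>By \<open>inv\<close> the elements of \<open>cl (insert e H) - H\<close> share the
  colour of \<open>e\<close>. The trace of this coset on \<open>G\<close> is nonempty and avoids
  \<open>H\<close>, so the lift-join reads off \<open>c e\<close>.\<close>

lemma lift_join_restrict:
  assumes c: "dom c = ground M" and loopless: "cl {} = {}"
    and F: "F \<subseteq> ground M" "cl F = F" and H: "H \<subseteq> F" "cl H = H"
      and G: "G \<subseteq> F" "cl G = G"
    and skew: "mrank M (H \<union> G) = mrank M H + mrank M G" "mrank M (H \<union> G) = mrank M F"
    and inv: "\<And>e e'. e \<in> F - H \<Longrightarrow> e' \<in> cl (insert e H) - H \<Longrightarrow> c e' = c e"
  shows "H \<inter> G = {}" and "lift_join M (c |` H) (c |` G) = c |` F"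
proof -
  have HE: "H \<subseteq> ground M" and GE: "G \<subseteq> ground M"
    and HG: "H \<union> G \<subseteq> F" "H \<union> G \<subseteq> ground M" using H G F by auto
  have dH: "dom (c |` H) = H" and dG: "dom (c |` G) = G" using c HE GE by auto
  have "cl (H \<union> G) = cl F" by (rule flat_eq[OF _ F(1) skew(2)]) (use HG F in simp)
  then have FHG: "cl (H \<union> G) = F" using F by simp
  have "mrank M (H \<inter> G) = 0" using modular[OF HE GE] skew(1) H G by simp
  then show HG0: "H \<inter> G = {}"
  proof (rule contrapos_pp)
    assume "H \<inter> G \<noteq> {}"
    then obtain x where x: "x \<in> H \<inter> G" by blast
    then have "mrank M {x} = 1" using r_insert[of "{}" x] loopless HE r_empty by auto
    then show "mrank M (H \<inter> G) \<noteq> 0" using rank_mono[of "{x}" "H \<inter> G"] x by simp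
  qed
  show "lift_join M (c |` H) (c |` G) = c |` F"
  proof
    fix e
    consider "e \<in> H" | "e \<in> F" "e \<notin> H" | "e \<notin> F" by blast
    then show "lift_join M (c |` H) (c |` G) e = (c |` F) e"
    proof cases
      case 1
      then show ?thesis using dH H by (auto simp: lift_join_def)
    next
      case 2
      then obtain k where k: "c e = Some k" using c F by blast
      let ?L = "cl (insert e H) \<inter> G"
      have "mrank M ?L = 1" using skew_trace_rank[OF HE H(2) GE G(2) skew(1)] FHG 2 by simp
      then have "?L \<noteq> {}" using r_empty by auto
      moreover have same: "c x = Some k" if "x \<in> ?L" for x using inv[of e x] 2 that HG0 k by auto
      ultimately have "colours (c |` G) ?L = {k}" by (auto simp: colours_def)
      then show ?thesis using 2 k dH dG FHG by (simp add: lift_join_def mcl_eq_rank_closure)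
    next
      case 3
      then show ?thesis using dH dG FHG H by (auto simp: lift_join_def mcl_eq_rank_closure)
    qed
  qed
qed

text \<open>A flat that can itself be a first factor is left alone; failing this, it has rank at
  least 2 and at least three colours, as \<open>invariant_decomposition\<close> requires. The list
  is claimed nonempty for \<open>lift_joins_snoc\<close>, and spanning so that the complement of
  \<open>H\<close> is skew to all its members together.\<close>

lemma decomposition:
  assumes c: "dom c = ground M" and loopless: "cl {} = {}"
    and no_rainbow: "\<And>T. mtriangle M T \<Longrightarrow> \<not> rainbow c T"
  shows "mflat M F \<Longrightarrow> F \<noteq> {} \<Longrightarrow> \<exists>Fs. Fs \<noteq> [] \<and> (\<forall>X\<in>set Fs. mflat M X \<and> X \<noteq> {}) \<and> mutually_skew M Fs \<and>
    cl (\<Union>(set Fs)) = F \<and> c |` F = lift_joins M (map (\<lambda>F. c |` F) Fs) \<and>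
    (\<forall>X\<in>set (tl Fs). simple_colouring M (c |` X) \<and> card (colours c X) \<le> 2) \<and>
    (mrank M (hd Fs) = 1 \<or> card (colours c (hd Fs)) \<le> 2)"
proof (induction "mrank M F" arbitrary: F rule: less_induct)
  case less
  have F: "F \<subseteq> ground M" "cl F = F" using less.prems by (auto simp: mflat_iff)
  show ?case
  proof (cases "mrank M F = 1 \<or> card (colours c F) \<le> 2")
    case True
    then show ?thesis using less.prems F by (intro exI[of _ "[F]"]) (simp add: mutually_skew_def)
  next
    case False
    let ?g = "\<lambda>e. the (c e)"
    have ce: "c e = Some (?g e)" if "e \<in> ground M" for e using that c by (metis domIff option.collapse)
    note Fcl = restriction(2)[OF F]
    interpret R: projective_rank F "mrank M" by (rule restriction(1)[OF F])
    interpret R: gallai_colouring F "mrank M" ?g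
    proof
      show "R.cl {} = {}" using Fcl[of "{}"] loopless by simp
      fix x y z assume xyz: "x \<in> F" "y \<in> F" "z \<in> R.cl {x, y}" "y \<notin> R.cl {x}" "z \<notin> R.cl {x}" "z \<notin> R.cl {y}"
      have E: "x \<in> ground M" "y \<in> ground M" "z \<in> ground M"
        using xyz F R.cl_in_ground[OF xyz(3)] by auto
      have tri: "mtriangle M {x, y, z}"
        using triangleI[OF E(1,2)] xyz Fcl[of "{x, y}"] Fcl[of "{x}"] Fcl[of "{y}"] by simp
      have "\<not> inj_on c {x, y, z}" using no_rainbow[OF tri] unfolding rainbow_def .
      then show "?g x = ?g y \<or> ?g x = ?g z \<or> ?g y = ?g z"
        using ce[OF E(1)] ce[OF E(2)] ce[OF E(3)] by (auto simp: inj_on_def)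
    qed
    obtain x where x: "x \<in> F" using less.prems by blast
    have "mrank M {x} = 1" using r_insert[of "{}" x] x F loopless r_empty by auto
    then have "mrank M F \<ge> 1" using rank_mono[of "{x}" F] x by simp
    then have rank2: "mrank M F \<ge> 2" using False by simp
    have card3: "card (?g ` F) \<ge> 3" using False colours_eq_image[OF c F(1)] by simp
    obtain H where H: "R.invariant_flat H" "H \<noteq> {}" "card (?g ` (F - H)) \<le> 2"
      using R.invariant_decomposition[OF rank2 card3] .
    have HF: "H \<subseteq> F" "H \<noteq> F" "cl H = H"
      using H(1) Fcl[of H] unfolding R.invariant_flat_def by auto
    have HE: "H \<subseteq> ground M" using HF F by blast
    have inv: "c e' = c e" if e: "e \<in> F - H" "e' \<in> cl (insert e H) - H" for e e'
    proof -
      have "insert e H \<subseteq> F" using e HF by blast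
      then have "?g e' = ?g e" using R.invariant_flatD[OF H(1) e(1), of e'] e(2) Fcl[of "insert e H"] by simp
      then show ?thesis using ce[of e] ce[of e'] e F cl_in_ground[of e' "insert e H"] by auto
    qed
    have "mrank M H \<noteq> mrank M F"
    proof
      assume eq: "mrank M H = mrank M F"
      have "H \<subseteq> cl F" using HF F by simp
      from flat_eq[OF this F(1) eq] show False using HF F by simp
    qed
    then have less': "mrank M H < mrank M F" using rank_mono[OF HF(1)] by simp
    have "mflat M H" using HE HF by (simp add: mflat_iff)
    from less.hyps[OF less' this H(2)]
    obtain Fs where Fs: "Fs \<noteq> []" "\<forall>X\<in>set Fs. mflat M X \<and> X \<noteq> {}" "mutually_skew M Fs" "cl (\<Union>(set Fs)) = H"
      "c |` H = lift_joins M (map (\<lambda>F. c |` F) Fs)"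
      "\<forall>X\<in>set (tl Fs). simple_colouring M (c |` X) \<and> card (colours c X) \<le> 2"
      "mrank M (hd Fs) = 1 \<or> card (colours c (hd Fs)) \<le> 2" by blast
    obtain G where G: "G \<subseteq> F" "cl G = G" "mrank M (H \<union> G) = mrank M H + mrank M G" "mrank M (H \<union> G) = mrank M F"
      using complement_exists[OF HF(1) F] .
    have GE: "G \<subseteq> ground M" using G F by blast
    note join = lift_join_restrict[OF c loopless F HF(1,3) G inv]
    have Gne: "G \<noteq> {}" using G(4) less' by auto
    have GH: "G \<subseteq> F - H" using G join(1) by blast
    have "colours c G \<subseteq> ?g ` (F - H)" using colours_eq_image[OF c GE] GH by blast
    then have two: "card (colours c G) \<le> 2"
      using card_mono[of "?g ` (F - H)" "colours c G"] finite_sub[OF F(1)] H(3) by simp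
    have dG: "dom (c |` G) = G" using c GE by auto
    \<comment> \<open>Parallel elements of \<open>G\<close> are in the same coset of
      \<open>H\<close>, where \<open>c\<close> is constant.\<close>
    have simple: "simple_colouring M (c |` G)" unfolding simple_colouring_def dG
    proof (intro conjI ballI impI)
      fix e assume "e \<in> G"
      then have "e \<in> ground M" using GE by blast
      then have "indep M {e}" using indep_insert[OF indep_empty] loopless by simp
      then show "\<not> mloop M e" by (simp add: mloop_def mcircuit_def)
    next
      fix e f assume ef: "e \<in> G" "f \<in> G" "mparallel M e f"
      have "mcircuit M {e, f}" "e \<noteq> f" using ef(3) by (auto simp: mparallel_def)
      from circuit_closure(2)[OF this(1), of f e] this(2) have "f \<in> cl {e}" by (simp add: insert_commute)
      moreover have "cl {e} \<subseteq> cl (insert e H)" using ef GE HE by (intro cl_mono) auto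
      ultimately have "c f = c e" using inv[of e f] ef GH by blast
      then show "(c |` G) e = (c |` G) f" using ef by simp
    qed
    let ?U = "\<Union>(set Fs)"
    have UE: "?U \<subseteq> ground M" using Fs(2) by (auto simp: mflat_iff)
    have rU: "mrank M (?U \<union> G) = mrank M (H \<union> G)" using rank_cl_Un[OF UE GE] Fs(4) by simp
    have "mrank M ?U = mrank M H" using r_cl[OF UE] Fs(4) by simp
    then have skew: "mutually_skew M (Fs @ [G])"
      using Fs(3) rU G(3) by (simp add: mutually_skew_def Un_commute)
    have UG: "?U \<union> G \<subseteq> ground M" "?U \<union> G \<subseteq> F"
      using UE GE subset_cl[OF UE] Fs(4) HF G by auto
    have span: "cl (?U \<union> G) = F"
      using flat_eq[of "?U \<union> G" F] UG F rU G(4) by simp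
    have lj: "c |` F = lift_joins M (map (\<lambda>F. c |` F) (Fs @ [G]))"
      using lift_joins_snoc[of "map (\<lambda>F. c |` F) Fs" M "c |` G"] Fs(1,5) join(2) by simp
    have mG: "mflat M G \<and> G \<noteq> {}" using GE G(2) Gne by (simp add: mflat_iff)
    show ?thesis
    proof (intro exI[of _ "Fs @ [G]"] conjI)
      show "\<forall>X\<in>set (Fs @ [G]). mflat M X \<and> X \<noteq> {}" using Fs(2) mG by simp
      show "cl (\<Union>(set (Fs @ [G]))) = F" using span by (simp add: Un_commute)
      show "\<forall>X\<in>set (tl (Fs @ [G])). simple_colouring M (c |` X) \<and> card (colours c X) \<le> 2"
        using Fs(1,6) simple two by simp
      show "mrank M (hd (Fs @ [G])) = 1 \<or> card (colours c (hd (Fs @ [G]))) \<le> 2" using Fs(1,7) by simp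
    qed (use skew lj in simp_all)
  qed
qed

lemma decomposition_exists:
  assumes c: "dom c = ground M" and no_rainbow: "\<And>T. mtriangle M T \<Longrightarrow> \<not> rainbow c T"
  shows "\<exists>Fs. (\<forall>F\<in>set Fs. mflat M F \<and> F \<noteq> {}) \<and> mutually_skew M Fs \<and>
    c = lift_joins M (map (\<lambda>F. c |` F) Fs) \<and>
    (\<forall>F\<in>set (tl Fs). simple_colouring M (c |` F) \<and> card (colours c F) \<le> 2) \<and>
    (Fs \<noteq> [] \<longrightarrow> mrank M (hd Fs) = 1 \<or> card (colours c (hd Fs)) \<le> 2)"
proof -
  have clE': "cl (ground M) = ground M" using subset_cl[of "ground M"] cl_subset by blast
  have cE: "c |` ground M = c"
  proof
    show "(c |` ground M) e = c e" for e using domIff[of e c] unfolding c restrict_map_def by simp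
  qed
  have mE: "mflat M (ground M)" using clE' by (simp add: mflat_iff)
  \<comment> \<open>Factors are nonempty, so the empty ground set needs the empty list. A loop makes
    the ground set a single element, for which one factor with one colour is enough.\<close>
  consider "ground M = {}" | e where "e \<in> cl {}" | "ground M \<noteq> {}" "cl {} = {}" by blast
  then show ?thesis
  proof cases
    case 1
    then show ?thesis using c r_empty by (intro exI[of _ "[]"]) (simp add: mutually_skew_def)
  next
    case 2
    then have E: "ground M = {e}" by (rule ground_of_loop)
    have "card (colours c (ground M)) \<le> card (ground M)"
      unfolding colours_eq_image[OF c subset_refl] by (rule card_image_le[OF finite_ground])
    then show ?thesis using cE mE E by (intro exI[of _ "[ground M]"]) (simp add: mutually_skew_def)
  next
    case 3
    have "\<exists>Fs. Fs \<noteq> [] \<and> (\<forall>X\<in>set Fs. mflat M X \<and> X \<noteq> {}) \<and> mutually_skew M Fs \<and>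
      cl (\<Union>(set Fs)) = ground M \<and> c |` ground M = lift_joins M (map (\<lambda>F. c |` F) Fs) \<and>
      (\<forall>X\<in>set (tl Fs). simple_colouring M (c |` X) \<and> card (colours c X) \<le> 2) \<and>
      (mrank M (hd Fs) = 1 \<or> card (colours c (hd Fs)) \<le> 2)"
      by (rule decomposition[OF c 3(2) _ mE 3(1)]) (rule no_rainbow)
    then show ?thesis unfolding cE by (elim exE conjE) (intro exI conjI impI; assumption)
  qed
qed

end

section \<open>Equivalence of the three conditions\<close>

theorem theorem6p7:
  fixes M :: "'a matroid" and c :: "'a \<rightharpoonup> 'c"
  assumes "coloured_matroid M c"
    and "mconnected M"
    and "mmodular M"
  shows "((\<not> (\<exists>T. mtriangle M T \<and> rainbow c T)) \<longleftrightarrow>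
          (\<not> (\<exists>C. mcircuit M C \<and> card C \<ge> 3 \<and> rainbow c C)))
       \<and> ((\<not> (\<exists>C. mcircuit M C \<and> card C \<ge> 3 \<and> rainbow c C)) \<longleftrightarrow>
          (\<exists>Fs. (\<forall>F\<in>set Fs. mflat M F \<and> F \<noteq> {}) \<and>
                mutually_skew M Fs \<and>
                c = lift_joins M (map (\<lambda>F. c |` F) Fs) \<and>
                (\<forall>F\<in>set (tl Fs). simple_colouring M (c |` F) \<and> card (colours c F) \<le> 2) \<and>
                (Fs \<noteq> [] \<longrightarrow> mrank M (hd Fs) = 1 \<or> card (colours c (hd Fs)) \<le> 2)))"
    (is "(?i \<longleftrightarrow> ?ii) \<and> (?ii \<longleftrightarrow> ?iii)")
proof -
  have "matroid M" and c: "dom c = ground M" using assms(1) by (auto simp: coloured_matroid_def)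
  then interpret connected_modular_matroid M
    using assms(2,3) by (simp add: connected_modular_matroid_def connected_modular_matroid_axioms_def
        modular_matroid_def modular_matroid_axioms_def)
  have i_ii: "?i \<longleftrightarrow> ?ii"
    using rainbow_triangle_of_circuit[of _ c] by (metis mtriangle_def order_refl)
  moreover have "?iii" if ?i
    using decomposition_exists[OF c] that by blast
  moreover have "?i" if iii: ?iii
  proof
    assume "\<exists>T. mtriangle M T \<and> rainbow c T"
    then obtain T where T: "mtriangle M T" "rainbow c T" by blast
    obtain Fs where Fs: "\<forall>F\<in>set Fs. mflat M F \<and> F \<noteq> {}" "mutually_skew M Fs"
      "c = lift_joins M (map (\<lambda>F. c |` F) Fs)"
      "\<forall>F\<in>set (tl Fs). simple_colouring M (c |` F) \<and> card (colours c F) \<le> 2"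
      "Fs \<noteq> [] \<longrightarrow> mrank M (hd Fs) = 1 \<or> card (colours c (hd Fs)) \<le> 2"
      using iii by (elim exE conjE)
    have TE: "T \<subseteq> ground M" and T3: "card T = 3"
      using T(1) by (auto simp: mtriangle_def mcircuit_def)
    show False
    proof (cases Fs)
      case Nil
      then have "c = Map.empty" using Fs(3) by simp
      then have "ground M = {}" using c by simp
      then show False using TE T3 by simp
    next
      case (Cons F Gs)
      have "\<forall>G\<in>set Gs. mflat M G \<and> simple_colouring M (c |` G) \<and> card (colours c G) \<le> 2"
        using Fs(1,4) Cons by simp
      moreover have "mutually_skew M (F # Gs)" using Fs(2) Cons by simp
      moreover have "mflat M F" "mrank M F = 1 \<or> card (colours c F) \<le> 2"
        using Fs(1,5) Cons by simp_all
      ultimately have "dom c = cl (\<Union>(set Fs)) \<and> (\<forall>T\<subseteq>cl (\<Union>(set Fs)). mtriangle M T \<longrightarrow> \<not> rainbow c T)"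
        using lift_joins_no_rainbow_triangle[OF c, of F Gs] Fs(3) Cons by simp
      \<comment> \<open>The domain of \<open>c\<close> is the ground set, so the span of the factors
        contains every triangle.\<close>
      then show False using T TE c by simp
    qed
  qed
  ultimately show ?thesis by blast
qed

end
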